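(* Let $0<q\le 2$, let $k,n$ be integers with $1\le k<n$, let $X=(X_1,\dots,X_n)$ be a symmetric $q$-stable random vector in $\mathbb{R}^n$, and let $Y=(Y_1,\dots,Y_n)$ be the symmetric $q$-stable random vector such that $(Y_1,\dots,Y_k)$ has the same distribution as $(X_1,\dots,X_k)$, $(Y_{k+1},\dots,Y_n)$ has the same distribution as $(X_{k+1},\dots,X_n)$, and $Y_i$ and $Y_j$ are independent for every $1\le i\le k$, $k+1\le j\le n$. Let $B=(\mathbb{R}^n,\|\cdot\|)$ be a homogeneous space and let $0<p<n$. Consider the symmetry condition $$( * )\qquad \|(u,v)\|=\|(u,-v)\|\quad\text{for all }u\in\mathbb{R}^k,\ v\in\mathbb{R}^{n-k}.$$ Then the inequality $$\mathbb{E}\big(\|X\|^{-p}\big)\ \ge\ \mathbb{E}\big(\|Y\|^{-p}\big)$$ holds in each of the following cases: (i) $B$ is any $n$-dimensional homogeneous space satisfying $( * )$, and $p\in[n-1,n)$; (ii) $B$ is an $n$-dimensional subspace of $L_r$ with $0<r\le 2$ satisfying $( * )$, and $p$ is any number from $(0,n)$; (iii) $B=\ell_\rho^n$ with $n\ge 3$, $2<\rho\le\infty$, and $p\in[n-3,n)$.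
   Context: Symmetric $q$-stable vector: $X$ is a symmetric $q$-stable random vector in $\mathbb{R}^n$ ($0<q\le 2$) if its characteristic functional has the form $\phi(\xi)=\exp\big(-\|\sum_{i=1}^n\xi_is_i\|_q^q\big)$, $\xi\in\mathbb{R}^n$, for some real-valued $s_1,\dots,s_n\in L_q([0,1])$, where $\|s\|_q^q=\int_0^1|s|^q$. With this notation the vector $Y$ has characteristic functional $\phi_0(\xi)=\exp\big(-\|\sum_{i=1}^k\xi_is_i\|_q^q-\|\sum_{i=k+1}^n\xi_is_i\|_q^q\big)$. Expectations of the non-negative quantities are understood in $[0,+\infty]$, with $0^{-p}=+\infty$. A homogeneous $n$-dimensional space $B=(\mathbb{R}^n,\|\cdot\|)$ is $\mathbb{R}^n$ together with a continuous function $x\mapsto\|x\|$ that is homogeneous of degree 1 ($\|tx\|=|t|\,\|x\|$ for all $t\in\mathbb{R}$, $x\in\mathbb{R}^n$) and positive outside the origin. "$B$ is an $n$-dimensional subspace of $L_r$" means that there is a linear map $T$ from $\mathbb{R}^n$ into a real space $L_r$ (e.g. $L_r([0,1])$) with $\|x\|=\|Tx\|_{L_r}$ for all $x$, where $\|f\|_{L_r}=(\int|f|^r)^{1/r}$ (a quasi-norm if $r<1$). $\ell_\rho^n$ is $\mathbb{R}^n$ with $\|x\|_\rho=(\sum_{i}|x_i|^\rho)^{1/\rho}$ for $\rho<\infty$ and $\|x\|_\infty=\max_i|x_i|$. *)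

theory Defs
  imports "HOL-Probability.Probability"
begin

text \<open>The space \<open>L\<^sub>r(\<mu>)\<close> is represented by representatives; elements are identified
  almost everywhere.\<close>

definition in_Lp :: "real \<Rightarrow> 't measure \<Rightarrow> ('t \<Rightarrow> real) \<Rightarrow> bool" where
  "in_Lp r \<mu> f \<longleftrightarrow> f \<in> borel_measurable \<mu> \<and> integrable \<mu> (\<lambda>t. \<bar>f t\<bar> powr r)"

definition Lp_norm :: "real \<Rightarrow> 't measure \<Rightarrow> ('t \<Rightarrow> real) \<Rightarrow> real" where
  "Lp_norm r \<mu> f = (LINT t|\<mu>. \<bar>f t\<bar> powr r) powr (1 / r)"

text \<open>Coordinates are taken with respect to \<open>Basis\<close>, which in \<open>real ^ 'n\<close> and in
  \<open>(real ^ 'k) \<times> (real ^ 'm)\<close> is the standard basis. Thus the functions \<open>s\<^sub>1, \<dots>, s\<^sub>n\<close> are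
  indexed by the basis vectors.\<close>

definition symmetric_stable ::
    "real \<Rightarrow> 'w measure \<Rightarrow> ('w \<Rightarrow> 'v::euclidean_space) \<Rightarrow> bool" where
  "symmetric_stable q M X \<longleftrightarrow>
     X \<in> borel_measurable M \<and>
     (\<exists>s :: 'v \<Rightarrow> real \<Rightarrow> real.
        (\<forall>b\<in>Basis. in_Lp q (lebesgue_on {0..1}) (s b)) \<and>
        (\<forall>\<xi>. (LINT \<omega>|M. cis (\<xi> \<bullet> X \<omega>)) =
          complex_of_real (exp (- (LINT t|lebesgue_on {0..1}.
            \<bar>\<Sum>b\<in>Basis. (\<xi> \<bullet> b) * s b t\<bar> powr q)))))"

text \<open>The function \<open>N\<close> need not satisfy the triangle inequality.\<close>

definition homogeneous_space :: "('v::real_normed_vector \<Rightarrow> real) \<Rightarrow> bool" where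
  "homogeneous_space N \<longleftrightarrow>
     continuous_on UNIV N \<and>
     (\<forall>t x. N (t *\<^sub>R x) = \<bar>t\<bar> * N x) \<and>
     (\<forall>x. x \<noteq> 0 \<longrightarrow> 0 < N x)"

definition subspace_of_Lp ::
    "real \<Rightarrow> 't measure \<Rightarrow> ('v::real_vector \<Rightarrow> real) \<Rightarrow> bool" where
  "subspace_of_Lp r \<mu> N \<longleftrightarrow>
     (\<exists>T :: 'v \<Rightarrow> 't \<Rightarrow> real.
        (\<forall>x. in_Lp r \<mu> (T x)) \<and>
        (\<forall>a b x y. AE t in \<mu>. T (a *\<^sub>R x + b *\<^sub>R y) t = a * T x t + b * T y t) \<and>
        (\<forall>x. N x = Lp_norm r \<mu> (T x)))"

definition ell_norm :: "ereal \<Rightarrow> 'v::euclidean_space \<Rightarrow> real" where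
  "ell_norm \<rho> x =
     (if \<rho> = \<infinity> then Max ((\<lambda>b. \<bar>x \<bullet> b\<bar>) ` Basis)
      else (\<Sum>b\<in>Basis. \<bar>x \<bullet> b\<bar> powr real_of_ereal \<rho>) powr (1 / real_of_ereal \<rho>))"

text \<open>The convention \<open>0\<^bsup>-p\<^esup> = \<infinity>\<close> has to be built in, since \<open>0 powr (- p) = 0\<close>.\<close>

definition neg_power :: "real \<Rightarrow> real \<Rightarrow> ennreal" where
  "neg_power p t = (if t = 0 then \<infinity> else ennreal (t powr (- p)))"

end

theory Submission
  imports Defs
begin

text \<open>Since \<open>|a + b|\<^sup>q + |a - b|\<^sup>q \<le> 2(|a|\<^sup>q + |b|\<^sup>q)\<close> for \<open>q \<le> 2\<close>, flipping the sign of the second block of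
  \<open>X\<close> with probability \<open>1/2\<close> gives a vector, with law \<open>P\<close>, whose characteristic function dominates
  that of \<open>Y\<close> pointwise; the symmetry condition makes this change invisible to the norm. It remains to
  see that \<open>\<integral> F dQ \<le> \<integral> F dP\<close> for \<open>F = \<parallel>\<cdot>\<parallel>\<^sup>-\<^sup>p\<close> and the law \<open>Q\<close> of \<open>Y\<close>, because \<open>F\<close> is a positive definite
  distribution. We have \<open>F(x) = C \<integral> s\<^sup>-\<^sup>p\<^sup>-\<^sup>1 \<Phi>(x/s) ds\<close> with \<open>\<Phi> = exp(-\<parallel>\<cdot>\<parallel>\<^sup>r)\<close>. In a subspace of \<open>L\<^sub>r\<close> the
  function \<open>\<Phi>\<close> itself is positive definite. In the other cases the Fourier transform of \<open>F\<close> at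
  \<open>\<xi>\<close> is, up to a positive constant, \<open>\<integral> s\<^sup>a \<Psi>(s\<xi>) ds\<close> with \<open>a = n - p - 1\<close> and \<open>\<Psi>\<close> the Fourier transform of \<open>\<Phi>\<close>.
  For \<open>-1 < a \<le> 0\<close> it is nonnegative since \<open>s\<^sup>a\<close> is a mixture of Gaussians. For \<open>0 < a \<le> 2\<close> the function \<open>s\<^sup>a\<close>
  is a limit of mixtures of \<open>1 - cos(us)\<close>, and nonnegativity says that the marginal of \<open>\<Phi>\<close> in direction \<open>\<xi>\<close>,
  smoothed by a Gaussian, is largest at the origin; for \<open>\<ell>\<^sub>\<rho>\<close> the function \<open>\<Phi>\<close> is a product of symmetric
  unimodal functions, and convolution preserves symmetric unimodality.\<close>

section \<open>Functions that preserve domination of cosine transforms\<close>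

text \<open>The obstacle is that \<open>F\<close> has a pole at the origin while \<open>P\<close>
  and \<open>Q\<close> need not have densities, so Parseval's formula cannot be applied directly.
  \<open>F\<close> is therefore mollified by a Gaussian; writing the Gaussian itself as an average
  of cosines makes the mollified function a mixture of cosines over a finite measure. Removing the
  mollifier is asymmetric: Fatou's lemma suffices under \<open>Q\<close>, whereas under
  \<open>P\<close> a majorant proportional to \<open>F\<close> and uniform in the width is required.
  The exponent a = n - p - 1 is the weight s^(-p-1) of the mixture times the Jacobian s^n of the
  dilation by s. Mixtures of 1 - cos(us) grow at most quadratically in s, hence a \<le> 2, that is p
  \<ge> n - 3. A second point concerns \<open>Y\<close>: independence is given only for pairs of
  single coordinates. That the characteristic function of \<open>Y\<close> nevertheless factorizes
  over the two blocks comes from stability, through the equality case of the power inequality when q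
  < 2 and through orthogonality when q = 2.\<close>

lemma Fubini_swap:
  fixes f :: "'a \<Rightarrow> 'b \<Rightarrow> real"
  assumes "sigma_finite_measure M1" "sigma_finite_measure M2"
    and f[measurable]: "case_prod f \<in> borel_measurable (M1 \<Otimes>\<^sub>M M2)"
    and fin: "(\<integral>\<^sup>+x. \<integral>\<^sup>+y. ennreal \<bar>f x y\<bar> \<partial>M2 \<partial>M1) < \<infinity>"
  shows "(\<integral>x. \<integral>y. f x y \<partial>M2 \<partial>M1) = (\<integral>y. \<integral>x. f x y \<partial>M1 \<partial>M2)"
    and "integrable M1 (\<lambda>x. \<integral>y. f x y \<partial>M2)"
    and "integrable M2 (\<lambda>y. \<integral>x. f x y \<partial>M1)"
proof -
  interpret pair_sigma_finite M1 M2 using assms by (simp add: pair_sigma_finite_def)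
  have *: "integrable (M1 \<Otimes>\<^sub>M M2) (case_prod f)"
  proof (rule integrableI_bounded)
    have "(\<integral>\<^sup>+ p. norm (case_prod f p) \<partial>(M1 \<Otimes>\<^sub>M M2)) = (\<integral>\<^sup>+ x. (\<integral>\<^sup>+ y. norm (f x y) \<partial>M2) \<partial>M1)"
      by (subst M2.nn_integral_fst[symmetric]) auto
    then show "(\<integral>\<^sup>+ p. norm (case_prod f p) \<partial>(M1 \<Otimes>\<^sub>M M2)) < \<infinity>" using fin by simp
  qed auto
  show "(\<integral>x. \<integral>y. f x y \<partial>M2 \<partial>M1) = (\<integral>y. \<integral>x. f x y \<partial>M1 \<partial>M2)"
    using Fubini_integral[OF *] by simp
  show "integrable M1 (\<lambda>x. \<integral>y. f x y \<partial>M2)" using integrable_fst[OF *] .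
  show "integrable M2 (\<lambda>y. \<integral>x. f x y \<partial>M1)" using integrable_snd[OF *] .
qed

lemma finite_measure_integrable_bounded:
  fixes f :: "'a \<Rightarrow> real"
  assumes "finite_measure M" "f \<in> borel_measurable M" "\<And>x. \<bar>f x\<bar> \<le> B"
  shows "integrable M f"
  using assms by (intro finite_measure.integrable_const_bound[where B=B]) auto

lemma nn_integral_bounded_finite:
  fixes f :: "'a \<Rightarrow> 'b \<Rightarrow> real"
  assumes "finite_measure M1" "finite_measure M2" and bd: "\<And>x y. \<bar>f x y\<bar> \<le> B"
  shows "(\<integral>\<^sup>+x. \<integral>\<^sup>+y. ennreal \<bar>f x y\<bar> \<partial>M2 \<partial>M1) < \<infinity>"
proof -
  interpret M1: finite_measure M1 by fact
  interpret M2: finite_measure M2 by fact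
  have "(\<integral>\<^sup>+x. \<integral>\<^sup>+y. ennreal \<bar>f x y\<bar> \<partial>M2 \<partial>M1) \<le> (\<integral>\<^sup>+x. \<integral>\<^sup>+y. ennreal B \<partial>M2 \<partial>M1)"
    by (intro nn_integral_mono) (auto intro: ennreal_leI bd)
  also have "\<dots> < \<infinity>"
    by (simp add: ennreal_mult_less_top less_top[symmetric] M1.emeasure_finite M2.emeasure_finite ennreal_mult_eq_top_iff)
  finally show ?thesis .
qed

abbreviation cos_moment :: "'v::euclidean_space measure \<Rightarrow> ('v \<Rightarrow> real) \<Rightarrow> 'v \<Rightarrow> real" where
  "cos_moment R F \<xi> \<equiv> \<integral>x. F x * cos (x \<bullet> \<xi>) \<partial>R"

text \<open>\<open>P\<close> will be the law of the vector with randomly signed second block,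
  \<open>Q\<close> the law of \<open>Y\<close>. Comparing cosine integrals instead of full
  characteristic functions is enough because the functions integrated later are built from
  cosines.\<close>

locale cos_dominated =
  fixes P Q :: "'v::euclidean_space measure"
  assumes fin_P: "finite_measure P" and sets_P: "sets P = sets borel"
    and fin_Q: "finite_measure Q" and sets_Q: "sets Q = sets borel"
    and cos_le: "\<And>\<xi>. (\<integral>x. cos (x \<bullet> \<xi>) \<partial>Q) \<le> (\<integral>x. cos (x \<bullet> \<xi>) \<partial>P)"
begin

definition bounded_borel :: "('v \<Rightarrow> real) \<Rightarrow> bool" where
  "bounded_borel F \<longleftrightarrow> F \<in> borel_measurable borel \<and> (\<exists>B. \<forall>x. \<bar>F x\<bar> \<le> B)"

text \<open>Equivalently, the signed measure \<open>F \<cdot> (P - Q)\<close> has a nonnegative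
  cosine transform. The locale assumption is the case \<open>F = 1\<close>.\<close>

definition dominated :: "('v \<Rightarrow> real) \<Rightarrow> bool" where
  "dominated F \<longleftrightarrow> (\<forall>\<xi>. cos_moment Q F \<xi> \<le> cos_moment P F \<xi>)"

text \<open>Multipliers are closed under products by definition, which replaces convolution of the
  measures representing positive definite functions.\<close>

definition multiplier :: "('v \<Rightarrow> real) \<Rightarrow> bool" where
  "multiplier G \<longleftrightarrow> bounded_borel G \<and>
     (\<forall>F. bounded_borel F \<longrightarrow> dominated F \<longrightarrow> dominated (\<lambda>x. G x * F x))"

lemma bounded_borelI:
  "F \<in> borel_measurable borel \<Longrightarrow> (\<And>x. \<bar>F x\<bar> \<le> B) \<Longrightarrow> bounded_borel F"
  by (auto simp: bounded_borel_def)

lemma measurable_PQ: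
  assumes "F \<in> borel_measurable borel" shows "F \<in> borel_measurable P" "F \<in> borel_measurable Q"
  using assms by (simp_all add: measurable_def sets_P sets_eq_imp_space_eq[OF sets_P] sets_Q sets_eq_imp_space_eq[OF sets_Q])

lemma bounded_borel_integrable:
  assumes "bounded_borel F" shows "integrable P F" "integrable Q F"
proof -
  obtain B where F: "F \<in> borel_measurable borel" "\<forall>x. \<bar>F x\<bar> \<le> B"
    using assms by (auto simp: bounded_borel_def)
  show "integrable P F"
    by (rule finite_measure_integrable_bounded[where B=B]) (simp_all add: F fin_P measurable_PQ)
  show "integrable Q F"
    by (rule finite_measure_integrable_bounded[where B=B]) (simp_all add: F fin_Q measurable_PQ)
qed

lemma bounded_borel_mult:
  assumes "bounded_borel F" "bounded_borel G" shows "bounded_borel (\<lambda>x. F x * G x)"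
proof -
  obtain A where A: "\<And>x. \<bar>F x\<bar> \<le> A" using assms(1) by (auto simp: bounded_borel_def)
  obtain B where B: "\<And>x. \<bar>G x\<bar> \<le> B" using assms(2) by (auto simp: bounded_borel_def)
  have "0 \<le> A" using A[of 0] by linarith
  show ?thesis
  proof (rule bounded_borelI)
    show "(\<lambda>x. F x * G x) \<in> borel_measurable borel"
      using assms by (intro borel_measurable_times) (simp_all add: bounded_borel_def)
    show "\<bar>F x * G x\<bar> \<le> A * B" for x
      unfolding abs_mult by (intro mult_mono A B \<open>0 \<le> A\<close> abs_ge_zero)
  qed
qed

lemma bounded_borel_add:
  assumes "bounded_borel F" "bounded_borel G" shows "bounded_borel (\<lambda>x. F x + G x)"
proof -
  obtain A where A: "\<And>x. \<bar>F x\<bar> \<le> A" using assms(1) by (auto simp: bounded_borel_def)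
  obtain B where B: "\<And>x. \<bar>G x\<bar> \<le> B" using assms(2) by (auto simp: bounded_borel_def)
  show ?thesis
  proof (rule bounded_borelI)
    show "(\<lambda>x. F x + G x) \<in> borel_measurable borel"
      using assms by (intro borel_measurable_add) (simp_all add: bounded_borel_def)
    show "\<bar>F x + G x\<bar> \<le> A + B" for x
      using A[of x] B[of x] by linarith
  qed
qed

lemma bounded_borel_const: "bounded_borel (\<lambda>x. c)"
  by (auto intro!: bounded_borelI)

lemma bounded_borel_cos: "bounded_borel (\<lambda>x. cos (x \<bullet> \<xi>))"
  by (rule bounded_borelI[where B=1]) auto

lemma multiplier_bounded: "multiplier G \<Longrightarrow> bounded_borel G"
  by (simp add: multiplier_def)

lemma multiplier_const:
  assumes "0 \<le> c" shows "multiplier (\<lambda>x. c)"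
  using assms by (auto simp: multiplier_def bounded_borel_const dominated_def mult.assoc intro!: mult_left_mono)

lemma multiplier_mult:
  assumes F: "multiplier F" and G: "multiplier G" shows "multiplier (\<lambda>x. F x * G x)"
  unfolding multiplier_def
proof (intro conjI allI impI)
  show "bounded_borel (\<lambda>x. F x * G x)" using assms by (simp add: bounded_borel_mult multiplier_bounded)
  fix H assume "bounded_borel H" "dominated H"
  then have "bounded_borel (\<lambda>x. G x * H x)" "dominated (\<lambda>x. G x * H x)"
    using G by (auto simp: multiplier_def bounded_borel_mult)
  then have "dominated (\<lambda>x. F x * (G x * H x))" using F by (auto simp: multiplier_def)
  then show "dominated (\<lambda>x. F x * G x * H x)" by (simp add: mult.assoc)
qed

lemma multiplier_add:
  assumes F: "multiplier F" and G: "multiplier G" shows "multiplier (\<lambda>x. F x + G x)"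
  unfolding multiplier_def
proof (intro conjI allI impI)
  show "bounded_borel (\<lambda>x. F x + G x)" using assms by (simp add: bounded_borel_add multiplier_bounded)
  fix H assume H: "bounded_borel H" "dominated H"
  show "dominated (\<lambda>x. (F x + G x) * H x)" unfolding dominated_def
  proof
    fix \<xi>
    have "bounded_borel (\<lambda>x. F x * H x * cos (x \<bullet> \<xi>))" "bounded_borel (\<lambda>x. G x * H x * cos (x \<bullet> \<xi>))"
      using multiplier_bounded[OF F] multiplier_bounded[OF G] H(1) by (simp_all add: bounded_borel_mult bounded_borel_cos)
    note i = this[THEN bounded_borel_integrable(1)] this[THEN bounded_borel_integrable(2)]
    have "dominated (\<lambda>x. F x * H x)" "dominated (\<lambda>x. G x * H x)" using assms H by (auto simp: multiplier_def)
    then have "cos_moment Q (\<lambda>x. F x * H x) \<xi> + cos_moment Q (\<lambda>x. G x * H x) \<xi>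
      \<le> cos_moment P (\<lambda>x. F x * H x) \<xi> + cos_moment P (\<lambda>x. G x * H x) \<xi>"
      by (intro add_mono) (auto simp: dominated_def)
    with i show "cos_moment Q (\<lambda>x. (F x + G x) * H x) \<xi> \<le> cos_moment P (\<lambda>x. (F x + G x) * H x) \<xi>"
      by (simp add: distrib_right)
  qed
qed

text \<open>By the product formula, multiplying by a cosine replaces the cosine transform at \<xi>
  by the average of its values at \<eta> - \<xi> and \<eta> + \<xi>, and the inequality holds at
  both points.\<close>

lemma multiplier_cos: "multiplier (\<lambda>x. cos (x \<bullet> \<eta>))"
  unfolding multiplier_def
proof (intro conjI allI impI)
  show "bounded_borel (\<lambda>x. cos (x \<bullet> \<eta>))" by (rule bounded_borel_cos)
  fix H assume H: "bounded_borel H" "dominated H"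
  show "dominated (\<lambda>x. cos (x \<bullet> \<eta>) * H x)" unfolding dominated_def
  proof
    fix \<xi>
    have *: "cos (x \<bullet> \<eta>) * H x * cos (x \<bullet> \<xi>) = (1/2) * (H x * cos (x \<bullet> (\<eta> - \<xi>)) + H x * cos (x \<bullet> (\<eta> + \<xi>)))" for x
      by (simp add: inner_diff_right inner_add_right cos_diff cos_add algebra_simps)
    have "bounded_borel (\<lambda>x. H x * cos (x \<bullet> \<zeta>))" for \<zeta>
      using H by (auto intro!: bounded_borel_mult bounded_borel_cos)
    note i = this[THEN bounded_borel_integrable(1)] this[THEN bounded_borel_integrable(2)]
    show "cos_moment Q (\<lambda>x. cos (x \<bullet> \<eta>) * H x) \<xi> \<le> cos_moment P (\<lambda>x. cos (x \<bullet> \<eta>) * H x) \<xi>"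
      unfolding * using H(2) i by (simp add: dominated_def add_mono)
  qed
qed

text \<open>Dominated convergence under both measures: they are finite, so the uniform bound is an
  integrable majorant, and a weak inequality survives the limit.\<close>

lemma multiplier_lim:
  assumes G: "\<And>m. multiplier (G m)" and bd: "\<And>m x. \<bar>G m x\<bar> \<le> B"
    and lim: "\<And>x. (\<lambda>m. G m x) \<longlonglongrightarrow> L x"
  shows "multiplier L"
proof -
  have Gm[measurable]: "G m \<in> borel_measurable borel" for m using G[of m] by (simp add: multiplier_def bounded_borel_def)
  have [measurable]: "L \<in> borel_measurable borel" using lim by (rule borel_measurable_LIMSEQ_real) simp
  have Lbd: "\<bar>L x\<bar> \<le> B" for x
    using tendsto_rabs[OF lim] by (rule LIMSEQ_le_const2) (auto intro: bd)
  show ?thesis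
    unfolding multiplier_def
  proof (intro conjI allI impI)
    show "bounded_borel L" by (rule bounded_borelI[where B=B]) (use Lbd in auto)
    fix H assume H: "bounded_borel H" "dominated H"
    have [measurable]: "H \<in> borel_measurable borel" using H by (simp add: bounded_borel_def)
    obtain A where A: "\<And>x. \<bar>H x\<bar> \<le> A" using H by (auto simp: bounded_borel_def)
    have bound: "\<bar>G m x * H x * cos (x \<bullet> \<xi>)\<bar> \<le> B * A" for m x \<xi>
    proof -
      have "\<bar>G m x * H x * cos (x \<bullet> \<xi>)\<bar> = \<bar>G m x\<bar> * \<bar>H x\<bar> * \<bar>cos (x \<bullet> \<xi>)\<bar>" by (simp add: abs_mult)
      also have "\<dots> \<le> B * A * 1"
        using A[of x] bd[of m x] by (intro mult_mono mult_nonneg_nonneg; linarith?) simp_all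
      finally show ?thesis by simp
    qed
    have conv: "(\<lambda>m. \<integral>x. G m x * H x * cos (x \<bullet> \<xi>) \<partial>R) \<longlonglongrightarrow> cos_moment R (\<lambda>x. L x * H x) \<xi>"
      if R: "finite_measure R" and sR[measurable_cong]: "sets R = sets borel" for R \<xi>
    proof (rule integral_dominated_convergence[where w="\<lambda>_. B * A"])
      show "integrable R (\<lambda>_. B * A)" using R by (rule finite_measure_integrable_bounded) auto
      show "AE x in R. (\<lambda>m. G m x * H x * cos (x \<bullet> \<xi>)) \<longlonglongrightarrow> L x * H x * cos (x \<bullet> \<xi>)"
        by (intro AE_I2 tendsto_intros lim)
    qed (use bound in auto)
    show "dominated (\<lambda>x. L x * H x)" unfolding dominated_def
    proof
      fix \<xi>
      show "cos_moment Q (\<lambda>x. L x * H x) \<xi> \<le> cos_moment P (\<lambda>x. L x * H x) \<xi>"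
      proof (rule LIMSEQ_le)
        show "(\<lambda>m. \<integral>x. G m x * H x * cos (x \<bullet> \<xi>) \<partial>Q) \<longlonglongrightarrow> cos_moment Q (\<lambda>x. L x * H x) \<xi>"
          by (rule conv[OF fin_Q sets_Q])
        show "(\<lambda>m. \<integral>x. G m x * H x * cos (x \<bullet> \<xi>) \<partial>P) \<longlonglongrightarrow> cos_moment P (\<lambda>x. L x * H x) \<xi>"
          by (rule conv[OF fin_P sets_P])
        show "\<exists>N. \<forall>m\<ge>N. cos_moment Q (\<lambda>x. G m x * H x) \<xi> \<le> cos_moment P (\<lambda>x. G m x * H x) \<xi>"
          using G H by (auto simp: multiplier_def dominated_def)
      qed
    qed
  qed
qed

text \<open>Interchanging the integrals reduces the claim to each \<open>K y\<close> separately; the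
  finite measures and the uniform bound justify the interchange.\<close>

lemma multiplier_integral:
  assumes \<eta>: "finite_measure \<eta>"
    and K: "case_prod K \<in> borel_measurable (\<eta> \<Otimes>\<^sub>M borel)"
    and bd: "\<And>y x. \<bar>K y x\<bar> \<le> B" and mult: "\<And>y. multiplier (K y)"
  shows "multiplier (\<lambda>x. \<integral>y. K y x \<partial>\<eta>)"
proof -
  interpret \<eta>: finite_measure \<eta> by fact
  have Bge: "0 \<le> B" using bd by (meson abs_ge_zero order_trans)
  have Ky[measurable]: "(\<lambda>y. K y x) \<in> borel_measurable \<eta>" for x
    using measurable_Pair1'[of x borel \<eta>] K by (auto dest: measurable_compose[rotated])
  show ?thesis
    unfolding multiplier_def
  proof (intro conjI allI impI)
    show "bounded_borel (\<lambda>x. \<integral>y. K y x \<partial>\<eta>)"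
    proof (rule bounded_borelI)
      fix x
      have "\<bar>\<integral>y. K y x \<partial>\<eta>\<bar> \<le> (\<integral>y. B \<partial>\<eta>)"
        using integral_norm_bound[of \<eta> "\<lambda>y. K y x"]
        by (intro order_trans[OF _ integral_mono[of \<eta> "\<lambda>y. \<bar>K y x\<bar>" "\<lambda>y. B"]])
           (auto intro!: finite_measure_integrable_bounded[OF \<eta>, where B=B] simp: bd Bge)
      then show "\<bar>\<integral>y. K y x \<partial>\<eta>\<bar> \<le> B * measure \<eta> (space \<eta>)" by (simp add: mult.commute)
    qed (rule \<eta>.borel_measurable_lebesgue_integral, use measurable_pair_swap[OF K] in \<open>simp add: case_prod_beta'\<close>)
    fix H assume H: "bounded_borel H" "dominated H"
    have [measurable]: "H \<in> borel_measurable borel" using H by (simp add: bounded_borel_def)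
    obtain A where A: "\<And>x. \<bar>H x\<bar> \<le> A" using H by (auto simp: bounded_borel_def)
    have bound: "\<bar>K y x * H x * cos (x \<bullet> \<xi>)\<bar> \<le> B * A" for y x \<xi>
    proof -
      have "\<bar>K y x * H x * cos (x \<bullet> \<xi>)\<bar> = \<bar>K y x\<bar> * \<bar>H x\<bar> * \<bar>cos (x \<bullet> \<xi>)\<bar>" by (simp add: abs_mult)
      also have "\<dots> \<le> B * A * 1"
        using A[of x] bd[of y x] by (intro mult_mono mult_nonneg_nonneg; linarith?) simp_all
      finally show ?thesis by simp
    qed
    have swap: "cos_moment R (\<lambda>x. (\<integral>y. K y x \<partial>\<eta>) * H x) \<xi> = (\<integral>y. \<integral>x. K y x * H x * cos (x \<bullet> \<xi>) \<partial>R \<partial>\<eta>)"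
      and int: "integrable \<eta> (\<lambda>y. \<integral>x. K y x * H x * cos (x \<bullet> \<xi>) \<partial>R)"
      if R: "finite_measure R" and sR[measurable_cong]: "sets R = sets borel" for R \<xi>
    proof -
      have KR: "case_prod K \<in> borel_measurable (\<eta> \<Otimes>\<^sub>M R)"
        using K by (subst measurable_cong_sets[OF sets_pair_measure_cong[OF refl sR] refl])
      have HR: "H \<in> borel_measurable R" "(\<lambda>x. cos (x \<bullet> \<xi>)) \<in> borel_measurable R"
        by measurable
      have "(\<lambda>z. case_prod K z * H (snd z) * cos (snd z \<bullet> \<xi>)) \<in> borel_measurable (\<eta> \<Otimes>\<^sub>M R)"
        by (intro borel_measurable_times KR measurable_compose[OF measurable_snd HR(1)]
            measurable_compose[OF measurable_snd HR(2)])
      then have m: "(\<lambda>(y, x). K y x * H x * cos (x \<bullet> \<xi>)) \<in> borel_measurable (\<eta> \<Otimes>\<^sub>M R)"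
        by (simp add: case_prod_beta')
      note F = Fubini_swap[OF \<eta>.sigma_finite_measure_axioms
          finite_measure.axioms(1)[OF R] m nn_integral_bounded_finite[OF \<eta> R bound]]
      show "integrable \<eta> (\<lambda>y. \<integral>x. K y x * H x * cos (x \<bullet> \<xi>) \<partial>R)" using F(2) .
      show "cos_moment R (\<lambda>x. (\<integral>y. K y x \<partial>\<eta>) * H x) \<xi> = (\<integral>y. \<integral>x. K y x * H x * cos (x \<bullet> \<xi>) \<partial>R \<partial>\<eta>)"
        unfolding F(1) by (simp add: mult.assoc)
    qed
    show "dominated (\<lambda>x. (\<integral>y. K y x \<partial>\<eta>) * H x)" unfolding dominated_def
    proof
      fix \<xi>
      show "cos_moment Q (\<lambda>x. (\<integral>y. K y x \<partial>\<eta>) * H x) \<xi> \<le> cos_moment P (\<lambda>x. (\<integral>y. K y x \<partial>\<eta>) * H x) \<xi>"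
        unfolding swap[OF fin_P sets_P] swap[OF fin_Q sets_Q]
        by (intro integral_mono int[OF fin_P sets_P] int[OF fin_Q sets_Q])
           (use mult H in \<open>auto simp: multiplier_def dominated_def\<close>)
    qed
  qed
qed

lemma multiplier_power: "multiplier F \<Longrightarrow> multiplier (\<lambda>x. F x ^ m)"
  by (induction m) (auto intro: multiplier_mult multiplier_const)

lemma multiplier_sum:
  "(\<And>i. i \<in> I \<Longrightarrow> multiplier (F i)) \<Longrightarrow> multiplier (\<lambda>x. \<Sum>i\<in>I. F i x)"
  by (induction I rule: infinite_finite_induct) (auto intro: multiplier_add multiplier_const)

text \<open>The Taylor coefficients of exp are nonnegative, so every partial sum is a multiplier,
  and all of them are bounded by \<open>exp B\<close>. Subtracting a constant from \<open>F\<close>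
  only rescales the exponential; this is how exponentials of negative functions are reached
  later.\<close>

lemma multiplier_exp:
  assumes F: "multiplier F" shows "multiplier (\<lambda>x. exp (F x))"
proof -
  obtain B where B: "\<And>x. \<bar>F x\<bar> \<le> B" using F by (auto simp: multiplier_def bounded_borel_def)
  have Bge: "0 \<le> B" using B by (meson abs_ge_zero order_trans)
  show ?thesis
  proof (rule multiplier_lim)
    show "multiplier (\<lambda>x. \<Sum>i<m. (1 / fact i) * F x ^ i)" for m
      by (intro multiplier_sum multiplier_mult multiplier_const multiplier_power F) simp
    show "(\<lambda>m. \<Sum>i<m. (1 / fact i) * F x ^ i) \<longlonglongrightarrow> exp (F x)" for x
      using exp_converges[of "F x"] by (simp add: sums_def field_simps)
    show "\<bar>\<Sum>i<m. (1 / fact i) * F x ^ i\<bar> \<le> exp B" for m x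
    proof -
      have "\<bar>\<Sum>i<m. (1 / fact i) * F x ^ i\<bar> \<le> (\<Sum>i<m. \<bar>(1 / fact i) * F x ^ i\<bar>)" by (rule sum_abs)
      also have "\<dots> \<le> (\<Sum>i<m. B ^ i /\<^sub>R fact i)"
        by (intro sum_mono) (auto simp: abs_mult power_abs field_simps intro!: power_mono B)
      also have "\<dots> \<le> exp B"
        using sum_le_suminf[OF summable_exp_generic[of B], of "{..<m}"] Bge by (simp add: exp_def)
      finally show ?thesis .
    qed
  qed
qed

text \<open>Test the multiplier against the constant 1, which is dominated by the locale assumption,
  and read off the frequency 0.\<close>

lemma multiplier_integral_le:
  assumes "multiplier G" shows "(\<integral>x. G x \<partial>Q) \<le> (\<integral>x. G x \<partial>P)"
proof -
  have "dominated (\<lambda>x. 1)" using cos_le by (simp add: dominated_def)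
  with assms have "dominated (\<lambda>x. G x * 1)" by (auto simp: multiplier_def bounded_borel_const dest!: spec[of _ "\<lambda>x. 1"])
  then show ?thesis by (auto simp: dominated_def dest!: spec[of _ 0])
qed

lemma multiplier_nn_integral_le:
  assumes G: "multiplier G" and nn: "\<And>x. 0 \<le> G x"
  shows "(\<integral>\<^sup>+x. ennreal (G x) \<partial>Q) \<le> (\<integral>\<^sup>+x. ennreal (G x) \<partial>P)"
  using multiplier_integral_le[OF G] bounded_borel_integrable[OF multiplier_bounded[OF G]] nn
  by (simp add: nn_integral_eq_integral ennreal_leI)

end

section \<open>Mixtures of powers\<close>

lemma one_minus_cos_le: "1 - cos x \<le> x\<^sup>2 / 2" for x :: real
proof -
  have "1 - cos x = 2 * (sin (x/2))\<^sup>2"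
    using cos_double_sin[of "x/2"] by simp
  also have "(sin (x/2))\<^sup>2 \<le> (x/2)\<^sup>2"
    using abs_sin_x_le_abs_x[of "x/2"] by (simp only: abs_le_square_iff)
  finally show ?thesis by (simp add: power_divide)
qed

lemma nn_integral_powr_0:
  fixes a t :: real
  assumes "- 1 < a" "0 \<le> t"
  shows "(\<integral>\<^sup>+u\<in>{0..t}. ennreal (u powr a) \<partial>lborel) = ennreal (t powr (a + 1) / (a + 1))"
  by (rule nn_integral_has_integral_lebesgue') (use has_integral_powr_from_0[OF assms] in auto)

lemma nn_integral_powr_inf:
  fixes a t :: real
  assumes "1 < a" "0 < t"
  shows "(\<integral>\<^sup>+u\<in>{t..}. ennreal (u powr (-a)) \<partial>lborel) = ennreal (t powr (1 - a) / (a - 1))"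
proof (rule nn_integral_has_integral_lebesgue')
  show "((\<lambda>u. u powr (-a)) has_integral t powr (1 - a) / (a - 1)) {t..}"
    using has_integral_powr_to_inf[of "-a" t] assms
    by (simp add: divide_minus_right[symmetric] del: divide_minus_right)
qed auto

lemma nn_integral_half_line_finite:
  fixes f :: "real \<Rightarrow> real"
  assumes a: "- 1 < a" and b: "1 < b" and AB: "0 \<le> A" "0 \<le> B"
    and near: "\<And>s. 0 < s \<Longrightarrow> s \<le> 1 \<Longrightarrow> f s \<le> A * s powr a"
    and far: "\<And>s. 1 < s \<Longrightarrow> f s \<le> B * s powr (- b)"
  shows "(\<integral>\<^sup>+s\<in>{0<..}. ennreal (f s) \<partial>lborel) < \<infinity>"
proof -
  have le: "ennreal (f s) * indicator {0<..} s
    \<le> ennreal A * (ennreal (s powr a) * indicator {0..1} s) + ennreal B * (ennreal (s powr (- b)) * indicator {1..} s)" for s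
    using near[of s] far[of s] AB
    by (cases "s \<le> 1") (auto simp: indicator_def ennreal_mult'[symmetric] intro: ennreal_leI add_increasing2)
  have "(\<integral>\<^sup>+s\<in>{0<..}. ennreal (f s) \<partial>lborel)
    \<le> (\<integral>\<^sup>+s. ennreal A * (ennreal (s powr a) * indicator {0..1} s) + ennreal B * (ennreal (s powr (- b)) * indicator {1..} s) \<partial>lborel)"
    by (intro nn_integral_mono le)
  also have "\<dots> = ennreal A * ennreal (1 / (a + 1)) + ennreal B * ennreal (1 / (b - 1))"
    using nn_integral_powr_0[OF a, of 1] nn_integral_powr_inf[OF b, of 1]
    by (subst nn_integral_add) (simp_all add: nn_integral_cmult)
  also have "\<dots> < \<infinity>" by (simp add: ennreal_mult_less_top)
  finally show ?thesis .
qed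

lemma nn_integral_half_line_pos:
  fixes f :: "real \<Rightarrow> real"
  assumes c: "0 < c" and le: "\<And>s. 1 \<le> s \<Longrightarrow> s \<le> 2 \<Longrightarrow> c \<le> f s"
  shows "0 < (\<integral>\<^sup>+s\<in>{0<..}. ennreal (f s) \<partial>lborel)"
proof -
  have "0 < (\<integral>\<^sup>+s\<in>{1..2::real}. ennreal c \<partial>lborel)"
    using c by (simp add: nn_integral_cmult)
  also have "\<dots> \<le> (\<integral>\<^sup>+s\<in>{0<..}. ennreal (f s) \<partial>lborel)"
    using le by (intro nn_integral_mono) (auto simp: indicator_def intro!: ennreal_leI)
  finally show ?thesis .
qed

text \<open>This is \<open>x / a \<le> exp (x / a)\<close> raised to the power
  \<open>a\<close>.\<close>

lemma powr_le_exp: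
  fixes a x :: real
  assumes "0 < a" "0 \<le> x" shows "x powr a \<le> a powr a * exp x"
proof -
  have "x powr a = a powr a * (x / a) powr a" using assms by (simp add: powr_divide)
  also have "(x / a) powr a \<le> exp (x / a) powr a"
    using assms exp_ge_add_one_self[of "x/a"] by (intro powr_mono2) (simp_all del: exp_ge_add_one_self)
  also have "exp (x / a) powr a = exp x" using assms by (simp add: powr_def)
  finally show ?thesis by (simp add: mult_left_mono)
qed

lemma nn_integral_pos_scale:
  fixes f :: "real \<Rightarrow> real"
  assumes [measurable]: "f \<in> borel_measurable borel" and c: "0 < c"
  shows "(\<integral>\<^sup>+s\<in>{0<..}. ennreal (f s) \<partial>lborel)
    = (\<integral>\<^sup>+s\<in>{0<..}. ennreal (c * f (c * s)) \<partial>lborel)"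
  using c by (subst nn_integral_real_affine[of _ c 0])
    (auto simp: nn_integral_cmult[symmetric] ennreal_mult' indicator_def zero_less_mult_iff mult.assoc intro!: nn_integral_cong)

abbreviation exp_mixture :: "real \<Rightarrow> real \<Rightarrow> real \<Rightarrow> real \<Rightarrow> ennreal" where
  "exp_mixture C p r t \<equiv> \<integral>\<^sup>+s\<in>{0<..}. ennreal (C * s powr (- p - 1) * exp (- ((t / s) powr r))) \<partial>lborel"

text \<open>The substitution s = t s' shows that the integral without constant is homogeneous of
  degree -p in t, so \<open>C\<close> is the reciprocal of its value at 1. At t = 0 the integral
  diverges, in agreement with the convention built into \<open>neg_power\<close>.\<close>

lemma neg_power_mixture:
  assumes r: "0 < r" and p: "0 < p"
  obtains C where "0 < C" and "\<And>t. 0 \<le> t \<Longrightarrow> neg_power p t =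
    exp_mixture C p r t"
proof -
  define I where "I t = (\<integral>\<^sup>+s\<in>{0<..}. ennreal (s powr (- p - 1) * exp (- ((t / s) powr r))) \<partial>lborel)" for t
  have scale: "I t = ennreal (t powr (- p)) * I 1" if t: "0 < t" for t
  proof -
    have "I t = (\<integral>\<^sup>+s. ennreal (t * ((t * s) powr (- p - 1) * exp (- ((t / (t * s)) powr r)))) * indicator {0<..} s \<partial>lborel)"
      unfolding I_def using t by (subst nn_integral_pos_scale[of _ t]) auto
    also have "\<dots> = (\<integral>\<^sup>+s. ennreal (t powr (- p)) * (ennreal (s powr (- p - 1) * exp (- ((1 / s) powr r))) * indicator {0<..} s) \<partial>lborel)"
    proof (intro nn_integral_cong)
      fix s :: real
      have "t * (t powr (- p - 1)) = t powr (- p)"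
        using t by (simp add: powr_mult_base)
      then have "t * ((t * s) powr (- p - 1)) = t powr (- p) * s powr (- p - 1)" if "0 < s"
        using t that by (simp add: powr_mult mult.assoc[symmetric])
      then show "ennreal (t * ((t * s) powr (- p - 1) * exp (- ((t / (t * s)) powr r)))) * indicator {0<..} s
        = ennreal (t powr (- p)) * (ennreal (s powr (- p - 1) * exp (- ((1 / s) powr r))) * indicator {0<..} s)"
        using t by (auto simp: indicator_def ennreal_mult'[symmetric] mult.assoc[symmetric])
    qed
    also have "\<dots> = ennreal (t powr (- p)) * I 1" unfolding I_def by (subst nn_integral_cmult) auto
    finally show ?thesis .
  qed
  have fin: "I 1 < \<infinity>" unfolding I_def
  proof (rule nn_integral_half_line_finite[where a=0 and b="p + 1" and B=1])
    \<comment> \<open>Chosen so that the \<open>a\<close>-th power of \<open>(1 / s) powr r\<close>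
      is exactly the singular factor \<open>s powr (- p - 1)\<close>; \<open>powr_le_exp\<close>
      then cancels the singularity at 0 against the exponential.\<close>
    define a where "a = (p + 1) / r"
    have a: "0 < a" using r p by (simp add: a_def)
    show "s powr (- p - 1) * exp (- ((1 / s) powr r)) \<le> ((p + 1) / r) powr ((p + 1) / r) * s powr 0" if s: "0 < s" "s \<le> 1" for s
    proof -
      have "((1 / s) powr r) powr a = (1 / s) powr (p + 1)"
        using r by (simp add: a_def powr_powr)
      also have "\<dots> = s powr (- p - 1)"
        using s powr_minus[of s "p+1"] by (simp add: powr_divide inverse_eq_divide)
      finally have "s powr (- p - 1) = ((1 / s) powr r) powr a" ..
      also have "\<dots> \<le> a powr a * exp ((1 / s) powr r)" using a by (intro powr_le_exp) auto
      finally show ?thesis using s by (simp add: exp_minus field_simps a_def)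
    qed
  qed (use p in \<open>auto intro!: mult_left_le\<close>)
  have pos: "0 < I 1" unfolding I_def
  proof (rule nn_integral_half_line_pos)
    show "2 powr (- p - 1) * exp (- 1) \<le> s powr (- p - 1) * exp (- ((1 / s) powr r))" if "1 \<le> s" "s \<le> 2" for s
      using that p r powr_mono2'[of "p+1" s 2] powr_mono2[of r "1/s" 1]
      by (intro mult_mono) (auto simp: algebra_simps powr_mono2')
  qed simp
  obtain c where c: "I 1 = ennreal c" "0 < c"
    using fin pos by (cases "I 1") auto
  \<comment> \<open>The integrand decreases in t, so \<open>I 0\<close> dominates every
    \<open>t powr (- p) * c\<close>, and these are unbounded as t tends to 0.\<close>
  have I0: "I 0 = \<infinity>"
  proof (rule ccontr)
    assume "I 0 \<noteq> \<infinity>"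
    then obtain b where b: "I 0 = ennreal b" "0 \<le> b" by (cases "I 0") auto
    have "I t \<le> I 0" for t unfolding I_def
      by (intro nn_integral_mono mult_right_mono ennreal_leI mult_left_mono) auto
    then have "ennreal (t powr (- p) * c) \<le> ennreal b" if "0 < t" for t
      using scale[OF that] c b that by (metis ennreal_mult' powr_ge_zero)
    \<comment> \<open>At this t the left-hand side equals \<open>b + 1\<close>.\<close>
    from this[of "((b + 1) / c) powr (- 1 / p)"] b c p show False
      by (simp add: powr_powr ennreal_le_iff)
  qed
  show ?thesis
  proof (rule that[of "1 / c"])
    show "0 < 1 / c" using c by simp
    fix t :: real assume t: "0 \<le> t"
    have "(\<integral>\<^sup>+s\<in>{0<..}. ennreal (1 / c * s powr (- p - 1) * exp (- ((t / s) powr r))) \<partial>lborel)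
      = (\<integral>\<^sup>+s. ennreal (1 / c) * (ennreal (s powr (- p - 1) * exp (- ((t / s) powr r))) * indicator {0<..} s) \<partial>lborel)"
      using c by (intro nn_integral_cong) (simp add: ennreal_mult'[symmetric] mult.assoc indicator_def)
    also have "\<dots> = ennreal (1 / c) * I t" unfolding I_def by (rule nn_integral_cmult) simp
    also have "\<dots> = neg_power p t"
    proof (cases "t = 0")
      case True then show ?thesis using c I0 by (simp add: neg_power_def ennreal_mult_top)
    next
      case False then show ?thesis using c t scale[of t] by (simp add: neg_power_def ennreal_mult'[symmetric])
    qed
    finally show "neg_power p t = (\<integral>\<^sup>+s\<in>{0<..}. ennreal (1 / c * s powr (- p - 1) * exp (- ((t / s) powr r))) \<partial>lborel)" ..
  qed
qed

section \<open>Approximation of powers by \<open>1 - cos\<close>\<close>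

text \<open>The half-angle formula turns 1 - cos into twice a squared sine, and the quotient becomes
  the square of z times a value of \<open>sinc\<close> near 0.\<close>

lemma cos_difference_quotient: "(\<lambda>m. 2 * (real m)\<^sup>2 * (1 - cos (z / real m))) \<longlonglongrightarrow> z\<^sup>2"
proof (rule Lim_transform_eventually)
  have "(\<lambda>m. z / (2 * real m)) \<longlonglongrightarrow> 0"
    by (rule real_tendsto_divide_at_top[OF tendsto_const])
       (auto intro!: filterlim_tendsto_pos_mult_at_top[OF tendsto_const] filterlim_real_sequentially)
  then have "(\<lambda>m. sinc (z / (2 * real m))) \<longlonglongrightarrow> sinc 0"
    by (rule isCont_tendsto_compose[OF isCont_sinc])
  then show "(\<lambda>m. z\<^sup>2 * (sinc (z / (2 * real m)))\<^sup>2) \<longlonglongrightarrow> z\<^sup>2"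
    by (auto intro!: tendsto_eq_intros)
  show "\<forall>\<^sub>F m in sequentially. z\<^sup>2 * (sinc (z / (2 * real m)))\<^sup>2 = 2 * (real m)\<^sup>2 * (1 - cos (z / real m))"
    using eventually_gt_at_top[of 0]
  proof eventually_elim
    case (elim m)
    have "1 - cos (z / real m) = 2 * (sin (z / (2 * real m)))\<^sup>2"
      using cos_double_sin[of "z / (2 * real m)"] by (simp add: field_simps)
    then show ?case using elim by (cases "z = 0") (simp_all add: power_divide power_mult_distrib)
  qed
qed

text \<open>Levy-Khintchine representation of the power. For r < 2 it is a constant multiple of the
  integral of 1 - cos(uz) against u^(-1-r) du on the positive half-line. That measure is infinite
  near 0, so it is cut off; the truncated integrals increase to the limit and thus never exceed it.
  For r = 2 the integral diverges and a second difference quotient, given by a single atom near 0,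
  takes its place. Finiteness of each \<open>\<nu> m\<close> matters because the total mass is later
  separated from the cosine part.\<close>

lemma abs_powr_levy:
  assumes r: "0 < r" "r \<le> 2"
  obtains \<nu> :: "nat \<Rightarrow> real measure"
  where "\<And>m. finite_measure (\<nu> m)" and "\<And>m. sets (\<nu> m) = sets borel"
    and "\<And>z. (\<lambda>m. \<integral>u. 1 - cos (u * z) \<partial>\<nu> m) \<longlonglongrightarrow> \<bar>z\<bar> powr r"
    and "\<And>m z. (\<integral>u. 1 - cos (u * z) \<partial>\<nu> m) \<le> \<bar>z\<bar> powr r"
proof (cases "r = 2")
  case True
  define \<nu> where "\<nu> m = density (return borel (1 / real m)) (\<lambda>_. ennreal (2 * (real m)\<^sup>2))" for m
  have val: "(\<integral>u. 1 - cos (u * z) \<partial>\<nu> m) = 2 * (real m)\<^sup>2 * (1 - cos (z / real m))" for m z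
    unfolding \<nu>_def by (subst integral_real_density) (auto simp: integral_return)
  show ?thesis
  proof (rule that[of \<nu>])
    show "finite_measure (\<nu> m)" for m
      by (rule finite_measureI) (simp add: \<nu>_def emeasure_density nn_integral_return ennreal_mult_eq_top_iff)
    show "sets (\<nu> m) = sets borel" for m by (simp add: \<nu>_def)
    show "(\<lambda>m. \<integral>u. 1 - cos (u * z) \<partial>\<nu> m) \<longlonglongrightarrow> \<bar>z\<bar> powr r" for z
      unfolding val using cos_difference_quotient[of z] True by (cases "z = 0") (simp_all add: powr_numeral)
    \<comment> \<open>At \<open>m = 0\<close> the atom has weight 0, so that the division by zero in
      its position is harmless.\<close>
    show "(\<integral>u. 1 - cos (u * z) \<partial>\<nu> m) \<le> \<bar>z\<bar> powr r" for m z
    proof (cases "m = 0")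
      case False
      have "2 * (real m)\<^sup>2 * (1 - cos (z / real m)) \<le> 2 * (real m)\<^sup>2 * ((z / real m)\<^sup>2 / 2)"
        by (intro mult_left_mono one_minus_cos_le) simp
      also have "\<dots> = z\<^sup>2" using False by (simp add: power_divide)
      finally show ?thesis unfolding val using True by (cases "z = 0") (simp_all add: powr_numeral)
    qed (simp add: val)
  qed
next
  case False
  then have r: "0 < r" "r < 2" using assms by auto
  define f where "f z u = (1 - cos (u * z)) * u powr (- 1 - r)" for z u :: real
  have f_nn: "0 \<le> f z u" for z u by (simp add: f_def)
  define A where "A z = (\<integral>\<^sup>+u\<in>{0<..}. ennreal (f z u) \<partial>lborel)" for z
  have [measurable]: "f z \<in> borel_measurable borel" for z unfolding f_def by measurable
  have f_neg: "f (- z) = f z" for z by (auto simp: f_def fun_eq_iff)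
  have A_scale: "A z = ennreal (\<bar>z\<bar> powr r) * A 1" for z
  proof (cases "z = 0")
    case True then show ?thesis by (simp add: A_def f_def)
  next
    case False
    define t where "t = \<bar>z\<bar>"
    have t: "0 < t" using False by (simp add: t_def)
    have "A z = A t" using f_neg[of z] by (cases "z \<ge> 0") (auto simp: A_def t_def)
    also have "A t = (\<integral>\<^sup>+u\<in>{0<..}. ennreal ((1 / t) * f t ((1 / t) * u)) \<partial>lborel)"
      unfolding A_def using t by (intro nn_integral_pos_scale) auto
    also have "\<dots> = (\<integral>\<^sup>+u. ennreal (t powr r) * (ennreal (f 1 u) * indicator {0<..} u) \<partial>lborel)"
    proof (intro nn_integral_cong)
      fix u :: real
      have "(1 / t) * ((1 / t) * u) powr (- 1 - r) = t powr r * u powr (- 1 - r)" if u: "0 < u"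
      proof -
        have "(1 / t) * (1 / t) powr (- 1 - r) = (1 / t) powr (- r)"
          using t powr_mult_base[of "1 / t" "- 1 - r"] by simp
        also have "\<dots> = t powr r" using t by (simp add: powr_divide powr_minus field_simps)
        finally have "(1 / t) * (1 / t) powr (- 1 - r) = t powr r" .
        then show ?thesis using t u by (subst powr_mult) (simp_all add: mult.assoc[symmetric])
      qed
      moreover have "(1 / t) * f t ((1 / t) * u) = (1 - cos u) * ((1 / t) * ((1 / t) * u) powr (- 1 - r))"
        using t by (simp add: f_def)
      ultimately have "(1 / t) * f t ((1 / t) * u) = t powr r * f 1 u" if u: "0 < u"
        using u by (simp add: f_def)
      then show "ennreal ((1 / t) * f t ((1 / t) * u)) * indicator {0<..} u = ennreal (t powr r) * (ennreal (f 1 u) * indicator {0<..} u)"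
        by (auto simp: indicator_def ennreal_mult'[symmetric])
    qed
    also have "\<dots> = ennreal (t powr r) * A 1" unfolding A_def by (subst nn_integral_cmult) auto
    finally show ?thesis by (simp add: t_def)
  qed
  \<comment> \<open>The exponent 1 - r at the origin comes from the quadratic bound for 1 - cos and
    exceeds -1 because r < 2; at infinity 1 - cos is at most 2, and 1 + r > 1 because r is
    positive.\<close>
  have fin: "A 1 < \<infinity>" unfolding A_def
  proof (rule nn_integral_half_line_finite[where a="1 - r" and b="1 + r" and A=1 and B=2])
    fix u :: real
    show "f 1 u \<le> 1 * u powr (1 - r)" if u: "0 < u" "u \<le> 1"
    proof -
      have "1 - cos u \<le> u\<^sup>2" using one_minus_cos_le[of u] zero_le_power2[of u] by linarith
      then have "f 1 u \<le> u\<^sup>2 * u powr (- 1 - r)"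
        unfolding f_def by (intro mult_right_mono) simp_all
      then show ?thesis using u powr_add[of u 2 "-1-r"] by (simp add: powr_numeral)
    qed
    have "f 1 u \<le> 2 * u powr (- 1 - r)"
      unfolding f_def using cos_ge_minus_one[of u] by (intro mult_right_mono) (auto simp del: cos_ge_minus_one)
    then show "f 1 u \<le> 2 * u powr (- (1 + r))" by simp
  qed (use r in auto)
  have pos: "0 < A 1" unfolding A_def
  proof (rule nn_integral_half_line_pos)
    show "(1 - cos 1) * 2 powr (- 1 - r) \<le> f 1 u" if "1 \<le> u" "u \<le> 2" for u
      using that r powr_mono2'[of "1 + r" u 2] cos_monotone_0_pi_le[of 1 u] pi_ge_two
      unfolding f_def by (intro mult_mono) (auto simp: algebra_simps powr_mono2')
    have "cos 1 < (1::real)" using cos_monotone_0_pi[of 0 1] pi_ge_two by simp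
    then show "0 < (1 - cos 1) * 2 powr (- 1 - r)" by simp
  qed
  obtain c where c: "A 1 = ennreal c" "0 < c"
    using fin pos by (cases "A 1") auto
  \<comment> \<open>The cutoff at \<open>1 / Suc m\<close> makes the mass finite, and dividing by
    \<open>c\<close> normalizes the limit to the exact power.\<close>
  define w where "w m u = indicator {1 / real (Suc m)..} u * (u powr (- 1 - r) / c)" for m :: nat and u :: real
  have w_nn: "0 \<le> w m u" for m u using c by (simp add: w_def)
  have [measurable]: "w m \<in> borel_measurable borel" for m unfolding w_def by measurable
  define \<nu> where "\<nu> m = density lborel (\<lambda>u. ennreal (w m u))" for m
  have \<nu>_fin: "finite_measure (\<nu> m)" for m
  proof (rule finite_measureI)
    have "emeasure (\<nu> m) (space (\<nu> m)) = (\<integral>\<^sup>+u. ennreal (1 / c) * (ennreal (u powr (- (1 + r))) * indicator {1 / real (Suc m)..} u) \<partial>lborel)"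
      unfolding \<nu>_def using c
      by (simp add: emeasure_density w_def) (intro nn_integral_cong, auto simp: indicator_def ennreal_mult'[symmetric])
    also have "\<dots> < \<infinity>"
      using r by (subst nn_integral_cmult, simp, subst nn_integral_powr_inf) (simp_all add: ennreal_mult_less_top)
    finally show "emeasure (\<nu> m) (space (\<nu> m)) \<noteq> \<infinity>" by simp
  qed
  have w_val: "ennreal ((1 - cos (u * z)) * w m u) = ennreal (1 / c) * (ennreal (f z u) * indicator {1 / real (Suc m)..} u)" for u z m
    using c by (auto simp: w_def f_def indicator_def ennreal_mult'[symmetric])
  have int_val: "ennreal (\<integral>u. 1 - cos (u * z) \<partial>\<nu> m) = (\<integral>\<^sup>+u. ennreal ((1 - cos (u * z)) * w m u) \<partial>lborel)" for m z
  proof -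
    have "integrable (\<nu> m) (\<lambda>u. 1 - cos (u * z))"
      by (rule finite_measure_integrable_bounded[OF \<nu>_fin, where B=2])
         (auto simp: \<nu>_def abs_le_iff intro: order_trans[OF cos_le_one])
    then have "ennreal (\<integral>u. 1 - cos (u * z) \<partial>\<nu> m) = (\<integral>\<^sup>+u. ennreal (1 - cos (u * z)) \<partial>\<nu> m)"
      by (subst nn_integral_eq_integral) auto
    also have "\<dots> = (\<integral>\<^sup>+u. ennreal ((1 - cos (u * z)) * w m u) \<partial>lborel)"
      unfolding \<nu>_def by (subst nn_integral_density) (auto simp: ennreal_mult' w_nn mult.commute)
    finally show ?thesis .
  qed
  have tot: "ennreal (1 / c) * A z = ennreal (\<bar>z\<bar> powr r)" for z
    unfolding A_scale[of z] c(1) using c(2) by (simp add: ennreal_mult'[symmetric])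
  have nn: "0 \<le> (\<integral>u. 1 - cos (u * z) \<partial>\<nu> m)" for m z by (rule integral_nonneg_AE) simp
  have sub: "1 / real (Suc m) \<le> u \<Longrightarrow> 0 < u" for m u
    by (rule less_le_trans[of _ "1 / real (Suc m)"]) simp_all
  show ?thesis
  proof (rule that[of \<nu>, OF \<nu>_fin])
    show "sets (\<nu> m) = sets borel" for m by (simp add: \<nu>_def)
    fix z
    have "(\<integral>\<^sup>+u. ennreal ((1 - cos (u * z)) * w m u) \<partial>lborel) \<le> ennreal (1 / c) * A z" for m
      unfolding A_def by (subst nn_integral_cmult[symmetric], simp)
        (intro nn_integral_mono, use sub in \<open>auto simp: w_val indicator_def intro!: mult_left_mono simp del: of_nat_Suc\<close>)
    then show "(\<integral>u. 1 - cos (u * z) \<partial>\<nu> m) \<le> \<bar>z\<bar> powr r" for m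
      using int_val[of m z] tot[of z] by (metis ennreal_le_iff powr_ge_zero)
    have "(\<lambda>m. \<integral>\<^sup>+u. ennreal ((1 - cos (u * z)) * w m u) \<partial>lborel) \<longlonglongrightarrow> (\<integral>\<^sup>+u. ennreal (1 / c) * (ennreal (f z u) * indicator {0<..} u) \<partial>lborel)"
    proof (rule nn_integral_LIMSEQ)
      show "incseq (\<lambda>m u. ennreal ((1 - cos (u * z)) * w m u))"
      proof (rule incseq_SucI, rule le_funI)
        fix m u
        have "1 / real (Suc (Suc m)) \<le> 1 / real (Suc m)" by (simp add: frac_le)
        then show "ennreal ((1 - cos (u * z)) * w m u) \<le> ennreal ((1 - cos (u * z)) * w (Suc m) u)"
          using c by (intro ennreal_leI mult_left_mono) (auto simp: w_def indicator_def)
      qed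
      fix u
      have "eventually (\<lambda>m. ennreal ((1 - cos (u * z)) * w m u) = ennreal (1 / c) * (ennreal (f z u) * indicator {0<..} u)) sequentially"
      proof (cases "0 < u")
        case True
        then obtain N where N: "1 / real (Suc N) < u" using reals_Archimedean by (auto simp: inverse_eq_divide)
        show ?thesis unfolding eventually_sequentially w_val
        proof (intro exI allI impI)
          fix m assume "N \<le> m"
          then have "1 / real (Suc m) \<le> 1 / real (Suc N)" by (simp add: frac_le)
          then have "1 / real (Suc m) \<le> u" using N by simp
          then show "ennreal (1 / c) * (ennreal (f z u) * indicator {1 / real (Suc m)..} u) = ennreal (1 / c) * (ennreal (f z u) * indicator {0<..} u)"
            using True by simp
        qed
      next
        case False
        then have "\<not> 1 / real (Suc m) \<le> u" for m using sub by blast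
        with False show ?thesis unfolding w_val by simp
      qed
      then show "(\<lambda>m. ennreal ((1 - cos (u * z)) * w m u)) \<longlonglongrightarrow> ennreal (1 / c) * (ennreal (f z u) * indicator {0<..} u)"
        by (rule tendsto_eventually)
    qed simp
    then have "(\<lambda>m. ennreal (\<integral>u. 1 - cos (u * z) \<partial>\<nu> m)) \<longlonglongrightarrow> ennreal (\<bar>z\<bar> powr r)"
      unfolding int_val by (simp add: nn_integral_cmult tot[unfolded A_def])
    then show "(\<lambda>m. \<integral>u. 1 - cos (u * z) \<partial>\<nu> m) \<longlonglongrightarrow> \<bar>z\<bar> powr r"
      by (subst (asm) tendsto_ennreal_iff) (auto simp: nn)
  qed
qed

section \<open>Gaussian integrals\<close>

lemma std_normal_cos: "(\<integral>x. cos (t * x) \<partial>std_normal_distribution) = exp (- t\<^sup>2 / 2)"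
proof -
  interpret real_distribution std_normal_distribution by (rule real_dist_normal_dist)
  have "(\<integral>x. cos (t * x) \<partial>std_normal_distribution) = Re (char std_normal_distribution t)"
    unfolding char_def by (subst integral_Re[symmetric]) (auto intro!: integrable_iexp simp: Re_exp)
  then show ?thesis by (simp add: char_std_normal_distribution)
qed

lemma integrable_gaussian:
  assumes d: "0 < d" shows "integrable lborel (\<lambda>s. exp (- d * s\<^sup>2) :: real)"
proof -
  define \<sigma> where "\<sigma> = sqrt (1 / (2 * d))"
  have \<sigma>: "0 < \<sigma>" "\<sigma>\<^sup>2 = 1 / (2 * d)" using d by (simp_all add: \<sigma>_def)
  have "integrable lborel (\<lambda>s. sqrt (2 * pi * \<sigma>\<^sup>2) * normal_density 0 \<sigma> s)"
    using \<sigma> by (intro integrable_mult_right integrable_normal_density)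
  also have "(\<lambda>s. sqrt (2 * pi * \<sigma>\<^sup>2) * normal_density 0 \<sigma> s) = (\<lambda>s. exp (- d * s\<^sup>2))"
    using \<sigma> d by (simp add: normal_density_def fun_eq_iff)
  finally show ?thesis .
qed

lemma prod_cis: "(\<Prod>b\<in>B. cis (f b)) = cis (\<Sum>b\<in>B. f b)"
  by (induction B rule: infinite_finite_induct) (auto simp: cis_mult)

lemma integral_gaussian_cos:
  assumes d: "0 < d"
  shows "(\<integral>s. exp (- d * s\<^sup>2) * cos (s * z) \<partial>lborel) = sqrt (pi / d) * exp (- z\<^sup>2 / (4 * d))"
proof -
  \<comment> \<open>The scale that turns the exponent \<open>x\<^sup>2 / 2\<close> of the standard
    normal density into \<open>d * s\<^sup>2\<close>.\<close>
  define c where "c = 1 / sqrt (2 * d)"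
  have c: "0 < c" "c\<^sup>2 = 1 / (2 * d)" using d by (simp_all add: c_def power_divide)
  have "exp (- (z * c)\<^sup>2 / 2) = (\<integral>x. std_normal_density x * cos ((z * c) * x) \<partial>lborel)"
    unfolding std_normal_cos[symmetric] by (subst integral_density) auto
  also have "\<dots> = (1 / sqrt (2 * pi)) * (\<integral>x. exp (- x\<^sup>2 / 2) * cos ((z * c) * x) \<partial>lborel)"
    by (simp add: std_normal_density_def mult.assoc)
  also have "(\<integral>x. exp (- x\<^sup>2 / 2) * cos ((z * c) * x) \<partial>lborel)
     = (1 / c) * (\<integral>s. exp (- (s / c)\<^sup>2 / 2) * cos ((z * c) * (s / c)) \<partial>lborel)"
    using c by (subst lborel_integral_real_affine[of "1 / c" _ 0]) auto
  also have "(\<integral>s. exp (- (s / c)\<^sup>2 / 2) * cos ((z * c) * (s / c)) \<partial>lborel) = (\<integral>s. exp (- d * s\<^sup>2) * cos (s * z) \<partial>lborel)"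
    using c d by (intro Bochner_Integration.integral_cong) (auto simp: power_divide mult.commute)
  finally have "(\<integral>s. exp (- d * s\<^sup>2) * cos (s * z) \<partial>lborel) = c * sqrt (2 * pi) * exp (- (z * c)\<^sup>2 / 2)"
    using c by (simp add: field_simps)
  also have "c * sqrt (2 * pi) = sqrt (pi / d)"
    using d by (simp add: c_def real_sqrt_mult real_sqrt_divide)
  finally show ?thesis using c d by (simp add: power_mult_distrib)
qed

lemma integral_even_half:
  fixes f :: "real \<Rightarrow> real"
  assumes i: "integrable lborel f" and e: "\<And>x. f (- x) = f x"
  shows "(\<integral>s. indicator {0<..} s * f s \<partial>lborel) = (\<integral>s. f s \<partial>lborel) / 2"
proof -
  have i1: "integrable lborel (\<lambda>s. indicator {0<..} s * f s)" "integrable lborel (\<lambda>s. indicator {..<0} s * f s)"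
    using integrable_mult_indicator[OF _ i, of "{0<..}"] integrable_mult_indicator[OF _ i, of "{..<0}"] by auto
  have "(\<integral>s. f s \<partial>lborel) = (\<integral>s. indicator {0<..} s * f s + indicator {..<0} s * f s \<partial>lborel)"
    by (intro integral_cong_AE) (use i i1 AE_lborel_singleton[of "0::real"] in \<open>auto simp: indicator_def\<close>)
  also have "\<dots> = (\<integral>s. indicator {0<..} s * f s \<partial>lborel) + (\<integral>s. indicator {..<0} s * f s \<partial>lborel)"
    using i1 by simp
  also have "(\<integral>s. indicator {..<0} s * f s \<partial>lborel) = (\<integral>s. indicator {0<..} s * f s \<partial>lborel)"
    by (subst lborel_integral_real_affine[of "-1" _ 0]) (auto simp: e indicator_def intro!: Bochner_Integration.integral_cong)
  finally show ?thesis by simp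
qed

lemma integral_half_gaussian_cos:
  assumes d: "0 < d"
  shows "(\<integral>s. indicator {0<..} s * (exp (- d * s\<^sup>2) * cos (s * z)) \<partial>lborel) = sqrt (pi / d) / 2 * exp (- z\<^sup>2 / (4 * d))"
  using integral_gaussian_cos[OF d, of z]
  by (subst integral_even_half)
    (auto intro!: Bochner_Integration.integrable_bound[OF integrable_gaussian[OF d]] simp: abs_mult mult_left_le)

text \<open>The standard Gaussian measure, obtained from independent normal coordinates. Its use is
  the reverse reading of the identity: a Gaussian function is an average of cosines over a
  probability measure.\<close>

lemma gaussian_vector:
  "\<exists>\<Gamma> :: 'v::euclidean_space measure. prob_space \<Gamma> \<and> sets \<Gamma> = sets borel \<and>
    (\<forall>z. (\<integral>\<eta>. cos (z \<bullet> \<eta>) \<partial>\<Gamma>) = exp (- (norm z)\<^sup>2 / 2))"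
proof -
  interpret R: real_distribution std_normal_distribution by (rule real_dist_normal_dist)
  interpret product_prob_space "\<lambda>_::'v. std_normal_distribution" UNIV ..
  let ?M = "\<Pi>\<^sub>M b\<in>Basis. std_normal_distribution :: ('v \<Rightarrow> real) measure"
  let ?S = "\<lambda>f. \<Sum>b\<in>Basis. f b *\<^sub>R (b :: 'v)"
  have [measurable]: "?S \<in> borel_measurable ?M" by measurable
  have [measurable]: "(\<lambda>a. cis (c * a)) \<in> borel_measurable borel" for c
    by (intro borel_measurable_continuous_onI continuous_intros)
  interpret M: prob_space ?M by (rule prob_space_PiM) (rule R.prob_space_axioms)
  show ?thesis
  proof (intro exI[of _ "distr ?M borel ?S"] conjI allI)
    show "prob_space (distr ?M borel ?S)" by (rule M.prob_space_distr) simp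
    fix z :: 'v
    have "(\<integral>\<eta>. cos (z \<bullet> \<eta>) \<partial>distr ?M borel ?S) = (\<integral>f. cos (z \<bullet> ?S f) \<partial>?M)"
      by (subst integral_distr) auto
    also have "\<dots> = (\<integral>f. Re (\<Prod>b\<in>Basis. cis ((z \<bullet> b) * f b)) \<partial>?M)"
      by (intro Bochner_Integration.integral_cong) (simp_all add: prod_cis inner_sum_right mult.commute)
    also have "\<dots> = Re (\<integral>f. (\<Prod>b\<in>Basis. cis ((z \<bullet> b) * f b)) \<partial>?M)"
      by (rule integral_Re) (intro product_integrable_prod, auto intro!: R.integrable_const_bound[where B=1])
    also have "(\<integral>f. (\<Prod>b\<in>Basis. cis ((z \<bullet> b) * f b)) \<partial>?M) = (\<Prod>b\<in>Basis. \<integral>x. cis ((z \<bullet> b) * x) \<partial>std_normal_distribution)"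
      by (intro product_integral_prod) (auto intro!: R.integrable_const_bound[where B=1])
    also have "\<dots> = (\<Prod>b\<in>Basis. complex_of_real (exp (- (z \<bullet> b)\<^sup>2 / 2)))"
      using fun_cong[OF char_std_normal_distribution] by (simp add: char_def cis_conv_exp)
    also have "Re \<dots> = exp (- (\<Sum>b\<in>Basis. (z \<bullet> b)\<^sup>2) / 2)"
      by (simp add: of_real_prod[symmetric] exp_sum[symmetric] sum_negf sum_divide_distrib del: of_real_prod of_real_exp)
    also have "(\<Sum>b\<in>Basis. (z \<bullet> b)\<^sup>2) = (norm z)\<^sup>2"
      unfolding power2_norm_eq_inner by (subst euclidean_inner) (simp add: power2_eq_square)
    finally show "(\<integral>\<eta>. cos (z \<bullet> \<eta>) \<partial>distr ?M borel ?S) = exp (- (norm z)\<^sup>2 / 2)" .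
  qed simp
qed

section \<open>Changes of variables, negative powers and homogeneous functions\<close>

lemma nn_integral_affine_euclidean:
  fixes f :: "'v::euclidean_space \<Rightarrow> ennreal"
  assumes [measurable]: "f \<in> borel_measurable borel" and c: "c \<noteq> 0"
  shows "(\<integral>\<^sup>+y. f y \<partial>lborel) = ennreal (\<bar>c\<bar> ^ DIM('v)) * (\<integral>\<^sup>+y. f (t + c *\<^sub>R y) \<partial>lborel)"
  by (subst lborel_affine[OF c, of t])
    (simp add: nn_integral_density nn_integral_distr nn_integral_cmult ennreal_power[symmetric])

lemma integral_affine_euclidean:
  fixes f :: "'v::euclidean_space \<Rightarrow> real"
  assumes [measurable]: "f \<in> borel_measurable borel" and c: "c \<noteq> 0"
  shows "(\<integral>y. f y \<partial>lborel) = \<bar>c\<bar> ^ DIM('v) * (\<integral>y. f (t + c *\<^sub>R y) \<partial>lborel)"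
  by (subst lborel_affine[OF c, of t])
    (simp add: integral_density integral_distr)

text \<open>Inversion in \<open>ennreal\<close> sends 0 to infinity and is continuous there, so this
  form makes \<open>neg_power p\<close> continuous up to and including 0.\<close>

lemma neg_power_eq_inverse:
  assumes "0 < p" "0 \<le> t" shows "neg_power p t = inverse (ennreal (t powr p))"
  using assms by (cases "t = 0") (simp_all add: neg_power_def powr_minus inverse_ennreal)

lemma neg_power_mult:
  assumes "0 < p" "0 < a" "0 \<le> t" shows "neg_power p (a * t) = ennreal (a powr (- p)) * neg_power p t"
  using assms by (cases "t = 0") (simp_all add: neg_power_def powr_mult ennreal_mult' ennreal_mult_top)

lemma neg_power_antimono:
  assumes "0 < p" "0 \<le> s" "s \<le> t" shows "neg_power p t \<le> neg_power p s"
  using assms powr_mono2[of p s t] by (auto simp: neg_power_def powr_minus intro!: ennreal_leI)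

lemma neg_power_tendsto:
  assumes p: "0 < p" and f: "(f \<longlongrightarrow> l) F" and nn: "\<And>x. 0 \<le> f x"
  shows "((\<lambda>x. neg_power p (f x)) \<longlongrightarrow> neg_power p l) F"
proof (cases "F = bot")
  case False
  then have l: "0 \<le> l" using f nn by (intro tendsto_lowerbound[of f l F 0]) auto
  have "((\<lambda>x. ennreal (f x powr p)) \<longlongrightarrow> ennreal (l powr p)) F"
    using f p nn by (intro tendsto_ennrealI tendsto_powr2 tendsto_const) auto
  then have "((\<lambda>x. inverse (ennreal (f x powr p))) \<longlongrightarrow> inverse (ennreal (l powr p))) F"
    using continuous_on_inverse_ennreal[of UNIV "\<lambda>x. x"]
    by (auto simp: continuous_on_def intro: tendsto_compose[where g=inverse])
  then show ?thesis using nn l p by (simp add: neg_power_eq_inverse)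
qed simp

lemma neg_power_measurable[measurable]: "neg_power p \<in> borel_measurable borel"
  unfolding neg_power_def by measurable

lemma homogeneous_spaceD:
  assumes "homogeneous_space N"
  shows homogeneous_space_scaleR: "N (t *\<^sub>R x) = \<bar>t\<bar> * N x"
    and homogeneous_space_zero: "N 0 = 0"
    and homogeneous_space_nonneg: "0 \<le> N x"
    and homogeneous_space_isCont: "isCont N x"
    and homogeneous_space_measurable: "N \<in> borel_measurable borel"
proof -
  show *: "N (t *\<^sub>R x) = \<bar>t\<bar> * N x" for t x using assms by (simp add: homogeneous_space_def)
  show "N 0 = 0" using *[of 0 0] by simp
  then show "0 \<le> N x" using assms by (cases "x = 0") (auto simp: homogeneous_space_def less_imp_le)
  show "isCont N x" using assms by (simp add: homogeneous_space_def continuous_on_eq_continuous_at)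
  show "N \<in> borel_measurable borel"
    using assms by (simp add: homogeneous_space_def borel_measurable_continuous_onI)
qed

text \<open>The constants are the minimum and the maximum of \<open>N\<close> on the compact unit
  sphere, spread to the whole space by homogeneity.\<close>

lemma homogeneous_space_bounds:
  fixes N :: "'v::euclidean_space \<Rightarrow> real"
  assumes "homogeneous_space N"
  obtains c C where "0 < c" "0 < C" "\<And>x. c * norm x \<le> N x" "\<And>x. N x \<le> C * norm x"
proof -
  have cont: "continuous_on (sphere 0 1) N" and hom: "\<And>t x. N (t *\<^sub>R x) = \<bar>t\<bar> * N x"
    and pos: "\<And>x. x \<noteq> 0 \<Longrightarrow> 0 < N x"
    using assms by (auto simp: homogeneous_space_def intro: continuous_on_subset)
  obtain b :: 'v where b: "b \<in> Basis" using nonempty_Basis by blast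
  then have ne: "sphere (0::'v) 1 \<noteq> {}" by (auto intro!: exI[of _ b])
  obtain u where u: "u \<in> sphere 0 1" "\<And>y. y \<in> sphere 0 1 \<Longrightarrow> N u \<le> N y"
    using continuous_attains_inf[OF compact_sphere ne cont] by auto
  obtain v where v: "v \<in> sphere 0 1" "\<And>y. y \<in> sphere 0 1 \<Longrightarrow> N y \<le> N v"
    using continuous_attains_sup[OF compact_sphere ne cont] by auto
  have N: "N x = norm x * N (x /\<^sub>R norm x)" if "x \<noteq> 0" for x
    using that by (simp add: hom)
  have N0: "N 0 = 0" using hom[of 0 0] by simp
  have *: "N u * norm x \<le> N x \<and> N x \<le> N v * norm x" for x
  proof (cases "x = 0")
    case False
    then have "x /\<^sub>R norm x \<in> sphere 0 1" by simp
    then have "N u \<le> N (x /\<^sub>R norm x)" "N (x /\<^sub>R norm x) \<le> N v" using u v by auto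
    then show ?thesis using N[OF False] False
      by (metis mult.commute mult_left_mono norm_ge_zero)
  qed (simp add: N0)
  show ?thesis
  proof (rule that[of "N u" "N v"])
    show "0 < N u" "0 < N v" using u(1) v(1) by (auto intro!: pos)
  qed (use * in auto)
qed

section \<open>Finiteness and decay of Gaussian-weighted quantities\<close>

lemma nn_integral_gaussian_finite:
  assumes d: "0 < d"
  shows "integral\<^sup>N lborel (\<lambda>x::'v::euclidean_space. ennreal (exp (- d * (norm x)\<^sup>2))) < \<infinity>"
proof -
  have "(\<integral>\<^sup>+x. ennreal (exp (- d * (norm (x::'v))\<^sup>2)) \<partial>lborel)
      = (\<integral>\<^sup>+x. ennreal (\<Prod>b\<in>Basis. exp (- d * ((x::'v) \<bullet> b)\<^sup>2)) \<partial>lborel)"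
  proof (intro nn_integral_cong arg_cong[where f=ennreal])
    fix x :: 'v
    have "(norm x)\<^sup>2 = (\<Sum>b\<in>Basis. (x \<bullet> b)\<^sup>2)"
      unfolding power2_norm_eq_inner by (subst euclidean_inner) (simp add: power2_eq_square)
    then show "exp (- d * (norm x)\<^sup>2) = (\<Prod>b\<in>Basis. exp (- d * (x \<bullet> b)\<^sup>2))"
      by (simp add: exp_sum[symmetric] sum_distrib_left sum_negf)
  qed
  also have "\<dots> = (\<integral>\<^sup>+x. (\<Prod>b\<in>Basis. ennreal (exp (- d * ((x::'v) \<bullet> b)\<^sup>2))) \<partial>lborel)"
    by (simp add: prod_ennreal)
  also have "\<dots> = (\<Prod>b\<in>(Basis::'v set). \<integral>\<^sup>+x. ennreal (exp (- d * x\<^sup>2)) \<partial>lborel)"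
    by (rule nn_integral_lborel_prod[of "\<lambda>b x. ennreal (exp (- d * x\<^sup>2))"]) auto
  also have "\<dots> = (\<Prod>b\<in>(Basis::'v set). ennreal (\<integral>x. exp (- d * x\<^sup>2) \<partial>lborel))"
    by (subst nn_integral_eq_integral[OF integrable_gaussian[OF d]]) auto
  also have "\<dots> < \<infinity>" by (simp add: ennreal_power less_top[symmetric])
  finally show ?thesis .
qed

lemma nn_integral_powr_gaussian_finite:
  fixes a d :: real
  assumes a: "- 1 < a" and d: "0 < d"
  shows "(\<integral>\<^sup>+s\<in>{0<..}. ennreal (s powr a * exp (- d * s\<^sup>2)) \<partial>lborel) < \<infinity>"
proof (rule nn_integral_half_line_finite[where b=2 and A=1, OF a])
  \<comment> \<open>With this exponent the \<open>e\<close>-th power of \<open>s\<^sup>2\<close> is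
    \<open>s powr (a + 2)\<close>, two degrees above \<open>s powr a\<close>, which leaves the
    integrable tail \<open>s powr (- 2)\<close>.\<close>
  define e where "e = (a + 2) / 2"
  have e: "0 < e" using a by (simp add: e_def)
  show "0 \<le> e powr e / d powr e" by simp
  show "s powr a * exp (- d * s\<^sup>2) \<le> e powr e / d powr e * s powr (- 2)" if s: "1 < s" for s
  proof -
    have "(s\<^sup>2) powr e = (s powr 2) powr e" using s by simp
    also have "\<dots> = s powr (2 * e)" by (rule powr_powr)
    also have "2 * e = a + 2" by (simp add: e_def)
    finally have "d powr e * s powr (a + 2) = (d * s\<^sup>2) powr e" using d by (simp add: powr_mult)
    also have "\<dots> \<le> e powr e * exp (d * s\<^sup>2)" using e d by (intro powr_le_exp) auto
    finally have "s powr (a + 2) * exp (- d * s\<^sup>2) \<le> e powr e / d powr e"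
      using d by (simp add: exp_minus field_simps)
    then have "s powr (a + 2) * exp (- d * s\<^sup>2) * s powr (- 2) \<le> e powr e / d powr e * s powr (- 2)"
      by (intro mult_right_mono) auto
    then show ?thesis using s powr_add[of s "a + 2" "- 2"] by (simp add: mult_ac)
  qed
qed (use d in \<open>auto intro!: mult_left_le\<close>)

text \<open>In the application m is the dimension and t is \<open>norm x / e\<close>. The 8 arises
  from the standard Gaussian at distance t/2, whose exponent is (t/2)^2 / 2. The factor 1 / (1 + t)
  serves twice: it is bounded, and it vanishes as the width \<open>e\<close> tends to 0.\<close>

lemma power_gaussian_bound:
  fixes m :: nat
  shows "\<exists>H::real. 0 < H \<and> (\<forall>t>0. t ^ m * exp (- t\<^sup>2 / 8) \<le> H / (1 + t))"
proof -
  have *: "\<exists>K>0. \<forall>t>0. t ^ j * exp (- t\<^sup>2 / 8) \<le> (K::real)" if j: "0 < j" for j :: nat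
  proof -
    define a where "a = real j / 2"
    have a: "0 < a" using j by (simp add: a_def)
    have "t ^ j * exp (- t\<^sup>2 / 8) \<le> a powr a * 8 powr a" if t: "0 < t" for t :: real
    proof -
      have "(t\<^sup>2) powr a = (t powr 2) powr a" using t by simp
      also have "\<dots> = t ^ j" using t by (simp only: powr_powr) (simp add: a_def powr_realpow)
      finally have "t ^ j = (t\<^sup>2) powr a" ..
      also have "\<dots> = (t\<^sup>2 / 8) powr a * 8 powr a" using t by (simp add: powr_divide)
      also have "\<dots> \<le> a powr a * exp (t\<^sup>2 / 8) * 8 powr a"
        using a t by (intro mult_right_mono powr_le_exp) auto
      finally show ?thesis
        by (simp add: exp_minus field_simps)
    qed
    then show ?thesis using a by (intro exI[of _ "a powr a * 8 powr a"]) auto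
  qed
  \<comment> \<open>Bounds for the powers m and m + 1 add up to a bound for t^m (1 + t).\<close>
  obtain K1 where K1: "0 < K1" "\<And>t. 0 < t \<Longrightarrow> t ^ Suc m * exp (- t\<^sup>2 / 8) \<le> (K1::real)" using *[of "Suc m"] by auto
  have "\<exists>K>0. \<forall>t>0. t ^ m * exp (- t\<^sup>2 / 8) \<le> (K::real)"
    using *[of m] by (cases "m = 0") (auto intro!: exI[of _ "1::real"])
  then obtain K0 where K0: "0 < K0" "\<And>t. 0 < t \<Longrightarrow> t ^ m * exp (- t\<^sup>2 / 8) \<le> (K0::real)" by auto
  show ?thesis
  proof (intro exI[of _ "K0 + K1"] conjI allI impI)
    fix t :: real assume t: "0 < t"
    have "t ^ m * exp (- t\<^sup>2 / 8) * (1 + t) \<le> K0 + K1"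
      using K0(2)[OF t] K1(2)[OF t] by (simp add: algebra_simps)
    then show "t ^ m * exp (- t\<^sup>2 / 8) \<le> (K0 + K1) / (1 + t)" using t by (simp add: field_simps)
  qed (use K0 K1 in simp)
qed

section \<open>Gaussian smoothing of negative powers\<close>

definition gauss :: "'v::euclidean_space \<Rightarrow> real" where
  "gauss z = exp (- (norm z)\<^sup>2 / 2)"

lemma gauss_measurable[measurable]: "gauss \<in> borel_measurable borel"
  unfolding gauss_def by measurable

lemma gauss_pos: "0 < gauss z" by (simp add: gauss_def)

lemma nn_integral_gauss: "integral\<^sup>N lborel (\<lambda>x::'v::euclidean_space. ennreal (gauss x)) < \<infinity>"
  "0 < integral\<^sup>N lborel (\<lambda>x::'v::euclidean_space. ennreal (gauss x))"
proof -
  show "integral\<^sup>N lborel (\<lambda>x::'v. ennreal (gauss x)) < \<infinity>"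
    using nn_integral_gaussian_finite[of "1/2", where 'v='v] by (simp add: gauss_def)
  have "integral\<^sup>N lborel (\<lambda>x::'v. ennreal (gauss x)) \<noteq> 0"
  proof
    assume "integral\<^sup>N lborel (\<lambda>x::'v. ennreal (gauss x)) = 0"
    then have "AE x in lborel. ennreal (gauss (x::'v)) = 0" by (subst (asm) nn_integral_0_iff_AE) auto
    then have "AE x in (lborel :: 'v measure). False"
      by eventually_elim (simp add: gauss_def)
    then have "emeasure lborel (UNIV::'v set) = 0" by (simp add: ae_filter_eq_bot_iff eventually_False)
    then show False by simp
  qed
  then show "0 < integral\<^sup>N lborel (\<lambda>x::'v. ennreal (gauss x))" by (simp add: zero_less_iff_neq_zero)
qed

lemma ennreal_tendsto_multc:
  fixes c :: ennreal
  assumes "c < top" "(f \<longlongrightarrow> l) F" shows "((\<lambda>x. f x * c) \<longlongrightarrow> l * c) F"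
  using ennreal_tendsto_cmult[OF assms] by (simp add: mult.commute)

text \<open>Convolution of the negative power with a Gaussian of width \<open>e\<close>. The
  Gaussian is not normalized; its mass is the \<open>Z\<close> occurring in the limits.\<close>

abbreviation smoothed :: "real \<Rightarrow> ('v::euclidean_space \<Rightarrow> real) \<Rightarrow> real \<Rightarrow> 'v \<Rightarrow> ennreal" where
  "smoothed p N e x \<equiv> \<integral>\<^sup>+z. neg_power p (N (x + e *\<^sub>R z)) * ennreal (gauss z) \<partial>lborel"

text \<open>The bound by \<open>A * neg_power p (N x)\<close>, uniform in the width, is the majorant
  for dominated convergence under a measure that integrates the negative power. The integral over y
  = x + e z is split at \<open>norm y = norm x / 2\<close>: outside, homogeneity makes the integrand
  comparable to its value at \<open>x\<close>; inside, local integrability controls the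
  pole.\<close>

lemma smoothed_neg_power:
  fixes N :: "'v::euclidean_space \<Rightarrow> real" and p :: real
  assumes N: "homogeneous_space N" and p: "0 < p"
    and int: "(\<integral>\<^sup>+y\<in>ball 0 1. neg_power p (N y) \<partial>lborel) < \<infinity>"
  defines "R \<equiv> \<lambda>e x. smoothed p N e x"
  defines "Z \<equiv> integral\<^sup>N lborel (\<lambda>x::'v. ennreal (gauss x))"
  obtains A where "A < \<infinity>" and "\<And>e x. 0 < e \<Longrightarrow> R e x \<le> A * neg_power p (N x)"
    and "\<And>x e. x \<noteq> 0 \<Longrightarrow> (\<And>j. 0 < e j) \<Longrightarrow> e \<longlonglongrightarrow> 0 \<Longrightarrow>
           (\<lambda>j. R (e j) x) \<longlonglongrightarrow> neg_power p (N x) * Z"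
proof -
  define n where "n = DIM('v)"
  define F where "F y = neg_power p (N y)" for y
  note hom = homogeneous_space_scaleR[OF N] and N0 = homogeneous_space_zero[OF N]
    and Nnn = homogeneous_space_nonneg[OF N] and isc = homogeneous_space_isCont[OF N]
  note [measurable] = homogeneous_space_measurable[OF N]
  have Fm[measurable]: "F \<in> borel_measurable borel"
    unfolding F_def by measurable
  obtain c C where c: "0 < c" "0 < C" "\<And>x. c * norm x \<le> N x" "\<And>x. N x \<le> C * norm x"
    using homogeneous_space_bounds[OF N] by blast
  have F_scale: "F (t *\<^sub>R y) = ennreal (t powr (- p)) * F y" if "0 < t" for t y
    using that p Nnn[of y] by (simp add: F_def hom neg_power_mult)
  have [measurable]: "ball (0::'v) r \<in> sets borel" for r by (intro borel_open open_ball)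
  define Fb where "Fb r y = F y * indicator (ball 0 r) y" for r and y :: 'v
  define far where "far x y = F y * indicator (- ball 0 (norm x / 2)) y" for x y :: 'v
  have [measurable]: "Fb r \<in> borel_measurable borel" "far x \<in> borel_measurable borel" for r x
    unfolding Fb_def far_def by measurable
  define D where "D = (\<integral>\<^sup>+y. Fb 1 y \<partial>lborel)"
  have D: "D < \<infinity>" using int by (simp add: D_def F_def Fb_def)
  have F_ball: "(\<integral>\<^sup>+y. Fb r y \<partial>lborel) = ennreal (r ^ n * r powr (- p)) * D" if r: "0 < r" for r
  proof -
    have "(\<integral>\<^sup>+y. Fb r y \<partial>lborel) = ennreal (r ^ n) * (\<integral>\<^sup>+y. Fb r (0 + r *\<^sub>R y) \<partial>lborel)"
      using r unfolding n_def by (subst nn_integral_affine_euclidean[of _ r 0]) auto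
    also have "(\<integral>\<^sup>+y. Fb r (0 + r *\<^sub>R y) \<partial>lborel)
       = (\<integral>\<^sup>+y. ennreal (r powr (- p)) * (Fb 1 y) \<partial>lborel)"
      using r by (intro nn_integral_cong) (auto simp: F_scale Fb_def indicator_def mult.assoc)
    also have "\<dots> = ennreal (r powr (- p)) * D" unfolding D_def by (rule nn_integral_cmult) simp
    finally show ?thesis using r by (simp add: ennreal_mult' mult.assoc)
  qed
  have F_upper: "F y \<le> ennreal ((c * t) powr (- p))" if "0 < t" "t \<le> norm y" for y t
  proof -
    have "c * t \<le> N y" using c(1) c(3)[of y] that by (meson mult_left_mono less_imp_le order_trans)
    then have "F y \<le> neg_power p (c * t)" unfolding F_def using p c that by (intro neg_power_antimono) auto
    then show ?thesis using c that by (simp add: neg_power_def)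
  qed
  have F_lower: "ennreal ((C * norm x) powr (- p)) \<le> F x" if "x \<noteq> 0" for x
    using neg_power_antimono[OF p Nnn[of x] c(4)[of x]] c that by (simp add: F_def neg_power_def)
  obtain H :: real where H: "0 < H" "\<And>t. 0 < t \<Longrightarrow> t ^ n * exp (- t\<^sup>2 / 8) \<le> H / (1 + t)"
    using power_gaussian_bound[of n] by blast
  \<comment> \<open>Near the origin \<open>F\<close> is large but the Gaussian weight centred at \<open>x\<close> is exponentially small.\<close>
  define RA where "RA e x = (\<integral>\<^sup>+z. far x (x + e *\<^sub>R z) * ennreal (gauss z) \<partial>lborel)" for e x
  define RB where "RB e x = (\<integral>\<^sup>+z. Fb (norm x / 2) (x + e *\<^sub>R z) * ennreal (gauss z) \<partial>lborel)" for e x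
  have R_split: "R e x = RA e x + RB e x" for e x
    unfolding R_def RA_def RB_def F_def[symmetric]
    by (subst nn_integral_add[symmetric]) (auto intro!: nn_integral_cong simp: Fb_def far_def indicator_def)
  \<comment> \<open>With r = \<open>norm x\<close>, homogeneity bounds the integral of
    \<open>F\<close> over the half-radius ball by a multiple of r^(n-p), the change of variables
    contributes e^(-n), and the Gaussian exp(-(r/e)^2 / 8). The product is r^(-p) times the quantity
    estimated by \<open>H\<close>.\<close>
  have RB_le: "RB e x \<le> ennreal (norm x powr (- p)) * (ennreal (2 powr p * H / (1 + norm x / e)) * D)"
    if e: "0 < e" and x: "x \<noteq> 0" for e x
  proof -
    define r where "r = norm x"
    have r: "0 < r" using x by (simp add: r_def)
    have "RB e x \<le> (\<integral>\<^sup>+z. ennreal (exp (- (r / e)\<^sup>2 / 8)) * (Fb (r / 2) (x + e *\<^sub>R z)) \<partial>lborel)"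
      unfolding RB_def
    proof (intro nn_integral_mono)
      fix z
      have "gauss z \<le> exp (- (r / e)\<^sup>2 / 8)" if "norm (x + e *\<^sub>R z) < r / 2"
      proof -
        have "r \<le> norm (x + e *\<^sub>R z) + norm (e *\<^sub>R z)"
          unfolding r_def using norm_triangle_ineq4[of "x + e *\<^sub>R z" "e *\<^sub>R z"] by simp
        then have "r / 2 \<le> e * norm z" using that e by simp
        then have "(r / e) / 2 \<le> norm z" using e by (simp add: field_simps)
        then have "((r / e) / 2)\<^sup>2 \<le> (norm z)\<^sup>2" using r e by (intro power_mono) auto
        then show ?thesis by (simp add: gauss_def power_divide)
      qed
      then show "Fb (norm x / 2) (x + e *\<^sub>R z) * ennreal (gauss z)
        \<le> ennreal (exp (- (r / e)\<^sup>2 / 8)) * (Fb (r / 2) (x + e *\<^sub>R z))"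
        by (subst mult.commute) (auto simp: Fb_def indicator_def r_def intro!: mult_right_mono ennreal_leI)
    qed
    also have "\<dots> = ennreal (exp (- (r / e)\<^sup>2 / 8)) * (\<integral>\<^sup>+z. Fb (r / 2) (x + e *\<^sub>R z) \<partial>lborel)"
      by (rule nn_integral_cmult) simp
    also have "(\<integral>\<^sup>+z. Fb (r / 2) (x + e *\<^sub>R z) \<partial>lborel)
       = ennreal ((1 / e) ^ n) * (\<integral>\<^sup>+y. Fb (r / 2) y \<partial>lborel)"
    proof -
      have "(\<integral>\<^sup>+y. Fb (r / 2) y \<partial>lborel) = ennreal (e ^ n) *
        (\<integral>\<^sup>+z. Fb (r / 2) (x + e *\<^sub>R z) \<partial>lborel)"
        using e unfolding n_def by (subst nn_integral_affine_euclidean[of _ e x]) auto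
      then show ?thesis using e
        by (simp add: mult.assoc[symmetric] ennreal_mult'[symmetric] power_mult_distrib[symmetric])
    qed
    also have "(\<integral>\<^sup>+y. Fb (r / 2) y \<partial>lborel) = ennreal ((r / 2) ^ n * (r / 2) powr (- p)) * D"
      using r by (intro F_ball) simp
    also have "ennreal (exp (- (r / e)\<^sup>2 / 8)) * (ennreal ((1 / e) ^ n) * (ennreal ((r / 2) ^ n * (r / 2) powr (- p)) * D))
      = ennreal (exp (- (r / e)\<^sup>2 / 8) * ((1 / e) ^ n * ((r / 2) ^ n * (r / 2) powr (- p)))) * D"
      using e r by (simp add: ennreal_mult' mult.assoc)
    also have "\<dots> \<le> ennreal (r powr (- p) * (2 powr p * H / (1 + r / e))) * D"
    proof (intro mult_right_mono ennreal_leI)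
      have "exp (- (r / e)\<^sup>2 / 8) * ((1 / e) ^ n * ((r / 2) ^ n * (r / 2) powr (- p)))
        = (1 / 2) ^ n * (((r / e) ^ n * exp (- (r / e)\<^sup>2 / 8)) * (r powr (- p) * 2 powr p))"
        using r by (simp add: power_divide powr_divide powr_minus field_simps)
      also have "\<dots> \<le> 1 * ((H / (1 + r / e)) * (r powr (- p) * 2 powr p))"
        using r e H by (intro mult_mono mult_nonneg_nonneg H(2)) (auto simp: power_le_one)
      finally show "exp (- (r / e)\<^sup>2 / 8) * ((1 / e) ^ n * ((r / 2) ^ n * (r / 2) powr (- p)))
        \<le> r powr (- p) * (2 powr p * H / (1 + r / e))" by (simp add: mult_ac)
    qed simp
    finally show ?thesis by (simp only: r_def ennreal_mult'[OF powr_ge_zero] mult.assoc)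
  qed
  have RA_bound: "far x (x + e *\<^sub>R z)
      \<le> ennreal ((c / 2) powr (- p) * norm x powr (- p))" if "x \<noteq> 0" for e x z
    using F_upper[of "norm x / 2" "x + e *\<^sub>R z"] that c
    by (auto simp: far_def indicator_def powr_mult[symmetric])
  have Zfin: "Z < \<infinity>" unfolding Z_def by (rule nn_integral_gauss)
  have RA_le: "RA e x \<le> ennreal (norm x powr (- p)) * (ennreal ((c / 2) powr (- p)) * Z)" if x: "x \<noteq> 0" for e x
  proof -
    have "RA e x \<le> (\<integral>\<^sup>+z. ennreal ((c / 2) powr (- p) * norm x powr (- p)) * ennreal (gauss (z::'v)) \<partial>lborel)"
      unfolding RA_def using RA_bound[OF x] by (intro nn_integral_mono mult_right_mono) auto
    also have "\<dots> = ennreal ((c / 2) powr (- p) * norm x powr (- p)) * Z"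
      unfolding Z_def by (rule nn_integral_cmult) simp
    finally show ?thesis by (simp add: ennreal_mult' mult_ac)
  qed
  define A0 where "A0 = ennreal (2 powr p * H) * D + ennreal ((c / 2) powr (- p)) * Z"
  \<comment> \<open>\<open>C powr p\<close> converts \<open>norm x powr (- p)\<close> into a
    multiple of \<open>F x\<close>. The summand 1 keeps \<open>A\<close> positive, so that the bound
    at the origin reads infinity and not 0 times infinity.\<close>
  define A where "A = 1 + ennreal (C powr p) * A0"
  have A0: "A0 < \<infinity>" using D Zfin by (simp add: A0_def ennreal_mult_less_top)
  have A: "A < \<infinity>" using A0 by (simp add: A_def ennreal_mult_less_top)
  show ?thesis
  proof (rule that[of A])
    show "A < \<infinity>" by (rule A)
    show "R e x \<le> A * neg_power p (N x)" if e: "0 < e" for e x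
    proof (cases "x = 0")
      case True
      then show ?thesis by (simp add: N0 neg_power_def A_def ennreal_mult_top)
    next
      case x: False
      have "0 \<le> norm x / e" using e by simp
      then have "2 powr p * H / (1 + norm x / e) \<le> 2 powr p * H / 1" using H
        by (intro divide_left_mono) auto
      then have "ennreal (2 powr p * H / (1 + norm x / e)) * D \<le> ennreal (2 powr p * H) * D"
        by (intro mult_right_mono ennreal_leI) auto
      then have "ennreal (norm x powr (- p)) * (ennreal (2 powr p * H / (1 + norm x / e)) * D)
          \<le> ennreal (norm x powr (- p)) * (ennreal (2 powr p * H) * D)"
        by (rule mult_left_mono) simp
      then have "RB e x \<le> ennreal (norm x powr (- p)) * (ennreal (2 powr p * H) * D)"
        by (rule order_trans[OF RB_le[OF e x]])
      then have "R e x \<le> ennreal (norm x powr (- p)) * A0"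
        unfolding R_split A0_def distrib_left
        using RA_le[OF x, of e] by (subst add.commute) (rule add_mono)
      also have "ennreal (norm x powr (- p)) = ennreal (C powr p) * ennreal ((C * norm x) powr (- p))"
        using c by (simp add: powr_mult ennreal_mult'[symmetric] mult.assoc[symmetric] powr_add[symmetric])
      also have "ennreal (C powr p) * ennreal ((C * norm x) powr (- p)) * A0 \<le> ennreal (C powr p) * F x * A0"
        by (intro mult_right_mono mult_left_mono F_lower x) auto
      also have "\<dots> = (ennreal (C powr p) * A0) * F x" by (simp add: mult_ac)
      also have "\<dots> \<le> A * F x" unfolding A_def by (intro mult_right_mono) auto
      finally show ?thesis by (simp add: F_def)
    qed
    fix x :: 'v and e :: "nat \<Rightarrow> real" assume x: "x \<noteq> 0" and e: "\<And>j. 0 < e j" and e0: "e \<longlonglongrightarrow> 0"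
    have arg: "(\<lambda>j. x + e j *\<^sub>R z) \<longlonglongrightarrow> x" for z
      using tendsto_add[OF tendsto_const tendsto_scaleR[OF e0 tendsto_const], of x z] by simp
    have "(\<lambda>j. RA (e j) x) \<longlonglongrightarrow> (\<integral>\<^sup>+z. F x * ennreal (gauss (z::'v)) \<partial>lborel)"
      unfolding RA_def
    proof (rule nn_integral_dominated_convergence[where w="\<lambda>z. ennreal ((c / 2) powr (- p) * norm x powr (- p)) * ennreal (gauss z)"])
      show "(\<integral>\<^sup>+z. ennreal ((c / 2) powr (- p) * norm x powr (- p)) * ennreal (gauss (z::'v)) \<partial>lborel) < \<infinity>"
        using Zfin by (subst nn_integral_cmult) (auto simp: Z_def ennreal_mult_less_top)
      show "AE z in lborel. (\<lambda>j. far x (x + e j *\<^sub>R z) * ennreal (gauss z)) \<longlonglongrightarrow> F x * ennreal (gauss z)"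
      proof (intro AE_I2)
        fix z
        have "(\<lambda>j. F (x + e j *\<^sub>R z)) \<longlonglongrightarrow> F x"
          unfolding F_def by (intro neg_power_tendsto p isCont_tendsto_compose[OF isc] arg Nnn)
        then have "(\<lambda>j. F (x + e j *\<^sub>R z) * ennreal (gauss z)) \<longlonglongrightarrow> F x * ennreal (gauss z)"
          by (intro ennreal_tendsto_multc) simp_all
        moreover have "eventually (\<lambda>j. norm x / 2 < norm (x + e j *\<^sub>R z)) sequentially"
          using order_tendstoD(1)[OF tendsto_norm[OF arg], of "norm x / 2" z] x by simp
        then have "eventually (\<lambda>j. F (x + e j *\<^sub>R z) * ennreal (gauss z) = far x (x + e j *\<^sub>R z) * ennreal (gauss z)) sequentially"
          by eventually_elim (simp add: far_def indicator_def)
        ultimately show "(\<lambda>j. far x (x + e j *\<^sub>R z) * ennreal (gauss z)) \<longlonglongrightarrow> F x * ennreal (gauss z)"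
          by (rule Lim_transform_eventually)
      qed
      show "AE z in lborel. far x (x + e j *\<^sub>R z) * ennreal (gauss z)
         \<le> ennreal ((c / 2) powr (- p) * norm x powr (- p)) * ennreal (gauss z)" for j
        using RA_bound[OF x] by (intro AE_I2 mult_right_mono) auto
    qed auto
    moreover have "(\<integral>\<^sup>+z. F x * ennreal (gauss (z::'v)) \<partial>lborel) = F x * Z"
      unfolding Z_def by (rule nn_integral_cmult) simp
    ultimately have A_lim: "(\<lambda>j. RA (e j) x) \<longlonglongrightarrow> F x * Z" by simp
    have inf: "filterlim (\<lambda>j. 1 + norm x / e j) at_top sequentially"
      unfolding divide_inverse using x e
      by (intro filterlim_tendsto_add_at_top[OF tendsto_const] filterlim_tendsto_pos_mult_at_top[OF tendsto_const]
          filterlim_inverse_at_top[OF e0]) auto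
    have "(\<lambda>j. ennreal (2 powr p * H / (1 + norm x / e j))) \<longlonglongrightarrow> ennreal 0"
      by (intro tendsto_ennrealI real_tendsto_divide_at_top[OF tendsto_const inf])
    then have "(\<lambda>j. ennreal (norm x powr (- p)) * (ennreal (2 powr p * H / (1 + norm x / e j)) * D)) \<longlonglongrightarrow> ennreal (norm x powr (- p)) * (ennreal 0 * D)"
      using D by (intro ennreal_tendsto_cmult ennreal_tendsto_multc) simp_all
    then have "(\<lambda>j. ennreal (norm x powr (- p)) * (ennreal (2 powr p * H / (1 + norm x / e j)) * D)) \<longlonglongrightarrow> 0" by simp
    then have B_lim: "(\<lambda>j. RB (e j) x) \<longlonglongrightarrow> 0"
      by (rule tendsto_sandwich[OF _ _ tendsto_const, rotated 2]) (auto intro!: always_eventually RB_le e x)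
    show "(\<lambda>j. R (e j) x) \<longlonglongrightarrow> neg_power p (N x) * Z"
      using tendsto_add[OF A_lim B_lim] unfolding R_split F_def by simp
  qed
qed

text \<open>On the \<open>Q\<close> side Fatou's lemma gives the lower bound, whether or not the
  integral is finite. On the \<open>P\<close> side the integral may be assumed finite, and then the
  uniform majorant gives convergence. The common factor \<open>Z\<close> is positive and finite and
  cancels.\<close>

lemma nn_integral_neg_power_mono_of_smoothed:
  fixes N :: "'v::euclidean_space \<Rightarrow> real" and p :: real
  assumes N: "homogeneous_space N" and p: "0 < p"
    and int: "(\<integral>\<^sup>+y\<in>ball 0 1. neg_power p (N y) \<partial>lborel) < \<infinity>"
    and P: "finite_measure P" "sets P = sets borel" and Q: "finite_measure Q" "sets Q = sets borel"
    and le: "\<And>e. 0 < e \<Longrightarrow>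
      (\<integral>\<^sup>+x. smoothed p N e x \<partial>Q)
      \<le> (\<integral>\<^sup>+x. smoothed p N e x \<partial>P)"
  shows "(\<integral>\<^sup>+x. neg_power p (N x) \<partial>Q) \<le> (\<integral>\<^sup>+x. neg_power p (N x) \<partial>P)"
proof (cases "(\<integral>\<^sup>+x. neg_power p (N x) \<partial>P) = \<infinity>")
  case False
  define R where "R e x = (smoothed p N e x)" for e x
  define Z where "Z = integral\<^sup>N lborel (\<lambda>x::'v. ennreal (gauss x))"
  define e where "e j = 1 / real (Suc j)" for j
  have e: "0 < e j" for j by (simp add: e_def)
  have e0: "e \<longlonglongrightarrow> 0" unfolding e_def using LIMSEQ_inverse_real_of_nat by (simp add: inverse_eq_divide)
  have Z: "Z < \<infinity>" "0 < Z" using nn_integral_gauss by (auto simp: Z_def)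
  note hom = homogeneous_space_scaleR[OF N] and N0 = homogeneous_space_zero[OF N]
    and Nnn = homogeneous_space_nonneg[OF N] and isc = homogeneous_space_isCont[OF N]
  note [measurable] = homogeneous_space_measurable[OF N]
  have Rm[measurable]: "R e \<in> borel_measurable borel" for e unfolding R_def by measurable
  note [measurable_cong] = P(2) Q(2)
  have arg: "(\<lambda>j. x + e j *\<^sub>R z) \<longlonglongrightarrow> x" for x z :: 'v
    using tendsto_add[OF tendsto_const tendsto_scaleR[OF e0 tendsto_const], of x z] by simp
  \<comment> \<open>Since \<open>neg_power p\<close> is continuous at 0 with value infinity, this
    holds at the origin too, where \<open>Q\<close> might have an atom.\<close>
  have lower: "neg_power p (N x) * Z \<le> liminf (\<lambda>j. R (e j) x)" for x
  proof -
    have "neg_power p (N x) * Z = (\<integral>\<^sup>+z. neg_power p (N x) * ennreal (gauss (z::'v)) \<partial>lborel)"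
      unfolding Z_def by (rule nn_integral_cmult[symmetric]) simp
    also have "\<dots> = (\<integral>\<^sup>+z. liminf (\<lambda>j. neg_power p (N (x + e j *\<^sub>R z)) * ennreal (gauss z)) \<partial>lborel)"
    proof (intro nn_integral_cong lim_imp_Liminf[symmetric])
      fix z
      have "(\<lambda>j. neg_power p (N (x + e j *\<^sub>R z))) \<longlonglongrightarrow> neg_power p (N x)"
        by (intro neg_power_tendsto p isCont_tendsto_compose[OF isc] arg Nnn)
      then show "(\<lambda>j. neg_power p (N (x + e j *\<^sub>R z)) * ennreal (gauss z)) \<longlonglongrightarrow> neg_power p (N x) * ennreal (gauss z)"
        by (intro ennreal_tendsto_multc) simp_all
    qed simp
    also have "\<dots> \<le> liminf (\<lambda>j. R (e j) x)" unfolding R_def by (intro nn_integral_liminf) measurable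
    finally show ?thesis .
  qed
  have Zc: "(\<integral>\<^sup>+x. neg_power p (N x) * Z \<partial>M) = (\<integral>\<^sup>+x. neg_power p (N x) \<partial>M) * Z" if [measurable_cong]: "sets M = sets borel" for M
    by (rule nn_integral_multc) measurable
  obtain A where A: "A < \<infinity>" "\<And>e x. 0 < e \<Longrightarrow> R e x \<le> A * neg_power p (N x)"
    "\<And>x e. x \<noteq> 0 \<Longrightarrow> (\<And>j. 0 < e j) \<Longrightarrow> e \<longlonglongrightarrow> 0 \<Longrightarrow> (\<lambda>j. R (e j) x) \<longlonglongrightarrow> neg_power p (N x) * Z"
    unfolding R_def Z_def using smoothed_neg_power[OF N p int] by blast
  have "AE x in P. neg_power p (N x) \<noteq> \<infinity>" using False by (intro nn_integral_PInf_AE) auto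
  \<comment> \<open>A finite integral of a function that is infinite at 0 excludes an atom there;
    the pointwise limit is available only away from the origin.\<close>
  then have ne: "AE x in P. x \<noteq> 0" by eventually_elim (auto simp: N0 neg_power_def)
  have upper: "(\<lambda>j. \<integral>\<^sup>+x. R (e j) x \<partial>P) \<longlonglongrightarrow> (\<integral>\<^sup>+x. neg_power p (N x) * Z \<partial>P)"
  proof (rule nn_integral_dominated_convergence[where w="\<lambda>x. A * neg_power p (N x)"])
    show "(\<integral>\<^sup>+x. A * neg_power p (N x) \<partial>P) < \<infinity>"
      using A(1) False by (subst nn_integral_cmult) (auto simp: ennreal_mult_less_top less_top[symmetric] ennreal_mult_eq_top_iff)
    show "AE x in P. (\<lambda>j. R (e j) x) \<longlonglongrightarrow> neg_power p (N x) * Z"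
      using ne by eventually_elim (intro A(3) e e0)
  qed (use A(2) e in auto)
  have "(\<integral>\<^sup>+x. neg_power p (N x) \<partial>Q) * Z \<le> (\<integral>\<^sup>+x. liminf (\<lambda>j. R (e j) x) \<partial>Q)"
    unfolding Zc[OF Q(2), symmetric] by (intro nn_integral_mono lower)
  also have "\<dots> \<le> liminf (\<lambda>j. \<integral>\<^sup>+x. R (e j) x \<partial>Q)" by (intro nn_integral_liminf) measurable
  also have "\<dots> \<le> liminf (\<lambda>j. \<integral>\<^sup>+x. R (e j) x \<partial>P)"
    by (intro Liminf_mono always_eventually allI) (use le[OF e] in \<open>simp add: R_def\<close>)
  also have "\<dots> = (\<integral>\<^sup>+x. neg_power p (N x) * Z \<partial>P)" by (rule lim_imp_Liminf[OF _ upper]) simp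
  also have "\<dots> = (\<integral>\<^sup>+x. neg_power p (N x) \<partial>P) * Z" by (rule Zc[OF P(2)])
  finally show ?thesis
    using Z by (metis ennreal_mult_le_mult_iff infinity_ennreal_def less_irrefl mult.commute)
qed simp

section \<open>Moment inequality from a nonnegative Fourier transform\<close>

lemma power2_le_one_plus_powr:
  fixes t r :: real
  assumes "0 \<le> t" "2 \<le> r" shows "t\<^sup>2 \<le> 1 + t powr r"
proof (cases "t \<le> 1")
  case True
  then have "t\<^sup>2 \<le> 1" using assms by (simp add: power_le_one)
  then show ?thesis by (simp add: add_increasing2)
next
  case False
  then have "t powr 2 \<le> t powr r" using assms by (intro powr_mono) auto
  then show ?thesis using False by (simp add: powr_numeral)
qed

text \<open>For \<open>r \<ge> 2\<close> the square of \<open>N y\<close> is at most 1 plus its r-th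
  power, which yields a Gaussian majorant.\<close>

lemma nn_integral_exp_neg_homogeneous:
  fixes N :: "'v::euclidean_space \<Rightarrow> real" and r :: real
  assumes N: "homogeneous_space N" and r: "2 \<le> r"
  shows "(\<integral>\<^sup>+y. ennreal (exp (- (N y powr r))) \<partial>lborel) < \<infinity>"
proof -
  obtain c C where c: "0 < c" "0 < C" "\<And>x. c * norm x \<le> N x" "\<And>x. N x \<le> C * norm x"
    using homogeneous_space_bounds[OF N] by blast
  have le: "exp (- (N y powr r)) \<le> exp 1 * exp (- (c\<^sup>2) * (norm y)\<^sup>2)" for y
  proof -
    have nn: "0 \<le> c * norm y" using c(1) by simp
    then have "(c * norm y)\<^sup>2 \<le> (N y)\<^sup>2" using c(3)[of y] by (intro power_mono)
    also have "\<dots> \<le> 1 + N y powr r"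
      using order_trans[OF nn c(3)] r by (intro power2_le_one_plus_powr)
    finally show ?thesis by (simp add: exp_add[symmetric] power_mult_distrib)
  qed
  have "(\<integral>\<^sup>+y. ennreal (exp (- (N y powr r))) \<partial>lborel) \<le> (\<integral>\<^sup>+y. ennreal (exp 1) * ennreal (exp (- (c\<^sup>2) * (norm (y::'v))\<^sup>2)) \<partial>lborel)"
    by (intro nn_integral_mono, subst ennreal_mult'[symmetric], simp) (intro ennreal_leI le)
  also have "\<dots> < \<infinity>"
    using nn_integral_gaussian_finite[of "c\<^sup>2", where 'v='v] c
    by (subst nn_integral_cmult) (auto simp: ennreal_mult_less_top)
  finally show ?thesis .
qed

text \<open>For even \<Phi> this is its Fourier transform at \<open>s *\<^sub>R \<xi>\<close>, seen
  as a function on the ray through \<xi>.\<close>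

abbreviation cosine_transform :: "('v::euclidean_space \<Rightarrow> real) \<Rightarrow> 'v \<Rightarrow> real \<Rightarrow> real" where
  "cosine_transform \<Phi> \<xi> s \<equiv> \<integral>y. \<Phi> y * cos (s * (y \<bullet> \<xi>)) \<partial>lborel"

abbreviation ray_weight :: "real \<Rightarrow> real \<Rightarrow> real \<Rightarrow> real" where
  "ray_weight q d s \<equiv> indicator {0<..} s * (s powr q * exp (- d * s\<^sup>2))"

abbreviation scale_mixture :: "(real \<Rightarrow> real) \<Rightarrow> ('v::euclidean_space \<Rightarrow> real) \<Rightarrow> 'v \<Rightarrow> ennreal" where
  "scale_mixture w \<Phi> y \<equiv> \<integral>\<^sup>+s. ennreal (w s * \<Phi> (y /\<^sub>R s)) \<partial>lborel"

text \<open>Dilating the profile by \<open>s\<close> contributes the Jacobian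
  \<open>s ^ DIM('v)\<close>. The same factor, multiplied with \<open>s powr (- p - 1)\<close>, is
  the origin of the exponent n - p - 1 in \<open>ray_weight\<close>.\<close>

lemma nn_integral_scale_mixture:
  fixes \<Phi> :: "'v::euclidean_space \<Rightarrow> real" and w :: "real \<Rightarrow> real"
  assumes [measurable]: "\<Phi> \<in> borel_measurable borel" "w \<in> borel_measurable borel"
    and wnn: "\<And>s. 0 \<le> w s" and w0: "\<And>s. s \<le> 0 \<Longrightarrow> w s = 0"
  shows "(\<integral>\<^sup>+y. scale_mixture w \<Phi> y \<partial>lborel)
    = (\<integral>\<^sup>+s. ennreal (w s * s ^ DIM('v)) \<partial>lborel) * (\<integral>\<^sup>+y. ennreal (\<Phi> y) \<partial>lborel)"
proof -
  have "(\<integral>\<^sup>+y. scale_mixture w \<Phi> y \<partial>lborel) = (\<integral>\<^sup>+s. \<integral>\<^sup>+y. ennreal (w s * \<Phi> (y /\<^sub>R s)) \<partial>lborel \<partial>lborel)"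
    by (rule lborel_pair.Fubini'[symmetric]) measurable
  also have "\<dots> = (\<integral>\<^sup>+s. ennreal (w s * s ^ DIM('v)) * (\<integral>\<^sup>+y. ennreal (\<Phi> y) \<partial>lborel) \<partial>lborel)"
  proof (intro nn_integral_cong)
    fix s :: real
    show "(\<integral>\<^sup>+y. ennreal (w s * \<Phi> (y /\<^sub>R s)) \<partial>lborel) = ennreal (w s * s ^ DIM('v)) * (\<integral>\<^sup>+y. ennreal (\<Phi> y) \<partial>lborel)"
    proof (cases "0 < s")
      case True
      have "(\<integral>\<^sup>+y. ennreal (w s * \<Phi> (y /\<^sub>R s)) \<partial>lborel) = ennreal (w s) * (\<integral>\<^sup>+y. ennreal (\<Phi> (y /\<^sub>R s)) \<partial>lborel)"
        by (subst nn_integral_cmult[symmetric]) (auto simp: ennreal_mult' wnn)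
      also have "(\<integral>\<^sup>+y. ennreal (\<Phi> (y /\<^sub>R s)) \<partial>lborel) = ennreal (s ^ DIM('v)) * (\<integral>\<^sup>+y. ennreal (\<Phi> y) \<partial>lborel)"
        using True by (subst nn_integral_affine_euclidean[of _ s 0]) auto
      finally show ?thesis by (simp add: ennreal_mult' wnn mult.assoc)
    qed (simp add: w0)
  qed
  also have "\<dots> = (\<integral>\<^sup>+s. ennreal (w s * s ^ DIM('v)) \<partial>lborel) * (\<integral>\<^sup>+y. ennreal (\<Phi> y) \<partial>lborel)"
    by (rule nn_integral_multc) measurable
  finally show ?thesis .
qed

context cos_dominated
begin

text \<open>The cosine transform \<open>g\<close> of the mixture is the integral in
  \<open>pos\<close>, hence nonnegative, and it is bounded because the mixture is integrable.
  Inserting the Gaussian vector shows that the smoothed mixture averages \<open>g (\<eta> /\<^sub>R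
  e) * cos (x \<bullet> (\<eta> /\<^sub>R e))\<close> over a probability measure, so it is a
  multiplier.\<close>

lemma scale_mixture_smoothed_le:
  fixes \<Phi> :: "'v \<Rightarrow> real" and w :: "real \<Rightarrow> real"
  assumes \<Phi>m[measurable]: "\<Phi> \<in> borel_measurable borel" and \<Phi>nn: "\<And>y. 0 \<le> \<Phi> y"
    and \<Phi>even: "\<And>y. \<Phi> (- y) = \<Phi> y" and \<Phi>int: "(\<integral>\<^sup>+y. ennreal (\<Phi> y) \<partial>lborel) < \<infinity>"
    and wm[measurable]: "w \<in> borel_measurable borel" and wnn: "\<And>s. 0 \<le> w s" and w0: "\<And>s. s \<le> 0 \<Longrightarrow> w s = 0"
    and wint: "(\<integral>\<^sup>+s. ennreal (w s * s ^ DIM('v)) \<partial>lborel) < \<infinity>"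
    and pos: "\<And>\<xi>. 0 \<le> (\<integral>s. w s * s ^ DIM('v) * cosine_transform \<Phi> \<xi> s \<partial>lborel)"
    and e: "0 < e"
  shows "(\<integral>\<^sup>+x. \<integral>\<^sup>+y. scale_mixture w \<Phi> y * ennreal (gauss ((y - x) /\<^sub>R e)) \<partial>lborel \<partial>Q)
    \<le> (\<integral>\<^sup>+x. \<integral>\<^sup>+y. scale_mixture w \<Phi> y * ennreal (gauss ((y - x) /\<^sub>R e)) \<partial>lborel \<partial>P)"
proof -
  define n where "n = DIM('v)"
  define G where "G y = (\<integral>s. w s * \<Phi> (y /\<^sub>R s) \<partial>lborel)" for y
  have fin: "(\<integral>\<^sup>+y. scale_mixture w \<Phi> y \<partial>lborel) < \<infinity>"
    using wint \<Phi>int by (subst nn_integral_scale_mixture) (simp_all add: wnn w0 ennreal_mult_less_top)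
  have Gm[measurable]: "G \<in> borel_measurable borel" unfolding G_def by measurable
  have Gnn: "0 \<le> G y" for y unfolding G_def by (rule integral_nonneg_AE) (simp add: wnn \<Phi>nn)
  have Geven: "G (- y) = G y" for y unfolding G_def by (simp add: \<Phi>even)
  have "AE y in lborel. scale_mixture w \<Phi> y \<noteq> \<infinity>"
    using fin by (intro nn_integral_PInf_AE) auto
  \<comment> \<open>The mixture may be infinite on a null set, where the real-valued
    \<open>G\<close> carries the default value of a divergent integral.\<close>
  then have G_eq: "AE y in lborel. scale_mixture w \<Phi> y = ennreal (G y)"
  proof eventually_elim
    case (elim y)
    have "integrable lborel (\<lambda>s. w s * \<Phi> (y /\<^sub>R s))"
      using elim by (intro integrableI_bounded) (auto simp: wnn \<Phi>nn less_top)
    then show ?case unfolding G_def by (intro nn_integral_eq_integral) (auto simp: wnn \<Phi>nn)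
  qed
  have Gint: "integrable lborel G"
    using fin nn_integral_cong_AE[OF G_eq] by (intro integrableI_bounded) (auto simp: Gnn)
  define I where "I = (\<integral>y. G y \<partial>lborel)"
  have FG_int: "integrable lborel (\<lambda>y. G y * f y)" if [measurable]: "f \<in> borel_measurable borel" and "\<And>y. \<bar>f y\<bar> \<le> 1" for f
    using that(2) by (intro Bochner_Integration.integrable_bound[OF Gint]) (auto simp: abs_mult Gnn intro!: mult_left_le)
  define g where "g \<eta> = (\<integral>y. G y * cos (y \<bullet> \<eta>) \<partial>lborel)" for \<eta>
  have gm[measurable]: "g \<in> borel_measurable borel" unfolding g_def by measurable
  have g_bd: "\<bar>g \<eta>\<bar> \<le> I" for \<eta>
  proof -
    have "\<bar>g \<eta>\<bar> \<le> (\<integral>y. \<bar>G y * cos (y \<bullet> \<eta>)\<bar> \<partial>lborel)"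
      unfolding g_def using integral_norm_bound[of lborel "\<lambda>y. G y * cos (y \<bullet> \<eta>)"] by simp
    also have "\<dots> \<le> I" unfolding I_def
      by (intro integral_mono integrable_abs FG_int Gint) (auto simp: abs_mult Gnn intro!: mult_left_le)
    finally show ?thesis .
  qed
  \<comment> \<open>Evenness of \<open>G\<close> removes the sine terms when the cosine of a
    difference is expanded below.\<close>
  have g_sin: "(\<integral>y. G y * sin (y \<bullet> \<eta>) \<partial>lborel) = 0" for \<eta>
  proof -
    have "(\<integral>y. G y * sin (y \<bullet> \<eta>) \<partial>lborel) = - (\<integral>y. G y * sin (y \<bullet> \<eta>) \<partial>lborel)"
      by (subst integral_affine_euclidean[of _ "-1" 0]) (auto simp: Geven)
    then show ?thesis by simp
  qed
  have g_pos: "0 \<le> g \<eta>" for \<eta>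
  proof -
    have swap: "(\<integral>y. \<integral>s. w s * \<Phi> (y /\<^sub>R s) * cos (y \<bullet> \<eta>) \<partial>lborel \<partial>lborel)
      = (\<integral>s. \<integral>y. w s * \<Phi> (y /\<^sub>R s) * cos (y \<bullet> \<eta>) \<partial>lborel \<partial>lborel)"
    proof (rule Fubini_swap(1)[OF sigma_finite_lborel sigma_finite_lborel])
      have "(\<integral>\<^sup>+y. \<integral>\<^sup>+s. ennreal \<bar>w s * \<Phi> (y /\<^sub>R s) * cos (y \<bullet> \<eta>)\<bar> \<partial>lborel \<partial>lborel)
        \<le> (\<integral>\<^sup>+y. scale_mixture w \<Phi> y \<partial>lborel)"
        by (intro nn_integral_mono ennreal_leI) (auto simp: abs_mult wnn \<Phi>nn intro!: mult_left_le)
      then show "(\<integral>\<^sup>+y. \<integral>\<^sup>+s. ennreal \<bar>w s * \<Phi> (y /\<^sub>R s) * cos (y \<bullet> \<eta>)\<bar> \<partial>lborel \<partial>lborel) < \<infinity>"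
        using fin by (rule le_less_trans)
    qed measurable
    have "g \<eta> = (\<integral>y. \<integral>s. w s * \<Phi> (y /\<^sub>R s) * cos (y \<bullet> \<eta>) \<partial>lborel \<partial>lborel)"
      unfolding g_def G_def by simp
    also note swap
    also have "(\<integral>s. \<integral>y. w s * \<Phi> (y /\<^sub>R s) * cos (y \<bullet> \<eta>) \<partial>lborel \<partial>lborel)
      = (\<integral>s. w s * s ^ n * cosine_transform \<Phi> \<eta> s \<partial>lborel)"
    proof (intro Bochner_Integration.integral_cong refl)
      fix s :: real
      show "(\<integral>y. w s * \<Phi> (y /\<^sub>R s) * cos (y \<bullet> \<eta>) \<partial>lborel) = w s * s ^ n * cosine_transform \<Phi> \<eta> s"
      proof (cases "0 < s")
        case True
        then show ?thesis unfolding n_def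
          by (subst integral_affine_euclidean[of _ s 0]) (auto simp: mult.assoc)
      qed (simp add: w0)
    qed
    finally show ?thesis using pos[of \<eta>] by (simp add: n_def)
  qed
  obtain \<Gamma> :: "'v measure" where \<Gamma>: "prob_space \<Gamma>" "sets \<Gamma> = sets borel"
    "\<And>z. (\<integral>\<eta>. cos (z \<bullet> \<eta>) \<partial>\<Gamma>) = exp (- (norm z)\<^sup>2 / 2)"
    using gaussian_vector by blast
  interpret \<Gamma>: prob_space \<Gamma> by fact
  note [measurable_cong] = \<Gamma>(2)
  define W where "W x = (\<integral>y. G y * gauss ((y - x) /\<^sub>R e) \<partial>lborel)" for x
  have gauss_le: "gauss z \<le> 1" for z :: 'v by (simp add: gauss_def)
  \<comment> \<open>The Gaussian weight is replaced by its own representation as an average of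
    cosines; after the interchange only \<open>g\<close> remains inside.\<close>
  have W_eq: "W x = (\<integral>\<eta>. g (\<eta> /\<^sub>R e) * cos (x \<bullet> (\<eta> /\<^sub>R e)) \<partial>\<Gamma>)" for x
  proof -
    have "W x = (\<integral>y. \<integral>\<eta>. G y * cos ((y - x) \<bullet> (\<eta> /\<^sub>R e)) \<partial>\<Gamma> \<partial>lborel)"
      unfolding W_def gauss_def \<Gamma>(3)[symmetric] by simp
    also have "\<dots> = (\<integral>\<eta>. \<integral>y. G y * cos ((y - x) \<bullet> (\<eta> /\<^sub>R e)) \<partial>lborel \<partial>\<Gamma>)"
    proof (rule Fubini_swap(1)[OF sigma_finite_lborel \<Gamma>.sigma_finite_measure_axioms])
      have "(\<integral>\<^sup>+y. \<integral>\<^sup>+\<eta>. ennreal \<bar>G y * cos ((y - x) \<bullet> (\<eta> /\<^sub>R e))\<bar> \<partial>\<Gamma> \<partial>lborel)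
        \<le> (\<integral>\<^sup>+y. \<integral>\<^sup>+\<eta>. ennreal (G y) \<partial>\<Gamma> \<partial>lborel)"
        by (intro nn_integral_mono ennreal_leI) (auto simp: abs_mult Gnn intro!: mult_left_le)
      also have "\<dots> < \<infinity>" using Gint Gnn by (simp add: \<Gamma>.emeasure_space_1 nn_integral_eq_integral)
      finally show "(\<integral>\<^sup>+y. \<integral>\<^sup>+\<eta>. ennreal \<bar>G y * cos ((y - x) \<bullet> (\<eta> /\<^sub>R e))\<bar> \<partial>\<Gamma> \<partial>lborel) < \<infinity>" .
    qed measurable
    also have "\<dots> = (\<integral>\<eta>. g (\<eta> /\<^sub>R e) * cos (x \<bullet> (\<eta> /\<^sub>R e)) \<partial>\<Gamma>)"
    proof (intro Bochner_Integration.integral_cong refl)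
      fix \<eta> :: 'v
      define \<zeta> where "\<zeta> = \<eta> /\<^sub>R e"
      have "G y * cos ((y - x) \<bullet> \<zeta>) = G y * cos (y \<bullet> \<zeta>) * cos (x \<bullet> \<zeta>) + G y * sin (y \<bullet> \<zeta>) * sin (x \<bullet> \<zeta>)" for y
        by (simp add: inner_diff_left cos_diff algebra_simps)
      then have "(\<integral>y. G y * cos ((y - x) \<bullet> \<zeta>) \<partial>lborel)
        = (\<integral>y. G y * cos (y \<bullet> \<zeta>) \<partial>lborel) * cos (x \<bullet> \<zeta>) + (\<integral>y. G y * sin (y \<bullet> \<zeta>) \<partial>lborel) * sin (x \<bullet> \<zeta>)"
        by (simp add: FG_int)
      then show "(\<integral>y. G y * cos ((y - x) \<bullet> (\<eta> /\<^sub>R e)) \<partial>lborel) = g (\<eta> /\<^sub>R e) * cos (x \<bullet> (\<eta> /\<^sub>R e))"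
        by (simp add: g_sin g_def \<zeta>_def[symmetric])
    qed
    finally show ?thesis .
  qed
  have "multiplier (\<lambda>x. \<integral>\<eta>. g (\<eta> /\<^sub>R e) * cos (x \<bullet> (\<eta> /\<^sub>R e)) \<partial>\<Gamma>)"
  proof (rule multiplier_integral[where B=I])
    show "finite_measure \<Gamma>" by (rule \<Gamma>.finite_measure_axioms)
    show "(\<lambda>(\<eta>, x). g (\<eta> /\<^sub>R e) * cos (x \<bullet> (\<eta> /\<^sub>R e))) \<in> borel_measurable (\<Gamma> \<Otimes>\<^sub>M borel)" by measurable
    show "\<bar>g (\<eta> /\<^sub>R e) * cos (x \<bullet> (\<eta> /\<^sub>R e))\<bar> \<le> I" for \<eta> x
    proof -
      have "\<bar>g (\<eta> /\<^sub>R e) * cos (x \<bullet> (\<eta> /\<^sub>R e))\<bar> \<le> \<bar>g (\<eta> /\<^sub>R e)\<bar> * 1"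
        unfolding abs_mult by (rule mult_left_mono) simp_all
      then show ?thesis using g_bd[of "\<eta> /\<^sub>R e"] by simp
    qed
    show "multiplier (\<lambda>x. g (\<eta> /\<^sub>R e) * cos (x \<bullet> (\<eta> /\<^sub>R e)))" for \<eta>
      by (intro multiplier_mult multiplier_const multiplier_cos g_pos)
  qed
  then have "multiplier W" unfolding W_eq[abs_def] .
  moreover have Wnn: "0 \<le> W x" for x unfolding W_def by (rule integral_nonneg_AE) (simp add: Gnn gauss_def)
  ultimately have "(\<integral>\<^sup>+x. ennreal (W x) \<partial>Q) \<le> (\<integral>\<^sup>+x. ennreal (W x) \<partial>P)"
    by (rule multiplier_nn_integral_le)
  moreover have "(\<integral>\<^sup>+y. scale_mixture w \<Phi> y * ennreal (gauss ((y - x) /\<^sub>R e)) \<partial>lborel) = ennreal (W x)" for x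
  proof -
    have "(\<integral>\<^sup>+y. scale_mixture w \<Phi> y * ennreal (gauss ((y - x) /\<^sub>R e)) \<partial>lborel)
      = (\<integral>\<^sup>+y. ennreal (G y * gauss ((y - x) /\<^sub>R e)) \<partial>lborel)"
      by (intro nn_integral_cong_AE) (use G_eq in eventually_elim, simp add: ennreal_mult' Gnn)
    also have "\<dots> = ennreal (W x)"
      unfolding W_def
      by (intro nn_integral_eq_integral FG_int) (auto simp: Gnn less_imp_le[OF gauss_pos] gauss_le)
    finally show ?thesis .
  qed
  ultimately show ?thesis by simp
qed

text \<open>The Gaussian damping \<open>exp (- d * s\<^sup>2)\<close> makes the mixture integrable; it is removed by monotone
  convergence before the smoothing is.\<close>

theorem neg_power_le_of_fourier_nonneg:
  fixes N :: "'v \<Rightarrow> real" and p r :: real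
  assumes N: "homogeneous_space N" and p: "0 < p" "p < DIM('v)" and r: "2 \<le> r"
    and pos: "\<And>d \<xi>. 0 < d \<Longrightarrow> 0 \<le> (\<integral>s. ray_weight (real DIM('v) - p - 1) d s *
      cosine_transform (\<lambda>y. exp (- (N y powr r))) \<xi> s \<partial>lborel)"
  shows "(\<integral>\<^sup>+x. neg_power p (N x) \<partial>Q) \<le> (\<integral>\<^sup>+x. neg_power p (N x) \<partial>P)"
proof -
  define n where "n = DIM('v)"
  define \<Phi> where "\<Phi> y = exp (- (N y powr r))" for y
  obtain C where C: "0 < C" and mix: "\<And>t. 0 \<le> t \<Longrightarrow> neg_power p t =
    exp_mixture C p r t"
    using neg_power_mixture[of r p] r p by auto
  note hom = homogeneous_space_scaleR[OF N] and Nnn = homogeneous_space_nonneg[OF N]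
  note [measurable] = homogeneous_space_measurable[OF N]
  have \<Phi>m[measurable]: "\<Phi> \<in> borel_measurable borel" unfolding \<Phi>_def by measurable
  have \<Phi>nn: "0 \<le> \<Phi> y" for y by (simp add: \<Phi>_def)
  have \<Phi>even: "\<Phi> (- y) = \<Phi> y" for y using hom[of "-1" y] by (simp add: \<Phi>_def)
  have \<Phi>int: "(\<integral>\<^sup>+y. ennreal (\<Phi> y) \<partial>lborel) < \<infinity>"
    unfolding \<Phi>_def by (rule nn_integral_exp_neg_homogeneous[OF N r])
  \<comment> \<open>\<open>d\<close> is the strength of the damping. At \<open>d = 0\<close> the
    mixture is exactly \<open>neg_power p (N y)\<close>, so one family covers the approximants and
    the limit.\<close>
  define w where "w d s = indicator {0<..} s * (C * s powr (- p - 1) * exp (- d * s\<^sup>2))" for d s :: real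
  have wm[measurable]: "w d \<in> borel_measurable borel" for d unfolding w_def by measurable
  have wnn: "0 \<le> w d s" for d s using C by (simp add: w_def)
  have w0: "s \<le> 0 \<Longrightarrow> w d s = 0" for d s by (simp add: w_def)
  have w_pow: "w d s * s ^ n = C * (ray_weight (real n - p - 1) d s)" for d s
  proof (cases "0 < s")
    case True
    have "s powr (- p - 1) * s ^ n = s powr (real n - p - 1)"
      using True powr_add[of s "- p - 1" "real n"] by (simp add: powr_realpow algebra_simps)
    then show ?thesis using True by (simp add: w_def mult_ac)
  qed (simp add: w_def)
  have wint: "(\<integral>\<^sup>+s. ennreal (w d s * s ^ n) \<partial>lborel) < \<infinity>" if d: "0 < d" for d
  proof -
    have "(\<integral>\<^sup>+s. ennreal (w d s * s ^ n) \<partial>lborel)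
      = (\<integral>\<^sup>+s. ennreal C * (ennreal (s powr (real n - p - 1) * exp (- d * s\<^sup>2)) * indicator {0<..} s) \<partial>lborel)"
      unfolding w_pow using C by (intro nn_integral_cong) (auto simp: indicator_def ennreal_mult'[symmetric])
    also have "\<dots> < \<infinity>"
      using nn_integral_powr_gaussian_finite[of "real n - p - 1" d] d p
      by (subst nn_integral_cmult) (auto simp: n_def ennreal_mult_less_top)
    finally show ?thesis .
  qed
  define F where "F d y = scale_mixture (w d) \<Phi> y" for d y
  have Fm[measurable]: "F d \<in> borel_measurable borel" for d unfolding F_def by measurable
  have F0: "F 0 y = neg_power p (N y)" for y
    unfolding F_def mix[OF Nnn]
    by (intro nn_integral_cong) (auto simp: w_def \<Phi>_def indicator_def hom field_simps)
  have step: "(\<integral>\<^sup>+x. \<integral>\<^sup>+y. F d y * ennreal (gauss ((y - x) /\<^sub>R e)) \<partial>lborel \<partial>Q)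
      \<le> (\<integral>\<^sup>+x. \<integral>\<^sup>+y. F d y * ennreal (gauss ((y - x) /\<^sub>R e)) \<partial>lborel \<partial>P)" if d: "0 < d" and e: "0 < e" for d e
    unfolding F_def
  proof (rule scale_mixture_smoothed_le[OF \<Phi>m \<Phi>nn \<Phi>even \<Phi>int wm wnn w0 _ _ e])
    show "(\<integral>\<^sup>+s. ennreal (w d s * s ^ DIM('v)) \<partial>lborel) < \<infinity>" using wint[OF d] by (simp add: n_def)
    show "0 \<le> (\<integral>s. w d s * s ^ DIM('v) * cosine_transform \<Phi> \<xi> s \<partial>lborel)" for \<xi>
      using pos[OF d, of \<xi>] C unfolding n_def[symmetric] w_pow \<Phi>_def by (simp add: mult.assoc)
  qed
  define d where "d m = 1 / real (Suc m)" for m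
  have d: "0 < d m" "d (Suc m) \<le> d m" for m by (auto simp: d_def frac_le)
  have d0: "d \<longlonglongrightarrow> 0" unfolding d_def using LIMSEQ_inverse_real_of_nat by (simp add: inverse_eq_divide)
  have w_mono: "w (d m) s \<le> w (d (Suc m)) s" for m s
    unfolding w_def using C d(2)[of m] by (intro mult_left_mono) (auto simp: mult_right_mono)
  have w_lim: "(\<lambda>m. w (d m) s) \<longlonglongrightarrow> w 0 s" for s
    unfolding w_def by (intro tendsto_intros d0)
  have F_mono: "F (d m) y \<le> F (d (Suc m)) y" for m y
    unfolding F_def by (intro nn_integral_mono ennreal_leI mult_right_mono w_mono \<Phi>nn)
  have F_lim: "(\<lambda>m. F (d m) y) \<longlonglongrightarrow> F 0 y" for y
    unfolding F_def
    by (rule nn_integral_LIMSEQ)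
       (auto intro!: incseq_SucI le_funI ennreal_leI mult_right_mono w_mono \<Phi>nn tendsto_ennrealI tendsto_mult w_lim)
  define S where "S d e x = (\<integral>\<^sup>+y. F d y * ennreal (gauss ((y - x) /\<^sub>R e)) \<partial>lborel)" for d e x
  have Sm[measurable]: "S d e \<in> borel_measurable borel" for d e unfolding S_def by measurable
  have S_mono: "S (d m) e x \<le> S (d (Suc m)) e x" for m e x
    unfolding S_def by (intro nn_integral_mono mult_right_mono F_mono) auto
  have S_lim: "(\<lambda>m. S (d m) e x) \<longlonglongrightarrow> S 0 e x" for e x
    unfolding S_def
    by (rule nn_integral_LIMSEQ)
       (auto intro!: incseq_SucI le_funI mult_right_mono F_mono ennreal_tendsto_multc F_lim)
  have lim: "(\<lambda>m. \<integral>\<^sup>+x. S (d m) e x \<partial>M) \<longlonglongrightarrow> (\<integral>\<^sup>+x. S 0 e x \<partial>M)" if [measurable_cong]: "sets M = sets borel" for M e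
    by (rule nn_integral_LIMSEQ) (auto intro!: incseq_SucI le_funI S_mono S_lim)
  have S_le: "(\<integral>\<^sup>+x. S 0 e x \<partial>Q) \<le> (\<integral>\<^sup>+x. S 0 e x \<partial>P)" if e: "0 < e" for e
    using step[OF d(1) e] by (intro LIMSEQ_le[OF lim[OF sets_Q] lim[OF sets_P]]) (auto simp: S_def)
  have S_eq: "S 0 e x = ennreal (e ^ n) * (smoothed p N e x)" if e: "0 < e" for e x
    using e unfolding S_def n_def by (subst nn_integral_affine_euclidean[of _ e x]) (auto simp: F0)
  show ?thesis
  proof (rule nn_integral_neg_power_mono_of_smoothed[OF N p(1) _ fin_P sets_P fin_Q sets_Q])
    fix e :: real assume e: "0 < e"
    have "(\<integral>\<^sup>+x. S 0 e x \<partial>M) = ennreal (e ^ n) * (\<integral>\<^sup>+x. smoothed p N e x \<partial>M)"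
      if [measurable_cong]: "sets M = sets borel" for M
      unfolding S_eq[OF e] by (rule nn_integral_cmult) measurable
    then show "(\<integral>\<^sup>+x. smoothed p N e x \<partial>Q)
      \<le> (\<integral>\<^sup>+x. smoothed p N e x \<partial>P)"
      using S_le[OF e] e sets_P sets_Q by (auto simp: ennreal_mult_le_mult_iff)
  next
    \<comment> \<open>Local integrability of the negative power is read off from the damped mixture:
      for s < 1 the damping costs at most the factor \<open>exp 1\<close>, and the scales s \<ge> 1
      contribute at most the constant \<open>C / p\<close>. The condition p < n enters through the
      finite total mass of the damped mixture.\<close>
    have F_le: "F 0 y \<le> ennreal (exp 1) * F 1 y + ennreal (C / p)" for y
    proof -
      have "F 0 y \<le> (\<integral>\<^sup>+s. ennreal (exp 1) * ennreal (w 1 s * \<Phi> (y /\<^sub>R s)) + ennreal C * (ennreal (s powr (- (p + 1))) * indicator {1..} s) \<partial>lborel)"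
        unfolding F_def
      proof (intro nn_integral_mono)
        fix s :: real
        show "ennreal (w 0 s * \<Phi> (y /\<^sub>R s)) \<le> ennreal (exp 1) * ennreal (w 1 s * \<Phi> (y /\<^sub>R s)) + ennreal C * (ennreal (s powr (- (p + 1))) * indicator {1..} s)"
        proof (cases "s < 1")
          case True
          have "w 0 s \<le> exp 1 * w 1 s"
          proof (cases "0 < s")
            case True
            then have "s\<^sup>2 \<le> 1" using \<open>s < 1\<close> by (simp add: power_le_one)
            then have "1 \<le> exp 1 * exp (- s\<^sup>2)" by (simp add: exp_add[symmetric])
            then have "C * s powr (- p - 1) * 1 \<le> C * s powr (- p - 1) * (exp 1 * exp (- s\<^sup>2))"
              using C by (intro mult_left_mono) auto
            then show ?thesis using True by (simp add: w_def mult_ac)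
          qed (simp add: w_def)
          then have "w 0 s * \<Phi> (y /\<^sub>R s) \<le> exp 1 * w 1 s * \<Phi> (y /\<^sub>R s)" by (intro mult_right_mono \<Phi>nn)
          then show ?thesis using True by (simp add: ennreal_mult'[symmetric] ennreal_leI mult.assoc)
        next
          case False
          have "w 0 s * \<Phi> (y /\<^sub>R s) \<le> w 0 s * 1" using wnn by (intro mult_left_mono) (auto simp: \<Phi>_def)
          then have "ennreal (w 0 s * \<Phi> (y /\<^sub>R s)) \<le> ennreal C * (ennreal (s powr (- (p + 1))) * indicator {1..} s)"
            using False C by (auto simp: w_def ennreal_mult'[symmetric] intro!: ennreal_leI)
          then show ?thesis by (rule add_increasing[rotated]) simp
        qed
      qed
      also have "\<dots> = ennreal (exp 1) * F 1 y + ennreal C * ennreal (1 / p)"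
        using nn_integral_powr_inf[of "p + 1" 1] p unfolding F_def
        by (subst nn_integral_add) (auto simp: nn_integral_cmult)
      also have "ennreal C * ennreal (1 / p) = ennreal (C / p)" using C by (simp add: ennreal_mult'[symmetric])
      finally show ?thesis .
    qed
    have F1: "(\<integral>\<^sup>+y. F 1 y \<partial>lborel) < \<infinity>"
      using wint[of 1] \<Phi>int unfolding F_def n_def
      by (subst nn_integral_scale_mixture) (simp_all add: wnn w0 ennreal_mult_less_top)
    have [measurable]: "ball (0::'v) 1 \<in> sets borel" by (intro borel_open open_ball)
    have "(\<integral>\<^sup>+y\<in>ball 0 1. neg_power p (N y) \<partial>lborel)
      \<le> (\<integral>\<^sup>+y. ennreal (exp 1) * F 1 y + ennreal (C / p) * indicator (ball 0 1) (y::'v) \<partial>lborel)"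
      using F_le unfolding F0[symmetric] by (intro nn_integral_mono) (auto simp: indicator_def)
    also have "\<dots> = ennreal (exp 1) * (\<integral>\<^sup>+y. F 1 y \<partial>lborel) + ennreal (C / p) * emeasure lborel (ball (0::'v) 1)"
      by (subst nn_integral_add) (auto simp: nn_integral_cmult)
    also have "\<dots> < \<infinity>" using F1 emeasure_lborel_ball_finite[of "0::'v" 1] by (simp add: ennreal_mult_less_top)
    finally show "(\<integral>\<^sup>+y\<in>ball 0 1. neg_power p (N y) \<partial>lborel) < \<infinity>" .
  qed
qed

end

section \<open>Positivity along rays\<close>

text \<open>\<open>neg_power_mixture\<close> with exponent 2 writes \<open>s powr q\<close> for q <
  0 as an average of Gaussians of width v. The damping merely adds \<open>d\<close> to the
  coefficient 1 / v^2, and each resulting cosine transform is an explicit positive Gaussian.\<close>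

lemma cosine_transform_powr_gaussian_nonneg:
  fixes q d z :: real
  assumes q: "- 1 < q" "q \<le> 0" and d: "0 < d"
  shows "0 \<le> (\<integral>s. ray_weight q d s * cos (s * z) \<partial>lborel)"
proof (cases "q = 0")
  case True
  have eq: "(\<integral>s. ray_weight q d s * cos (s * z) \<partial>lborel)
     = (\<integral>s. indicator {0<..} s * (exp (- d * s\<^sup>2) * cos (s * z)) \<partial>lborel)"
    using True by (intro Bochner_Integration.integral_cong) (auto simp: indicator_def)
  show ?thesis unfolding eq integral_half_gaussian_cos[OF d] using d by simp
next
  case False
  then have q0: "0 < - q" using q by simp
  obtain C where C: "0 < C" and mix: "\<And>t. 0 \<le> t \<Longrightarrow> neg_power (- q) t =
    (\<integral>\<^sup>+v\<in>{0<..}. ennreal (C * v powr (q - 1) * exp (- ((t / v) powr 2))) \<partial>lborel)"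
    using neg_power_mixture[OF _ q0, of 2] by auto
  define f where "f s v = indicator {0<..} s * indicator {0<..} v * (C * v powr (q - 1) * exp (- (s / v)\<^sup>2)) * exp (- d * s\<^sup>2)" for s v :: real
  have fnn: "0 \<le> f s v" for s v using C by (simp add: f_def)
  have fv: "(\<integral>\<^sup>+v. ennreal (f s v) \<partial>lborel) = ennreal (s powr q * exp (- d * s\<^sup>2)) * indicator {0<..} s" for s
  proof (cases "0 < s")
    case True
    have "(\<integral>\<^sup>+v. ennreal (f s v) \<partial>lborel)
       = (\<integral>\<^sup>+v. ennreal (exp (- d * s\<^sup>2)) * (ennreal (C * v powr (q - 1) * exp (- ((s / v) powr 2))) * indicator {0<..} v) \<partial>lborel)"
      using True C by (intro nn_integral_cong) (auto simp: f_def indicator_def ennreal_mult'[symmetric] powr_numeral mult_ac)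
    also have "\<dots> = ennreal (exp (- d * s\<^sup>2)) * neg_power (- q) s"
      using True by (subst nn_integral_cmult) (auto simp: mix)
    also have "\<dots> = ennreal (s powr q * exp (- d * s\<^sup>2)) * indicator {0<..} s"
      using True by (simp add: neg_power_def ennreal_mult'[symmetric] mult.commute)
    finally show ?thesis .
  qed (simp add: f_def)
  have f_int: "(\<integral>v. f s v \<partial>lborel) = ray_weight q d s" for s
  proof -
    have "f s \<in> borel_measurable lborel" unfolding f_def by measurable
    then show ?thesis using integral_eq_nn_integral[of "f s" lborel] by (auto simp: fnn fv indicator_def)
  qed
  have fm[measurable]: "case_prod f \<in> borel_measurable (lborel \<Otimes>\<^sub>M lborel)" unfolding f_def by measurable
  have swap: "(\<integral>s. \<integral>v. f s v * cos (s * z) \<partial>lborel \<partial>lborel) = (\<integral>v. \<integral>s. f s v * cos (s * z) \<partial>lborel \<partial>lborel)"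
  proof (rule Fubini_swap(1)[OF sigma_finite_lborel sigma_finite_lborel])
    show "(\<lambda>(s, v). f s v * cos (s * z)) \<in> borel_measurable (lborel \<Otimes>\<^sub>M lborel)"
      unfolding f_def by measurable
    have "(\<integral>\<^sup>+s. \<integral>\<^sup>+v. ennreal \<bar>f s v * cos (s * z)\<bar> \<partial>lborel \<partial>lborel) \<le> (\<integral>\<^sup>+s. \<integral>\<^sup>+v. ennreal (f s v) \<partial>lborel \<partial>lborel)"
      by (intro nn_integral_mono ennreal_leI) (auto simp: abs_mult fnn intro!: mult_left_le)
    also have "\<dots> < \<infinity>" unfolding fv by (rule nn_integral_powr_gaussian_finite[OF q(1) d])
    finally show "(\<integral>\<^sup>+s. \<integral>\<^sup>+v. ennreal \<bar>f s v * cos (s * z)\<bar> \<partial>lborel \<partial>lborel) < \<infinity>" .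
  qed
  have "(\<integral>s. ray_weight q d s * cos (s * z) \<partial>lborel)
    = (\<integral>v. \<integral>s. f s v * cos (s * z) \<partial>lborel \<partial>lborel)"
    unfolding f_int[symmetric] swap[symmetric] by simp
  also have "\<dots> \<ge> 0"
  proof (rule integral_nonneg_AE, rule AE_I2)
    fix v :: real
    \<comment> \<open>At \<open>v = 0\<close> the quotient is 0 by convention and the sum is still
      positive.\<close>
    have d': "0 < 1 / v\<^sup>2 + d" using d by (simp add: add_nonneg_pos)
    have "(\<integral>s. f s v * cos (s * z) \<partial>lborel)
      = (\<integral>s. (indicator {0<..} v * (C * v powr (q - 1))) * (indicator {0<..} s * (exp (- (1 / v\<^sup>2 + d) * s\<^sup>2) * cos (s * z))) \<partial>lborel)"
      by (intro Bochner_Integration.integral_cong refl)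
         (simp add: f_def power_divide distrib_right exp_add[symmetric] algebra_simps)
    also have "\<dots> \<ge> 0" using C unfolding integral_mult_right_zero integral_half_gaussian_cos[OF d']
      by (intro mult_nonneg_nonneg divide_nonneg_nonneg real_sqrt_ge_zero less_imp_le[OF d']) simp_all
    finally show "0 \<le> (\<integral>s. f s v * cos (s * z) \<partial>lborel)" .
  qed
  finally show ?thesis .
qed

text \<open>A Parseval identity along one ray: the transform moves from \<Phi>, about which little
  is known, to the explicit weight \<open>w\<close>.\<close>

lemma radial_fourier_swap:
  fixes \<Phi> :: "'v::euclidean_space \<Rightarrow> real"
  assumes \<Phi>[measurable]: "\<Phi> \<in> borel_measurable borel" "\<And>y. 0 \<le> \<Phi> y" "(\<integral>\<^sup>+y. ennreal (\<Phi> y) \<partial>lborel) < \<infinity>"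
    and w[measurable]: "w \<in> borel_measurable borel" and wint: "(\<integral>\<^sup>+s. ennreal \<bar>w s\<bar> \<partial>lborel) < \<infinity>"
  shows "(\<integral>s. w s * cosine_transform \<Phi> \<xi> s \<partial>lborel)
    = (\<integral>y. \<Phi> y * (\<integral>s. w s * cos (s * (y \<bullet> \<xi>)) \<partial>lborel) \<partial>lborel)"
    "integrable lborel (\<lambda>s. w s * cosine_transform \<Phi> \<xi> s)"
proof -
  have "(\<integral>\<^sup>+s. \<integral>\<^sup>+y. ennreal \<bar>w s * (\<Phi> y * cos (s * (y \<bullet> \<xi>)))\<bar> \<partial>lborel \<partial>lborel)
    \<le> (\<integral>\<^sup>+s. \<integral>\<^sup>+y. ennreal \<bar>w s\<bar> * ennreal (\<Phi> y) \<partial>lborel \<partial>lborel)"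
    unfolding ennreal_mult'[symmetric, OF abs_ge_zero]
    by (intro nn_integral_mono ennreal_leI) (auto simp: abs_mult \<Phi>(2) intro!: mult_left_mono mult_left_le)
  also have "\<dots> = (\<integral>\<^sup>+s. ennreal \<bar>w s\<bar> * (\<integral>\<^sup>+y. ennreal (\<Phi> y) \<partial>lborel) \<partial>lborel)"
    by (intro nn_integral_cong nn_integral_cmult) measurable
  also have "\<dots> = (\<integral>\<^sup>+s. ennreal \<bar>w s\<bar> \<partial>lborel) * (\<integral>\<^sup>+y. ennreal (\<Phi> y) \<partial>lborel)"
    by (rule nn_integral_multc) measurable
  also have "\<dots> < \<infinity>" using \<Phi>(3) wint by (simp add: ennreal_mult_less_top)
  finally have fin: "(\<integral>\<^sup>+s. \<integral>\<^sup>+y. ennreal \<bar>w s * (\<Phi> y * cos (s * (y \<bullet> \<xi>)))\<bar> \<partial>lborel \<partial>lborel) < \<infinity>" .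
  have m: "(\<lambda>(s, y). w s * (\<Phi> y * cos (s * (y \<bullet> \<xi>)))) \<in> borel_measurable (lborel \<Otimes>\<^sub>M lborel)" by measurable
  note F = Fubini_swap[OF sigma_finite_lborel sigma_finite_lborel m fin]
  have "(\<integral>y. \<integral>s. w s * (\<Phi> y * cos (s * (y \<bullet> \<xi>))) \<partial>lborel \<partial>lborel) = (\<integral>y. \<Phi> y * (\<integral>s. w s * cos (s * (y \<bullet> \<xi>)) \<partial>lborel) \<partial>lborel)"
    by (simp add: mult.left_commute[of _ "\<Phi> _"])
  then show "(\<integral>s. w s * cosine_transform \<Phi> \<xi> s \<partial>lborel)
    = (\<integral>y. \<Phi> y * (\<integral>s. w s * cos (s * (y \<bullet> \<xi>)) \<partial>lborel) \<partial>lborel)" using F(1) by simp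
  show "integrable lborel (\<lambda>s. w s * cosine_transform \<Phi> \<xi> s)" using F(2) by simp
qed

lemma radial_fourier_nonneg:
  fixes \<Phi> :: "'v::euclidean_space \<Rightarrow> real"
  assumes \<Phi>: "\<Phi> \<in> borel_measurable borel" "\<And>y. 0 \<le> \<Phi> y" "(\<integral>\<^sup>+y. ennreal (\<Phi> y) \<partial>lborel) < \<infinity>"
    and q: "- 1 < q" "q \<le> 0" and d: "0 < d"
  shows "0 \<le> (\<integral>s. ray_weight q d s * cosine_transform \<Phi> \<xi> s \<partial>lborel)"
proof -
  have "(\<integral>\<^sup>+s. ennreal \<bar>ray_weight q d s\<bar> \<partial>lborel) < \<infinity>"
    using nn_integral_powr_gaussian_finite[OF q(1) d]
    by (rule le_less_trans[rotated]) (intro nn_integral_mono, simp add: indicator_def)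
  then have eq: "(\<integral>s. ray_weight q d s * cosine_transform \<Phi> \<xi> s \<partial>lborel)
    = (\<integral>y. \<Phi> y * (\<integral>s. ray_weight q d s * cos (s * (y \<bullet> \<xi>)) \<partial>lborel) \<partial>lborel)"
    by (intro radial_fourier_swap(1)[OF \<Phi>]) measurable
  show ?thesis unfolding eq
    by (rule integral_nonneg_AE) (intro AE_I2 mult_nonneg_nonneg[OF \<Phi>(2)] cosine_transform_powr_gaussian_nonneg[OF q d])
qed

text \<open>With the weight exp(-d s^2) (1 - cos(us)) the integral equals, up to a positive
  constant, \<open>B 0 - (B u + B (- u)) / 2\<close>, where \<open>B\<close> is the smoothed
  marginal; \<open>peak\<close> makes this nonnegative. Integrating over u against the measures of
  \<open>abs_powr_levy\<close> and passing to the limit produces the weight \<open>s powr q\<close>.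
  The 4 d is the variance parameter in the transform of exp(-d s^2).\<close>

lemma radial_fourier_nonneg_of_peak:
  fixes \<Phi> :: "'v::euclidean_space \<Rightarrow> real"
  assumes \<Phi>: "\<Phi> \<in> borel_measurable borel" "\<And>y. 0 \<le> \<Phi> y" "(\<integral>\<^sup>+y. ennreal (\<Phi> y) \<partial>lborel) < \<infinity>"
    and q: "0 < q" "q \<le> 2" and d: "0 < d"
    and peak: "\<And>u. (\<integral>y. \<Phi> y * exp (- (y \<bullet> \<xi> + u)\<^sup>2 / (4 * d)) \<partial>lborel) \<le> (\<integral>y. \<Phi> y * exp (- (y \<bullet> \<xi>)\<^sup>2 / (4 * d)) \<partial>lborel)"
  shows "0 \<le> (\<integral>s. ray_weight q d s * cosine_transform \<Phi> \<xi> s \<partial>lborel)"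
proof -
  note [measurable] = \<Phi>(1)
  define Ph where "Ph s = cosine_transform \<Phi> \<xi> s" for s
  have Phm[measurable]: "Ph \<in> borel_measurable borel" unfolding Ph_def by measurable
  define e where "e s = indicator {0<..} s * exp (- d * s\<^sup>2)" for s :: real
  have em[measurable]: "e \<in> borel_measurable borel" unfolding e_def by measurable
  have enn: "0 \<le> e s" for s by (simp add: e_def)
  have eint: "(\<integral>\<^sup>+s. ennreal \<bar>e s\<bar> \<partial>lborel) < \<infinity>"
    using nn_integral_powr_gaussian_finite[of 0 d] d
    by (rule_tac le_less_trans[rotated]) (auto intro!: nn_integral_mono simp: e_def indicator_def)
  obtain \<nu> :: "nat \<Rightarrow> real measure"
    where \<nu>: "\<And>m. finite_measure (\<nu> m)" "\<And>m. sets (\<nu> m) = sets borel"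
    "\<And>z. (\<lambda>m. \<integral>u. 1 - cos (u * z) \<partial>\<nu> m) \<longlonglongrightarrow> \<bar>z\<bar> powr q"
    "\<And>m z. (\<integral>u. 1 - cos (u * z) \<partial>\<nu> m) \<le> \<bar>z\<bar> powr q"
    using abs_powr_levy[OF q] by metis
  define a where "a m s = (\<integral>u. 1 - cos (u * s) \<partial>\<nu> m)" for m s
  have am[measurable]: "a m \<in> borel_measurable borel" for m
  proof -
    interpret finite_measure "\<nu> m" by (rule \<nu>)
    note [measurable_cong] = \<nu>(2)[of m]
    show ?thesis unfolding a_def by measurable
  qed
  have ann: "0 \<le> a m s" for m s unfolding a_def by (rule integral_nonneg_AE) simp
  define K where "K = sqrt (pi / d) / 2"
  have K: "0 < K" using d by (simp add: K_def)
  have \<Phi>i: "integrable lborel (\<lambda>y. \<Phi> y * f y)" if [measurable]: "f \<in> borel_measurable borel" and "\<And>y. \<bar>f y\<bar> \<le> 1" for f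
  proof -
    have "integrable lborel \<Phi>" using \<Phi> by (intro integrableI_bounded) auto
    then show ?thesis
      by (rule Bochner_Integration.integrable_bound) (use that(2) in \<open>auto simp: abs_mult \<Phi>(2) intro!: mult_left_le\<close>)
  qed
  \<comment> \<open>Up to normalization, the marginal of \<Phi> in direction \<xi> convolved with a
    Gaussian, evaluated at -u.\<close>
  define B where "B u = (\<integral>y. \<Phi> y * exp (- (y \<bullet> \<xi> + u)\<^sup>2 / (4 * d)) \<partial>lborel)" for u
  have ecos: "(\<integral>s. (e s * cos (u * s)) * Ph s \<partial>lborel) = K * (B u + B (- u)) / 2"
    and ecos_int: "integrable lborel (\<lambda>s. (e s * cos (u * s)) * Ph s)" for u
  proof -
    have fin: "(\<integral>\<^sup>+s. ennreal \<bar>e s * cos (u * s)\<bar> \<partial>lborel) < \<infinity>"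
      using eint by (rule le_less_trans[rotated])
        (intro nn_integral_mono ennreal_leI, auto simp: abs_mult intro!: mult_left_le)
    have m: "(\<lambda>s. e s * cos (u * s)) \<in> borel_measurable borel" by measurable
    note R = radial_fourier_swap[OF \<Phi> m fin, of \<xi>]
    show "integrable lborel (\<lambda>s. (e s * cos (u * s)) * Ph s)" using R(2) by (simp add: Ph_def)
    have inner: "(\<integral>s. e s * cos (u * s) * cos (s * z) \<partial>lborel) = K * (exp (- (z + u)\<^sup>2 / (4 * d)) + exp (- (z - u)\<^sup>2 / (4 * d))) / 2" for z
    proof -
      have i: "integrable lborel (\<lambda>s. e s * cos (s * x))" for x
      proof (rule integrableI_bounded)
        show "(\<integral>\<^sup>+s. ennreal (norm (e s * cos (s * x))) \<partial>lborel) < \<infinity>"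
          using eint by (rule le_less_trans[rotated])
            (intro nn_integral_mono ennreal_leI, auto simp: abs_mult intro!: mult_left_le)
      qed measurable
      have "(\<integral>s. e s * cos (u * s) * cos (s * z) \<partial>lborel) = (\<integral>s. (e s * cos (s * (z + u)) + e s * cos (s * (z - u))) / 2 \<partial>lborel)"
        by (intro Bochner_Integration.integral_cong refl)
          (simp add: distrib_left right_diff_distrib cos_add cos_diff mult.commute[of u] field_simps)
      also have "\<dots> = ((\<integral>s. e s * cos (s * (z + u)) \<partial>lborel) + (\<integral>s. e s * cos (s * (z - u)) \<partial>lborel)) / 2"
        using i by simp
      finally have "(\<integral>s. e s * cos (u * s) * cos (s * z) \<partial>lborel)
         = ((\<integral>s. e s * cos (s * (z + u)) \<partial>lborel) + (\<integral>s. e s * cos (s * (z - u)) \<partial>lborel)) / 2" .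
      then show ?thesis
        unfolding e_def mult.assoc integral_half_gaussian_cos[OF d] K_def by (simp add: algebra_simps)
    qed
    have bd: "\<bar>exp (- t\<^sup>2 / (4 * d))\<bar> \<le> 1" for t using d by simp
    have "(\<integral>s. (e s * cos (u * s)) * Ph s \<partial>lborel)
      = (\<integral>y. \<Phi> y * (K * (exp (- (y \<bullet> \<xi> + u)\<^sup>2 / (4 * d)) + exp (- (y \<bullet> \<xi> - u)\<^sup>2 / (4 * d))) / 2) \<partial>lborel)"
      unfolding Ph_def R(1) inner ..
    also have "\<dots> = (\<integral>y. (K / 2) * (\<Phi> y * exp (- (y \<bullet> \<xi> + u)\<^sup>2 / (4 * d)) + \<Phi> y * exp (- (y \<bullet> \<xi> + - u)\<^sup>2 / (4 * d))) \<partial>lborel)"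
      by (intro Bochner_Integration.integral_cong refl) (simp add: field_simps)
    also have "\<dots> = (K / 2) * (B u + B (- u))"
      unfolding B_def
      by (subst integral_mult_right_zero, subst Bochner_Integration.integral_add) (intro \<Phi>i bd, measurable)+
    finally show "(\<integral>s. (e s * cos (u * s)) * Ph s \<partial>lborel) = K * (B u + B (- u)) / 2" by simp
  qed
  have a_pos: "0 \<le> (\<integral>s. (a m s * e s) * Ph s \<partial>lborel)" for m
  proof -
    note [measurable_cong] = \<nu>(2)[of m]
    interpret \<nu>: finite_measure "\<nu> m" by (rule \<nu>)
    define I where "I = enn2real (\<integral>\<^sup>+y. ennreal (\<Phi> y) \<partial>lborel)"
    have "(\<integral>s. (a m s * e s) * Ph s \<partial>lborel) = (\<integral>s. \<integral>u. (1 - cos (u * s)) * (e s * Ph s) \<partial>\<nu> m \<partial>lborel)"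
      unfolding a_def by (simp add: mult.assoc)
    also have "\<dots> = (\<integral>u. \<integral>s. (1 - cos (u * s)) * (e s * Ph s) \<partial>lborel \<partial>\<nu> m)"
    proof (rule Fubini_swap(1)[OF sigma_finite_lborel \<nu>.sigma_finite_measure_axioms])
      have "integrable lborel (\<lambda>s. e s * Ph s)" using ecos_int[of 0] by simp
      then have f: "(\<integral>\<^sup>+s. ennreal \<bar>e s * Ph s\<bar> \<partial>lborel) < \<infinity>" by (simp add: integrable_iff_bounded)
      have "(\<integral>\<^sup>+s. \<integral>\<^sup>+u. ennreal \<bar>(1 - cos (u * s)) * (e s * Ph s)\<bar> \<partial>\<nu> m \<partial>lborel)
        \<le> (\<integral>\<^sup>+s. \<integral>\<^sup>+u. 2 * ennreal \<bar>e s * Ph s\<bar> \<partial>\<nu> m \<partial>lborel)"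
      proof (intro nn_integral_mono)
        fix s u :: real
        have "\<bar>1 - cos (u * s)\<bar> \<le> 2" using cos_ge_minus_one[of "u * s"] by (simp del: cos_ge_minus_one)
        then have "\<bar>(1 - cos (u * s)) * (e s * Ph s)\<bar> \<le> 2 * \<bar>e s * Ph s\<bar>"
          unfolding abs_mult[of "1 - cos (u * s)"] by (intro mult_right_mono) auto
        then show "ennreal \<bar>(1 - cos (u * s)) * (e s * Ph s)\<bar> \<le> 2 * ennreal \<bar>e s * Ph s\<bar>"
          using ennreal_leI by (fastforce simp: ennreal_mult')
      qed
      also have "\<dots> < \<infinity>"
        using f by (simp add: nn_integral_cmult nn_integral_multc ennreal_mult_less_top \<nu>.emeasure_finite less_top[symmetric] ennreal_mult_eq_top_iff)
      finally show "(\<integral>\<^sup>+s. \<integral>\<^sup>+u. ennreal \<bar>(1 - cos (u * s)) * (e s * Ph s)\<bar> \<partial>\<nu> m \<partial>lborel) < \<infinity>" .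
    qed measurable
    also have "\<dots> \<ge> 0"
    proof (rule integral_nonneg_AE, rule AE_I2)
      fix u
      have "(\<integral>s. (1 - cos (u * s)) * (e s * Ph s) \<partial>lborel) = (\<integral>s. (e s * cos (0 * s)) * Ph s \<partial>lborel) - (\<integral>s. (e s * cos (u * s)) * Ph s \<partial>lborel)"
        by (subst Bochner_Integration.integral_diff[symmetric, OF ecos_int ecos_int]) (simp add: algebra_simps)
      also have "\<dots> = K * (B 0 - (B u + B (- u)) / 2)" unfolding ecos by (simp add: algebra_simps)
      also have "\<dots> \<ge> 0" using K peak[of u] peak[of "- u"] by (simp add: B_def)
      finally show "0 \<le> (\<integral>s. (1 - cos (u * s)) * (e s * Ph s) \<partial>lborel)" .
    qed
    finally show ?thesis .
  qed
  have fin: "(\<integral>\<^sup>+s. ennreal \<bar>ray_weight q d s\<bar> \<partial>lborel) < \<infinity>"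
    using nn_integral_powr_gaussian_finite[of q d] q d
    by (rule_tac le_less_trans[rotated]) (auto intro!: nn_integral_mono simp: indicator_def)
  \<comment> \<open>Here the bound in \<open>\<nu>(4)\<close> is decisive: the approximations of the
    power never exceed it, so the limit integrand itself is a majorant.\<close>
  have "(\<lambda>m. \<integral>s. (a m s * e s) * Ph s \<partial>lborel) \<longlonglongrightarrow> (\<integral>s. ray_weight q d s * Ph s \<partial>lborel)"
  proof (rule integral_dominated_convergence[where w="\<lambda>s. \<bar>ray_weight q d s * Ph s\<bar>"])
    show "integrable lborel (\<lambda>s. \<bar>ray_weight q d s * Ph s\<bar>)"
      unfolding Ph_def by (intro integrable_abs radial_fourier_swap(2)[OF \<Phi> _ fin]) measurable
    show "AE s in lborel. (\<lambda>m. (a m s * e s) * Ph s) \<longlonglongrightarrow> ray_weight q d s * Ph s"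
    proof (rule AE_I2)
      fix s :: real
      have "(\<lambda>m. (a m s * e s) * Ph s) \<longlonglongrightarrow> (\<bar>s\<bar> powr q * e s) * Ph s"
        unfolding a_def by (intro tendsto_intros \<nu>(3))
      also have "(\<bar>s\<bar> powr q * e s) * Ph s = ray_weight q d s * Ph s"
        by (simp add: e_def indicator_def)
      finally show "(\<lambda>m. (a m s * e s) * Ph s) \<longlonglongrightarrow> ray_weight q d s * Ph s" .
    qed
    show "AE s in lborel. norm ((a m s * e s) * Ph s) \<le> \<bar>ray_weight q d s * Ph s\<bar>" for m
    proof (rule AE_I2)
      fix s :: real
      have "\<bar>a m s * e s\<bar> \<le> \<bar>s\<bar> powr q * e s"
        using ann[of m s] enn[of s] \<nu>(4)[of m s] by (simp add: abs_mult a_def mult_right_mono)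
      also have "\<dots> = \<bar>ray_weight q d s\<bar>" by (simp add: e_def indicator_def)
      finally show "norm ((a m s * e s) * Ph s) \<le> \<bar>ray_weight q d s * Ph s\<bar>"
        unfolding real_norm_def abs_mult[of _ "Ph s"] by (rule mult_right_mono) simp
    qed
  qed measurable
  then show ?thesis unfolding Ph_def[symmetric] by (rule LIMSEQ_le_const) (use a_pos in auto)
qed

section \<open>Products of symmetric unimodal functions\<close>

text \<open>Symmetry is contained in the last clause, applied twice to arguments of equal absolute
  value.\<close>

definition sym_unimodal :: "(real \<Rightarrow> real) \<Rightarrow> bool" where
  "sym_unimodal g \<longleftrightarrow> g \<in> borel_measurable borel \<and> (\<forall>x. 0 \<le> g x) \<and> (\<forall>x y. \<bar>x\<bar> \<le> \<bar>y\<bar> \<longrightarrow> g y \<le> g x)"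

text \<open>A reflection argument. For 0 \<le> u \<le> v, the difference \<open>D\<close> of the
  values at u and v equals -\<open>E\<close>, the same integral with \<open>h\<close> shifted by
  \<open>c\<close> and the sign reversed. Hence 2 D = D - E is the integral of a product of two
  differences, and these always have the same sign.\<close>

lemma sym_unimodal_convolution:
  assumes g: "sym_unimodal g" and h: "sym_unimodal h" "integrable lborel h"
  shows "sym_unimodal (\<lambda>u. \<integral>y. h y * g (u + a * y) \<partial>lborel)"
proof -
  have [measurable]: "g \<in> borel_measurable borel" "h \<in> borel_measurable borel"
    using g h by (auto simp: sym_unimodal_def)
  have gnn: "0 \<le> g x" and hnn: "0 \<le> h x" for x using g h by (auto simp: sym_unimodal_def)
  have gm: "\<bar>x\<bar> \<le> \<bar>y\<bar> \<Longrightarrow> g y \<le> g x" and hm: "\<bar>x\<bar> \<le> \<bar>y\<bar> \<Longrightarrow> h y \<le> h x" for x y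
    using g h by (auto simp: sym_unimodal_def)
  have gs: "g (- x) = g x" and hs: "h (- x) = h x" for x
    using gm[of x "-x"] gm[of "-x" x] hm[of x "-x"] hm[of "-x" x] by auto
  define H where "H u = (\<integral>y. h y * g (u + a * y) \<partial>lborel)" for u
  have int: "integrable lborel (\<lambda>y. h (y + t) * g (u + a * y))" for u t
  proof (rule Bochner_Integration.integrable_bound)
    have "integrable lborel (\<lambda>y. h (t + 1 * y))" using h(2) by (rule lborel_integrable_real_affine) simp
    then show "integrable lborel (\<lambda>y. h (y + t) * g 0)" by (simp add: add.commute)
    show "AE y in lborel. norm (h (y + t) * g (u + a * y)) \<le> norm (h (y + t) * g 0)"
      using gnn hnn by (auto simp: abs_mult intro!: mult_left_mono gm)
  qed measurable
  have H_sym: "H (- u) = H u" for u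
  proof -
    have "H (- u) = (\<integral>y. h (0 + - 1 * y) * g (- u + a * (0 + - 1 * y)) \<partial>lborel)"
      unfolding H_def by (subst lborel_integral_real_affine[of "-1" _ 0]) auto
    also have "\<dots> = H u" unfolding H_def
    proof (intro Bochner_Integration.integral_cong refl)
      fix y show "h (0 + - 1 * y) * g (- u + a * (0 + - 1 * y)) = h y * g (u + a * y)"
        using gs[of "u + a * y"] hs[of y] by simp
    qed
    finally show ?thesis .
  qed
  have mono: "H v \<le> H u" if "0 \<le> u" "u \<le> v" for u v
  proof (cases "a = 0")
    case True
    then show ?thesis unfolding H_def using that h(2)
      by (simp add: gm hnn mult_left_mono integral_nonneg_AE)
  next
    case False
    \<comment> \<open>The reflection \<open>y \<mapsto> - c - y\<close> exchanges \<open>|u + a y|\<close> and \<open>|v + a y|\<close>.\<close>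
    define c where "c = (u + v) / a"
    have ac: "a * c = u + v" using False by (simp add: c_def)
    define D where "D = (\<integral>y. h y * (g (u + a * y) - g (v + a * y)) \<partial>lborel)"
    define E where "E = (\<integral>y. h (y + c) * (g (u + a * y) - g (v + a * y)) \<partial>lborel)"
    have D_eq: "D = H u - H v"
      unfolding D_def H_def using int[of 0 u] int[of 0 v] by (simp add: right_diff_distrib)
    have "D = (\<integral>y. h (- c + - 1 * y) * (g (u + a * (- c + - 1 * y)) - g (v + a * (- c + - 1 * y))) \<partial>lborel)"
      unfolding D_def by (subst lborel_integral_real_affine[of "-1" _ "- c"]) auto
    also have "\<dots> = (\<integral>y. - (h (y + c) * (g (u + a * y) - g (v + a * y))) \<partial>lborel)"
    proof (intro Bochner_Integration.integral_cong refl)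
      fix y
      have "u + a * (- c + - 1 * y) = - (v + a * y)" "v + a * (- c + - 1 * y) = - (u + a * y)" "- c + - 1 * y = - (y + c)"
        using ac by (simp_all add: algebra_simps)
      then show "h (- c + - 1 * y) * (g (u + a * (- c + - 1 * y)) - g (v + a * (- c + - 1 * y)))
        = - (h (y + c) * (g (u + a * y) - g (v + a * y)))"
        by (simp only: gs hs) (simp add: algebra_simps)
    qed
    finally have DE: "D = - E" by (simp add: E_def)
    have "0 \<le> (\<integral>y. (h y - h (y + c)) * (g (u + a * y) - g (v + a * y)) \<partial>lborel)"
    proof (rule integral_nonneg_AE, rule AE_I2)
      fix y
      have sq: "\<bar>x\<bar> \<le> \<bar>z\<bar> \<longleftrightarrow> 0 \<le> z\<^sup>2 - x\<^sup>2" for x z :: real by (simp add: abs_le_square_iff)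
      \<comment> \<open>Both differences of squares are nonnegative multiples of
        \<open>a * (2 * y + c)\<close>, so the sign of this one expression orders the arguments of
        \<open>g\<close> and of \<open>h\<close> simultaneously.\<close>
      have 1: "(v + a * y)\<^sup>2 - (u + a * y)\<^sup>2 = (v - u) * (a * (2 * y + c))"
        using ac by (simp add: power2_eq_square algebra_simps)
      have 2: "(y + c)\<^sup>2 - y\<^sup>2 = (a * c) * (a * (2 * y + c)) / a\<^sup>2"
        using False by (simp add: power2_eq_square field_simps)
      show "0 \<le> (h y - h (y + c)) * (g (u + a * y) - g (v + a * y))"
      proof (cases "0 \<le> a * (2 * y + c)")
        case True
        then have "\<bar>u + a * y\<bar> \<le> \<bar>v + a * y\<bar>" "\<bar>y\<bar> \<le> \<bar>y + c\<bar>"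
          using that unfolding sq 1 2 ac by (auto intro!: mult_nonneg_nonneg divide_nonneg_nonneg)
        then show ?thesis using gm hm by (intro mult_nonneg_nonneg) auto
      next
        case False
        then have "\<bar>v + a * y\<bar> \<le> \<bar>u + a * y\<bar>" "\<bar>y + c\<bar> \<le> \<bar>y\<bar>"
        proof -
          have "(v + a * y)\<^sup>2 - (u + a * y)\<^sup>2 \<le> 0" unfolding 1 using False that mult_nonneg_nonpos[of "v - u" "a * (2 * y + c)"] by auto
          then show "\<bar>v + a * y\<bar> \<le> \<bar>u + a * y\<bar>" by (simp add: abs_le_square_iff)
          have "(y + c)\<^sup>2 - y\<^sup>2 \<le> 0" unfolding 2 ac using False that mult_nonneg_nonpos[of "u + v" "a * (2 * y + c)"]
            by (intro divide_nonpos_nonneg) auto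
          then show "\<bar>y + c\<bar> \<le> \<bar>y\<bar>" by (simp add: abs_le_square_iff)
        qed
        then show ?thesis using gm hm by (intro mult_nonpos_nonpos) auto
      qed
    qed
    also have "\<dots> = D - E"
      unfolding D_def E_def using int[of 0 u] int[of 0 v] int[of c u] int[of c v]
      by (subst Bochner_Integration.integral_diff[symmetric]) (auto simp: right_diff_distrib left_diff_distrib)
    finally show ?thesis using DE D_eq by simp
  qed
  show ?thesis
    unfolding sym_unimodal_def H_def[symmetric]
  proof (intro conjI allI impI)
    show "H \<in> borel_measurable borel" unfolding H_def by measurable
    show "0 \<le> H x" for x unfolding H_def by (rule integral_nonneg_AE) (simp add: gnn hnn)
    show "H y \<le> H x" if "\<bar>x\<bar> \<le> \<bar>y\<bar>" for x y
    proof -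
      have "H \<bar>z\<bar> = H z" for z using H_sym[of z] by (cases "0 \<le> z") auto
      then show ?thesis using mono[of "\<bar>x\<bar>" "\<bar>y\<bar>"] that by simp
    qed
  qed
qed

text \<open>Integrating out one coordinate replaces \<open>g\<close> by its convolution with a
  rescaled \<open>h\<close>, again symmetric unimodal; the induction therefore runs over arbitrary
  \<open>g\<close>. With no coordinate left, the claim is that \<open>g\<close> is largest at
  0.\<close>

lemma product_sym_unimodal_peak_PiM:
  assumes h: "sym_unimodal h" "integrable lborel h" and I: "finite I" and g: "sym_unimodal g"
  shows "(\<integral>\<^sup>+f. ennreal ((\<Prod>i\<in>I. h (f i)) * g (u + (\<Sum>i\<in>I. a i * f i))) \<partial>Pi\<^sub>M I (\<lambda>_. lborel))
    \<le> (\<integral>\<^sup>+f. ennreal ((\<Prod>i\<in>I. h (f i)) * g (0 + (\<Sum>i\<in>I. a i * f i))) \<partial>Pi\<^sub>M I (\<lambda>_. lborel))"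
  using I g
proof (induction I arbitrary: g)
  case empty
  then show ?case by (auto simp: sym_unimodal_def intro!: mult_right_mono ennreal_leI)
next
  case (insert j I)
  interpret product_sigma_finite "\<lambda>_. lborel :: real measure" by standard
  define g' where "g' v = (\<integral>y. h y * g (v + a j * y) \<partial>lborel)" for v
  have g': "sym_unimodal g'" unfolding g'_def by (rule sym_unimodal_convolution) fact+
  have [measurable]: "g \<in> borel_measurable borel" "h \<in> borel_measurable borel"
    using insert.prems h by (auto simp: sym_unimodal_def)
  have gnn: "0 \<le> g x" and hnn: "0 \<le> h x" and g_le: "g x \<le> g 0" for x
    using insert.prems h by (auto simp: sym_unimodal_def)
  have int: "integrable lborel (\<lambda>y. h y * g (v + a j * y))" for v
  proof (rule Bochner_Integration.integrable_bound)
    show "integrable lborel (\<lambda>y. h y * g 0)" using h(2) by simp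
    show "AE y in lborel. norm (h y * g (v + a j * y)) \<le> norm (h y * g 0)"
      using gnn hnn g_le by (auto simp: abs_mult intro!: mult_left_mono)
  qed measurable
  define J where "J I g w f = ennreal ((\<Prod>i\<in>I. h (f i)) * g (w + (\<Sum>i\<in>I. a i * f i)))" for I g w f
  have red: "(\<integral>\<^sup>+f. J (insert j I) g w f \<partial>Pi\<^sub>M (insert j I) (\<lambda>_. lborel))
    = (\<integral>\<^sup>+f. J I g' w f \<partial>Pi\<^sub>M I (\<lambda>_. lborel))" for w
  proof -
    have "(\<integral>\<^sup>+f. J (insert j I) g w f \<partial>Pi\<^sub>M (insert j I) (\<lambda>_. lborel))
     = (\<integral>\<^sup>+f. \<integral>\<^sup>+y. J (insert j I) g w (f(j := y)) \<partial>lborel \<partial>Pi\<^sub>M I (\<lambda>_. lborel))"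
      by (rule product_nn_integral_insert) (use insert in \<open>auto simp: J_def\<close>)
    also have "\<dots> = (\<integral>\<^sup>+f. J I g' w f \<partial>Pi\<^sub>M I (\<lambda>_. lborel))"
    proof (intro nn_integral_cong)
      fix f :: "'a \<Rightarrow> real"
      define p where "p = (\<Prod>i\<in>I. h (f i))"
      define s where "s = (\<Sum>i\<in>I. a i * f i)"
      have p: "0 \<le> p" unfolding p_def by (intro prod_nonneg) (simp add: hnn)
      have ps: "(\<Prod>i\<in>insert j I. h ((f(j := y)) i)) = h y * p" "(\<Sum>i\<in>insert j I. a i * (f(j := y)) i) = a j * y + s" for y
        using insert.hyps unfolding p_def s_def by (auto intro!: prod.cong sum.cong)
      have "(\<integral>\<^sup>+y. J (insert j I) g w (f(j := y)) \<partial>lborel)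
        = (\<integral>\<^sup>+y. ennreal p * ennreal (h y * g ((w + s) + a j * y)) \<partial>lborel)"
        unfolding J_def ps using p by (intro nn_integral_cong) (simp add: ennreal_mult'[symmetric] algebra_simps)
      also have "\<dots> = ennreal p * ennreal (g' (w + s))"
        unfolding g'_def using int[of "w + s"] gnn hnn
        by (subst nn_integral_cmult) (auto simp: nn_integral_eq_integral)
      finally show "(\<integral>\<^sup>+y. J (insert j I) g w (f(j := y)) \<partial>lborel)
        = J I g' w f"
        using p by (simp add: J_def ennreal_mult' p_def s_def)
    qed
    finally show ?thesis .
  qed
  show ?case using insert.IH[OF g'] unfolding J_def[symmetric] red .
qed

lemma product_sym_unimodal_peak:
  fixes \<xi> :: "'v::euclidean_space"
  assumes h: "sym_unimodal h" "integrable lborel h" and g: "sym_unimodal g"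
  shows "(\<integral>\<^sup>+y. ennreal ((\<Prod>b\<in>Basis. h (y \<bullet> b)) * g (y \<bullet> \<xi> + u)) \<partial>lborel)
    \<le> (\<integral>\<^sup>+y. ennreal ((\<Prod>b\<in>Basis. h (y \<bullet> b)) * g (y \<bullet> \<xi>)) \<partial>lborel)"
proof -
  have [measurable]: "g \<in> borel_measurable borel" "h \<in> borel_measurable borel"
    using g h by (auto simp: sym_unimodal_def)
  have eq: "(\<integral>\<^sup>+y. ennreal ((\<Prod>b\<in>Basis. h (y \<bullet> b)) * g (y \<bullet> \<xi> + w)) \<partial>lborel)
    = (\<integral>\<^sup>+f. ennreal ((\<Prod>b\<in>Basis. h (f b)) * g (w + (\<Sum>b\<in>Basis. (\<xi> \<bullet> b) * f b))) \<partial>Pi\<^sub>M (Basis :: 'v set) (\<lambda>_. lborel))" for w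
  proof -
    have "(\<integral>\<^sup>+y. ennreal ((\<Prod>b\<in>Basis. h (y \<bullet> b)) * g (y \<bullet> \<xi> + w)) \<partial>lborel)
      = (\<integral>\<^sup>+f. ennreal ((\<Prod>b\<in>Basis. h ((\<Sum>c\<in>Basis. f c *\<^sub>R c) \<bullet> b)) * g ((\<Sum>c\<in>Basis. f c *\<^sub>R c) \<bullet> \<xi> + w)) \<partial>Pi\<^sub>M (Basis :: 'v set) (\<lambda>_. lborel))"
      by (subst lborel_eq, subst nn_integral_distr) auto
    also have "\<dots> = (\<integral>\<^sup>+f. ennreal ((\<Prod>b\<in>Basis. h (f b)) * g (w + (\<Sum>b\<in>Basis. (\<xi> \<bullet> b) * f b))) \<partial>Pi\<^sub>M (Basis :: 'v set) (\<lambda>_. lborel))"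
    proof (intro nn_integral_cong)
      fix f :: "'v \<Rightarrow> real"
      have "(\<Prod>b\<in>Basis. h ((\<Sum>c\<in>Basis. f c *\<^sub>R c) \<bullet> b)) = (\<Prod>b\<in>(Basis::'v set). h (f b))"
        by (intro prod.cong refl) (simp add: inner_sum_left_Basis)
      moreover have "(\<Sum>c\<in>Basis. f c *\<^sub>R c) \<bullet> \<xi> = (\<Sum>b\<in>Basis. (\<xi> \<bullet> b) * f b)"
        unfolding inner_sum_left inner_scaleR_left by (simp add: inner_commute mult.commute)
      ultimately show "ennreal ((\<Prod>b\<in>Basis. h ((\<Sum>c\<in>Basis. f c *\<^sub>R c) \<bullet> b)) * g ((\<Sum>c\<in>Basis. f c *\<^sub>R c) \<bullet> \<xi> + w))
        = ennreal ((\<Prod>b\<in>Basis. h (f b)) * g (w + (\<Sum>b\<in>Basis. (\<xi> \<bullet> b) * f b)))"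
        by (simp add: add.commute)
    qed
    finally show ?thesis .
  qed
  show ?thesis
    using product_sym_unimodal_peak_PiM[OF h finite_Basis g, of u "\<lambda>b. \<xi> \<bullet> b"] eq[of u] eq[of 0] by simp
qed

section \<open>High exponents and \<open>\<ell>\<^sub>\<rho>\<close>-norms\<close>

lemma ell_norm_finite:
  assumes "0 < t"
  shows "ell_norm (ereal t) x = (\<Sum>b\<in>Basis. \<bar>x \<bullet> b\<bar> powr t) powr (1 / t)"
    and "ell_norm (ereal t) x powr t = (\<Sum>b\<in>Basis. \<bar>x \<bullet> b\<bar> powr t)"
  using assms by (simp_all add: ell_norm_def powr_powr sum_nonneg)

lemma homogeneous_space_ell_norm:
  fixes t :: real
  assumes t: "0 < t" shows "homogeneous_space (ell_norm (ereal t) :: 'v::euclidean_space \<Rightarrow> real)"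
  unfolding homogeneous_space_def
proof (intro conjI allI impI)
  show "continuous_on UNIV (ell_norm (ereal t) :: 'v \<Rightarrow> real)"
    unfolding ell_norm_finite(1)[OF t, abs_def] using t
    by (intro continuous_on_powr' continuous_intros) (auto intro: sum_nonneg)
  fix x :: 'v
  show "ell_norm (ereal t) (c *\<^sub>R x) = \<bar>c\<bar> * ell_norm (ereal t) x" for c
    using t unfolding ell_norm_finite(1)[OF t]
    by (simp add: abs_mult powr_mult sum_distrib_left[symmetric] powr_powr sum_nonneg)
  assume x: "x \<noteq> 0"
  then obtain b where b: "b \<in> Basis" "x \<bullet> b \<noteq> 0" using euclidean_all_zero_iff[of x] by blast
  have "0 < (\<Sum>b\<in>Basis. \<bar>x \<bullet> b\<bar> powr t)"
    using b by (intro sum_pos2[of _ b]) auto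
  then show "0 < ell_norm (ereal t) x" unfolding ell_norm_finite(1)[OF t] by simp
qed

text \<open>Used for \<open>t\<close> tending to infinity, where the factor
  \<open>DIM('v) powr (1 / t)\<close> tends to 1 and the sandwich closes.\<close>

lemma ell_norm_infinity_bounds:
  fixes x :: "'v::euclidean_space" and t :: real
  assumes t: "0 < t"
  shows "0 \<le> ell_norm \<infinity> x" "ell_norm \<infinity> x \<le> ell_norm (ereal t) x"
    "ell_norm (ereal t) x \<le> DIM('v) powr (1 / t) * ell_norm \<infinity> x"
proof -
  have fin: "finite ((\<lambda>b. \<bar>x \<bullet> b\<bar>) ` Basis)" "(\<lambda>b. \<bar>x \<bullet> b\<bar>) ` Basis \<noteq> {}" by auto
  have "ell_norm \<infinity> x \<in> (\<lambda>b. \<bar>x \<bullet> b\<bar>) ` Basis"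
    using Max_in[OF fin] by (simp add: ell_norm_def)
  then obtain b where b: "b \<in> Basis" "ell_norm \<infinity> x = \<bar>x \<bullet> b\<bar>" by auto
  have M: "c \<in> Basis \<Longrightarrow> \<bar>x \<bullet> c\<bar> \<le> ell_norm \<infinity> x" for c
    using fin by (auto simp: ell_norm_def intro!: Max_ge)
  show nn: "0 \<le> ell_norm \<infinity> x" using b by simp
  have "\<bar>x \<bullet> b\<bar> powr t \<le> (\<Sum>c\<in>Basis. \<bar>x \<bullet> c\<bar> powr t)"
    using b by (intro member_le_sum) auto
  then have "(\<bar>x \<bullet> b\<bar> powr t) powr (1 / t) \<le> ell_norm (ereal t) x"
    unfolding ell_norm_finite(1)[OF t] using t by (intro powr_mono2) auto
  then show "ell_norm \<infinity> x \<le> ell_norm (ereal t) x" using t by (simp add: b powr_powr)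
  have "(\<Sum>c\<in>Basis. \<bar>x \<bullet> c\<bar> powr t) \<le> (\<Sum>c\<in>(Basis::'v set). ell_norm \<infinity> x powr t)"
    using t by (intro sum_mono powr_mono2 M) auto
  then have "ell_norm (ereal t) x \<le> (DIM('v) * ell_norm \<infinity> x powr t) powr (1 / t)"
    unfolding ell_norm_finite(1)[OF t] using t by (intro powr_mono2) (auto intro: sum_nonneg)
  also have "\<dots> = DIM('v) powr (1 / t) * ell_norm \<infinity> x"
    using t nn by (simp add: powr_mult powr_powr)
  finally show "ell_norm (ereal t) x \<le> DIM('v) powr (1 / t) * ell_norm \<infinity> x" .
qed

context cos_dominated
begin

text \<open>Here -1 < n - p - 1 \<le> 0, and in this range the profile only has to be measurable,
  nonnegative and integrable; the exponent 2 provides that for every homogeneous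
  \<open>N\<close>.\<close>

theorem neg_power_le_high_exponent:
  fixes N :: "'v \<Rightarrow> real"
  assumes N: "homogeneous_space N" and p: "0 < p" "real DIM('v) - 1 \<le> p" "p < DIM('v)"
  shows "(\<integral>\<^sup>+x. neg_power p (N x) \<partial>Q) \<le> (\<integral>\<^sup>+x. neg_power p (N x) \<partial>P)"
proof (rule neg_power_le_of_fourier_nonneg[OF N p(1,3), of 2])
  note [measurable] = homogeneous_space_measurable[OF N]
  show "0 \<le> (\<integral>s. ray_weight (real DIM('v) - p - 1) d s *
      cosine_transform (\<lambda>y. exp (- (N y powr 2))) \<xi> s \<partial>lborel)" if d: "0 < d" for d \<xi>
    using p d by (intro radial_fourier_nonneg nn_integral_exp_neg_homogeneous[OF N]) auto
qed simp

text \<open>The profile exponent is taken equal to \<open>t\<close> so that the profile splits into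
  a product over coordinates. After the case p \<ge> n - 1 is removed, n - p - 1 lies in (0, 2], the
  upper bound being p \<ge> n - 3.\<close>

theorem neg_power_le_ell_norm_finite:
  fixes t p :: real
  assumes t: "2 < t" and p: "0 < p" "real DIM('v) - 3 \<le> p" "p < DIM('v)"
  shows "(\<integral>\<^sup>+x. neg_power p (ell_norm (ereal t) x) \<partial>Q) \<le> (\<integral>\<^sup>+x. neg_power p (ell_norm (ereal t) x) \<partial>P)"
proof (cases "real DIM('v) - 1 \<le> p")
  case True
  then show ?thesis using p t by (intro neg_power_le_high_exponent homogeneous_space_ell_norm) auto
next
  case False
  have t0: "0 < t" using t by simp
  note N = homogeneous_space_ell_norm[OF t0, where 'v='v]
  note [measurable] = homogeneous_space_measurable[OF N]
  define h where "h x = exp (- (\<bar>x\<bar> powr t))" for x :: real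
  have \<Phi>: "exp (- (ell_norm (ereal t) y powr t)) = (\<Prod>b\<in>Basis. h (y \<bullet> b))" for y :: 'v
    unfolding ell_norm_finite(2)[OF t0] by (simp add: h_def exp_sum[symmetric] sum_negf)
  have h: "sym_unimodal h"
    unfolding sym_unimodal_def
  proof (intro conjI allI impI)
    show "h \<in> borel_measurable borel" unfolding h_def by measurable
    show "h y \<le> h x" if "\<bar>x\<bar> \<le> \<bar>y\<bar>" for x y
      using powr_mono2[OF _ _ that, of t] t by (simp add: h_def)
  qed (simp add: h_def)
  have hint: "integrable lborel h"
  proof (rule Bochner_Integration.integrable_bound)
    show "integrable lborel (\<lambda>x. exp 1 * exp (- 1 * x\<^sup>2) :: real)" by (intro integrable_mult_right integrable_gaussian) simp
    show "AE x in lborel. norm (h x) \<le> norm (exp 1 * exp (- 1 * x\<^sup>2) :: real)"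
    proof (rule AE_I2)
      fix x :: real
      have "x\<^sup>2 \<le> 1 + \<bar>x\<bar> powr t" using power2_le_one_plus_powr[of "\<bar>x\<bar>" t] t by simp
      then show "norm (h x) \<le> norm (exp 1 * exp (- 1 * x\<^sup>2) :: real)" by (simp add: h_def exp_add[symmetric])
    qed
  qed (use h in \<open>simp add: sym_unimodal_def\<close>)
  have fin: "(\<integral>\<^sup>+y. ennreal (exp (- (ell_norm (ereal t) (y::'v) powr t))) \<partial>lborel) < \<infinity>"
    using t by (intro nn_integral_exp_neg_homogeneous[OF N]) simp
  show ?thesis
  proof (rule neg_power_le_of_fourier_nonneg[OF N p(1,3), of t])
    fix d :: real and \<xi> :: 'v assume d: "0 < d"
    show "0 \<le> (\<integral>s. ray_weight (real DIM('v) - p - 1) d s *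
      cosine_transform (\<lambda>y. exp (- (ell_norm (ereal t) y powr t))) \<xi> s \<partial>lborel)"
    proof (rule radial_fourier_nonneg_of_peak)
      show "0 < real DIM('v) - p - 1" "real DIM('v) - p - 1 \<le> 2" using False p by auto
      show "0 < d" by (rule d)
      show "(\<integral>\<^sup>+y. ennreal (exp (- (ell_norm (ereal t) (y::'v) powr t))) \<partial>lborel) < \<infinity>" by (rule fin)
      fix u
      define g where "g z = exp (- z\<^sup>2 / (4 * d))" for z :: real
      have g: "sym_unimodal g"
        unfolding sym_unimodal_def
      proof (intro conjI allI impI)
        show "g \<in> borel_measurable borel" unfolding g_def by measurable
        show "g y \<le> g x" if "\<bar>x\<bar> \<le> \<bar>y\<bar>" for x y
          using that d by (simp add: g_def abs_le_square_iff divide_right_mono)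
      qed (simp add: g_def)
      have [measurable]: "g \<in> borel_measurable borel" using g by (simp add: sym_unimodal_def)
      have g1: "0 \<le> g z" "g z \<le> 1" for z using d by (simp_all add: g_def)
      define I where "I w = (\<integral>y. exp (- (ell_norm (ereal t) y powr t)) * g (y \<bullet> \<xi> + w) \<partial>lborel)" for w
      have I: "ennreal (I w) = (\<integral>\<^sup>+y. ennreal ((\<Prod>b\<in>Basis. h (y \<bullet> b)) * g (y \<bullet> \<xi> + w)) \<partial>lborel)" for w
      proof -
        have "integrable lborel (\<lambda>y::'v. exp (- (ell_norm (ereal t) y powr t)))"
          using fin by (intro integrableI_bounded) auto
        then have "integrable lborel (\<lambda>y. exp (- (ell_norm (ereal t) y powr t)) * g (y \<bullet> \<xi> + w))"
          by (rule Bochner_Integration.integrable_bound) (use g1 in \<open>auto intro!: mult_left_le\<close>)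
        then show ?thesis unfolding I_def \<Phi>[symmetric]
          by (subst nn_integral_eq_integral) (use g1 in auto)
      qed
      have "ennreal (I u) \<le> ennreal (I 0)"
        unfolding I using product_sym_unimodal_peak[OF h hint g, of \<xi> u] by simp
      moreover have "0 \<le> I 0" unfolding I_def using g1 by (intro integral_nonneg_AE) simp
      ultimately have "I u \<le> I 0" by simp
      then show "(\<integral>y. exp (- (ell_norm (ereal t) y powr t)) * exp (- (y \<bullet> \<xi> + u)\<^sup>2 / (4 * d)) \<partial>lborel)
        \<le> (\<integral>y. exp (- (ell_norm (ereal t) y powr t)) * exp (- (y \<bullet> \<xi>)\<^sup>2 / (4 * d)) \<partial>lborel)"
        by (simp add: I_def g_def)
    next
      show "(\<lambda>y::'v. exp (- (ell_norm (ereal t) y powr t))) \<in> borel_measurable borel" by measurable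
      show "0 \<le> exp (- (ell_norm (ereal t) y powr t))" for y :: 'v by simp
    qed
  qed (use t in simp)
qed

text \<open>For the maximum norm no power turns the profile into a product, so the result is deduced
  from the finite exponents \<open>t = j + 3\<close>. The two norm comparisons lose only the factor
  \<open>c j\<close>, which tends to 1.\<close>

theorem neg_power_le_ell_norm:
  fixes \<rho> :: ereal and p :: real
  assumes \<rho>: "2 < \<rho>" and p: "0 < p" "real DIM('v) - 3 \<le> p" "p < DIM('v)"
  shows "(\<integral>\<^sup>+x. neg_power p (ell_norm \<rho> x) \<partial>Q) \<le> (\<integral>\<^sup>+x. neg_power p (ell_norm \<rho> x) \<partial>P)"
proof (cases \<rho>)
  case (real t)
  then show ?thesis using \<rho> p neg_power_le_ell_norm_finite[of t p] by simp
next
  case PInf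
  define A where "A = (\<integral>\<^sup>+x. neg_power p (ell_norm \<infinity> x) \<partial>Q)"
  define B where "B = (\<integral>\<^sup>+x. neg_power p (ell_norm \<infinity> x) \<partial>P)"
  define c where "c j = ennreal ((real DIM('v) powr (1 / (real j + 3))) powr (- p))" for j :: nat
  note [measurable_cong] = sets_P sets_Q
  have Nm[measurable]: "(ell_norm \<infinity> :: 'v \<Rightarrow> real) \<in> borel_measurable borel"
    unfolding ell_norm_def[abs_def] by simp
  have cA: "c j * A \<le> B" for j
  proof -
    define t where "t = real j + 3"
    have t: "2 < t" "0 < t" by (auto simp: t_def)
    have "c j * A = (\<integral>\<^sup>+x. c j * neg_power p (ell_norm \<infinity> x) \<partial>Q)"
      unfolding A_def by (rule nn_integral_cmult[symmetric]) measurable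
    also have "\<dots> \<le> (\<integral>\<^sup>+x. neg_power p (ell_norm (ereal t) x) \<partial>Q)"
    proof (intro nn_integral_mono)
      fix x :: 'v
      have "c j * neg_power p (ell_norm \<infinity> x) = neg_power p (real DIM('v) powr (1 / t) * ell_norm \<infinity> x)"
        unfolding c_def t_def[symmetric] using p ell_norm_infinity_bounds(1)[OF t(2)] by (subst neg_power_mult) auto
      also have "\<dots> \<le> neg_power p (ell_norm (ereal t) x)"
        using p order_trans[OF ell_norm_infinity_bounds(1,2)[OF t(2)]] ell_norm_infinity_bounds(3)[OF t(2)]
        by (intro neg_power_antimono) auto
      finally show "c j * neg_power p (ell_norm \<infinity> x) \<le> neg_power p (ell_norm (ereal t) x)" .
    qed
    also have "\<dots> \<le> (\<integral>\<^sup>+x. neg_power p (ell_norm (ereal t) x) \<partial>P)"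
      using t p by (intro neg_power_le_ell_norm_finite) auto
    also have "\<dots> \<le> B" unfolding B_def
      by (intro nn_integral_mono neg_power_antimono p(1) ell_norm_infinity_bounds[OF t(2)])
    finally show ?thesis .
  qed
  have "A \<le> B"
  \<comment> \<open>If \<open>A\<close> is infinite, a single positive factor already forces
    \<open>B\<close> to be infinite; the limit is taken only for finite \<open>A\<close>.\<close>
  proof (cases "A = \<infinity>")
    case True
    have "c 0 \<noteq> 0" by (simp add: c_def)
    then have "c 0 * A = \<infinity>" using True by (simp add: ennreal_mult_top)
    then show ?thesis using cA[of 0] by (simp add: top_unique)
  next
    case False
    have "(\<lambda>j. 1 / (real j + 3)) \<longlonglongrightarrow> 0"
      by (subst add.commute) (intro real_tendsto_divide_at_top[OF tendsto_const]
        filterlim_tendsto_add_at_top[OF tendsto_const filterlim_real_sequentially])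
    then have "c \<longlonglongrightarrow> ennreal ((real DIM('v) powr 0) powr (- p))"
      unfolding c_def by (intro tendsto_ennrealI tendsto_powr tendsto_const) auto
    then have "(\<lambda>j. c j * A) \<longlonglongrightarrow> 1 * A"
      using False by (intro ennreal_tendsto_multc) (auto simp: less_top)
    then show ?thesis using cA by (intro LIMSEQ_le_const2[of "\<lambda>j. c j * A"]) auto
  qed
  then show ?thesis using PInf by (simp add: A_def B_def)
qed (use \<rho> in simp)

end

section \<open>Subspaces of \<open>L\<^sub>r\<close>\<close>

lemma Lp_norm_powr:
  assumes "0 < r" shows "Lp_norm r \<mu> f powr r = (LINT t|\<mu>. \<bar>f t\<bar> powr r)"
  using assms by (simp add: Lp_norm_def powr_powr integral_nonneg_AE)

text \<open>Each summand is at most \<open>m\<close>, the quasi-norm of the family; this treats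
  exponents below and above 1 together.\<close>

lemma sum_powr_le:
  fixes f :: "'b \<Rightarrow> real"
  assumes B: "finite B" and r: "0 < r" and nn: "\<And>b. b \<in> B \<Longrightarrow> 0 \<le> f b"
  shows "(\<Sum>b\<in>B. f b) powr r \<le> real (card B) powr r * (\<Sum>b\<in>B. f b powr r)"
proof -
  define m where "m = (\<Sum>b\<in>B. f b powr r) powr (1 / r)"
  have m: "f b \<le> m" if b: "b \<in> B" for b
  proof -
    have "f b powr r \<le> (\<Sum>b\<in>B. f b powr r)" using b B by (intro member_le_sum) auto
    then have "(f b powr r) powr (1 / r) \<le> m" unfolding m_def using r by (intro powr_mono2) auto
    then show ?thesis using r nn[OF b] by (simp add: powr_powr)
  qed
  have "(\<Sum>b\<in>B. f b) \<le> (\<Sum>b\<in>B. m)" by (intro sum_mono m)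
  then have "(\<Sum>b\<in>B. f b) powr r \<le> (real (card B) * m) powr r"
    using r nn by (intro powr_mono2) (auto intro: sum_nonneg)
  also have "\<dots> = real (card B) powr r * (\<Sum>b\<in>B. f b powr r)"
    using r by (simp add: powr_mult m_def powr_powr sum_nonneg)
  finally show ?thesis .
qed

text \<open>Polar coordinates \<open>y = |y| \<cdot> \<theta>\<close> of the vector of basis images turn the possibly infinite
  measure \<open>\<mu>\<close> into a finite one.\<close>

lemma subspace_of_Lp_spectral:
  fixes N :: "'v::euclidean_space \<Rightarrow> real" and \<mu> :: "'t measure"
  assumes r: "0 < r" and N: "subspace_of_Lp r \<mu> N"
  obtains M :: "'t measure" and \<theta> :: "'t \<Rightarrow> 'v"
  where "finite_measure M" "\<theta> \<in> borel_measurable M" "\<And>t. norm (\<theta> t) \<le> 1"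
    "\<And>x. N x powr r = (\<integral>t. \<bar>x \<bullet> \<theta> t\<bar> powr r \<partial>M)"
proof -
  obtain T :: "'v \<Rightarrow> 't \<Rightarrow> real" where T: "\<And>x. in_Lp r \<mu> (T x)"
    "\<And>a b x y. AE t in \<mu>. T (a *\<^sub>R x + b *\<^sub>R y) t = a * T x t + b * T y t"
    "\<And>x. N x = Lp_norm r \<mu> (T x)"
    using N by (auto simp: subspace_of_Lp_def)
  define y where "y t = (\<Sum>b\<in>Basis. T b t *\<^sub>R b)" for t
  have Tm[measurable]: "T x \<in> borel_measurable \<mu>" and Ti: "integrable \<mu> (\<lambda>t. \<bar>T x t\<bar> powr r)" for x
    using T(1)[of x] by (auto simp: in_Lp_def)
  have ym[measurable]: "y \<in> borel_measurable \<mu>" unfolding y_def by measurable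
  have lin: "AE t in \<mu>. T (\<Sum>b\<in>S. c b *\<^sub>R b) t = (\<Sum>b\<in>S. c b * T b t)" if "finite S" for S :: "'v set" and c
    using that
  proof (induction S)
    case empty
    show ?case using T(2)[of 0 0 0 0] by simp
  next
    case (insert b S)
    have "AE t in \<mu>. T (c b *\<^sub>R b + 1 *\<^sub>R (\<Sum>b\<in>S. c b *\<^sub>R b)) t = c b * T b t + 1 * T (\<Sum>b\<in>S. c b *\<^sub>R b) t"
      by (rule T(2))
    with insert.IH show ?case
      by eventually_elim (use insert.hyps in simp)
  qed
  \<comment> \<open>The exceptional null set depends on \<open>x\<close>. This is harmless, since
    each integral below concerns one \<open>x\<close> only.\<close>
  have Ty: "AE t in \<mu>. T x t = x \<bullet> y t" for x
    using lin[OF finite_Basis, of "\<lambda>b. x \<bullet> b"]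
    by eventually_elim (simp add: euclidean_representation y_def inner_sum_right mult.commute)
  have y_int: "integrable \<mu> (\<lambda>t. norm (y t) powr r)"
  proof (rule Bochner_Integration.integrable_bound)
    show "integrable \<mu> (\<lambda>t. real DIM('v) powr r * (\<Sum>b\<in>Basis. \<bar>T b t\<bar> powr r))"
      by (intro integrable_mult_right Bochner_Integration.integrable_sum Ti)
    show "AE t in \<mu>. norm (norm (y t) powr r) \<le> norm (real DIM('v) powr r * (\<Sum>b\<in>Basis. \<bar>T b t\<bar> powr r))"
    proof (rule AE_I2)
      fix t
      have "norm (y t) \<le> (\<Sum>b\<in>Basis. norm (T b t *\<^sub>R (b::'v)))" unfolding y_def by (rule norm_sum)
      also have "\<dots> = (\<Sum>b\<in>(Basis::'v set). \<bar>T b t\<bar>)" by (intro sum.cong) auto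
      finally have "norm (y t) powr r \<le> (\<Sum>b\<in>(Basis::'v set). \<bar>T b t\<bar>) powr r" using r by (intro powr_mono2) auto
      also have "\<dots> \<le> real DIM('v) powr r * (\<Sum>b\<in>Basis. \<bar>T b t\<bar> powr r)"
        by (rule sum_powr_le[OF finite_Basis r]) simp
      finally show "norm (norm (y t) powr r) \<le> norm (real DIM('v) powr r * (\<Sum>b\<in>Basis. \<bar>T b t\<bar> powr r))" by simp
    qed
  qed measurable
  define M where "M = density \<mu> (\<lambda>t. ennreal (norm (y t) powr r))"
  \<comment> \<open>Where \<open>y\<close> vanishes, \<theta> is 0 and not a unit vector, hence the
    bound \<open>norm (\<theta> t) \<le> 1\<close>; the density of \<open>M\<close> vanishes
    there.\<close>
  define \<theta> where "\<theta> t = y t /\<^sub>R norm (y t)" for t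
  have \<theta>m[measurable]: "\<theta> \<in> borel_measurable \<mu>" unfolding \<theta>_def by measurable
  show ?thesis
  proof (rule that[of M \<theta>])
    have "(\<integral>\<^sup>+t. ennreal (norm (y t) powr r) \<partial>\<mu>) < \<infinity>" using y_int by (simp add: integrable_iff_bounded)
    then show "finite_measure M" by (intro finite_measureI) (simp add: M_def emeasure_density)
    show "\<theta> \<in> borel_measurable M" by (simp add: M_def)
    show "norm (\<theta> t) \<le> 1" for t by (cases "y t = 0") (simp_all add: \<theta>_def)
    fix x
    have "N x powr r = (\<integral>t. \<bar>x \<bullet> y t\<bar> powr r \<partial>\<mu>)"
      unfolding T(3) Lp_norm_powr[OF r]
      by (intro integral_cong_AE) (use Ty[of x] in \<open>auto elim: eventually_mono\<close>)
    also have "\<dots> = (\<integral>t. norm (y t) powr r * \<bar>x \<bullet> \<theta> t\<bar> powr r \<partial>\<mu>)"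
    proof (intro Bochner_Integration.integral_cong refl)
      fix t show "\<bar>x \<bullet> y t\<bar> powr r = norm (y t) powr r * \<bar>x \<bullet> \<theta> t\<bar> powr r"
        by (cases "y t = 0") (simp_all add: \<theta>_def powr_mult[symmetric] abs_mult mult.assoc[symmetric])
    qed
    also have "\<dots> = (\<integral>t. \<bar>x \<bullet> \<theta> t\<bar> powr r \<partial>M)"
      unfolding M_def by (subst integral_density) auto
    finally show "N x powr r = (\<integral>t. \<bar>x \<bullet> \<theta> t\<bar> powr r \<partial>M)" .
  qed
qed

context cos_dominated
begin

text \<open>Schoenberg's argument. Replacing the r-th power by its approximation \<open>a m\<close>
  turns the exponent into a constant plus \<open>c\<close> times a mixture of cosines, so the
  exponential is a positive constant times a \<open>multiplier_exp\<close>. All approximants lie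
  between 0 and 1, and \<open>multiplier_lim\<close> applies.\<close>

lemma multiplier_exp_neg_Lp_norm:
  fixes N :: "'v \<Rightarrow> real" and \<mu> :: "'t measure"
  assumes r: "0 < r" "r \<le> 2" and N: "subspace_of_Lp r \<mu> N" and c: "0 \<le> c"
  shows "multiplier (\<lambda>x. exp (- c * N x powr r))"
proof -
  obtain M :: "'t measure" and \<theta> :: "'t \<Rightarrow> 'v"
    where M: "finite_measure M" and \<theta>m[measurable]: "\<theta> \<in> borel_measurable M" and \<theta>: "\<And>t. norm (\<theta> t) \<le> 1"
    and N_eq: "\<And>x. N x powr r = (\<integral>t. \<bar>x \<bullet> \<theta> t\<bar> powr r \<partial>M)"
    using subspace_of_Lp_spectral[OF r(1) N] by metis
  interpret M: finite_measure M by fact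
  obtain \<nu> :: "nat \<Rightarrow> real measure"
    where \<nu>: "\<And>m. finite_measure (\<nu> m)" "\<And>m. sets (\<nu> m) = sets borel"
    "\<And>z. (\<lambda>m. \<integral>u. 1 - cos (u * z) \<partial>\<nu> m) \<longlonglongrightarrow> \<bar>z\<bar> powr r"
    "\<And>m z. (\<integral>u. 1 - cos (u * z) \<partial>\<nu> m) \<le> \<bar>z\<bar> powr r"
    using abs_powr_levy[OF r] by metis
  define a where "a m z = (\<integral>u. 1 - cos (u * z) \<partial>\<nu> m)" for m z
  define k where "k m z = (\<integral>u. cos (u * z) \<partial>\<nu> m)" for m z
  have km[measurable]: "k m \<in> borel_measurable borel" for m
  proof -
    interpret finite_measure "\<nu> m" by (rule \<nu>)
    note [measurable_cong] = \<nu>(2)[of m]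
    show ?thesis unfolding k_def by measurable
  qed
  have ak: "a m z = measure (\<nu> m) (space (\<nu> m)) - k m z" for m z
  proof -
    have "integrable (\<nu> m) (\<lambda>u. cos (u * z))"
      by (rule finite_measure_integrable_bounded[OF \<nu>(1), where B=1]) (simp_all add: \<nu>(2) cong: measurable_cong_sets)
    moreover have "integrable (\<nu> m) (\<lambda>u. 1 :: real)"
      by (rule finite_measure_integrable_bounded[OF \<nu>(1), where B=1]) simp_all
    ultimately show ?thesis unfolding a_def k_def by simp
  qed
  have am[measurable]: "a m \<in> borel_measurable borel" for m unfolding ak by measurable
  have ann: "0 \<le> a m z" for m z unfolding a_def by (rule integral_nonneg_AE) simp
  have a_le: "a m z \<le> \<bar>z\<bar> powr r" for m z unfolding a_def by (rule \<nu>(4))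
  have k_le: "\<bar>k m z\<bar> \<le> measure (\<nu> m) (space (\<nu> m))" for m z
  proof -
    interpret finite_measure "\<nu> m" by (rule \<nu>)
    have "\<bar>k m z\<bar> \<le> (\<integral>u. \<bar>cos (u * z)\<bar> \<partial>\<nu> m)"
      unfolding k_def using integral_norm_bound[of "\<nu> m" "\<lambda>u. cos (u * z)"] by simp
    also have "\<dots> \<le> (\<integral>u. 1 \<partial>\<nu> m)"
      by (intro integral_mono finite_measure_integrable_bounded[OF \<nu>(1), where B=1]) (simp_all add: \<nu>(2) cong: measurable_cong_sets)
    finally show ?thesis by simp
  qed
  have inner_le: "\<bar>x \<bullet> \<theta> t\<bar> \<le> norm x" for x t
    using Cauchy_Schwarz_ineq2[of x "\<theta> t"] mult_left_mono[OF \<theta>[of t] norm_ge_zero[of x]] by simp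
  have a_int: "integrable M (\<lambda>t. a m (x \<bullet> \<theta> t))" for m x
  proof (rule M.integrable_const_bound[where B="norm x powr r"])
    show "AE t in M. norm (a m (x \<bullet> \<theta> t)) \<le> norm x powr r"
      using ann order_trans[OF a_le powr_mono2[OF _ _ inner_le]] r by (intro AE_I2) simp
  qed measurable
  have mk: "multiplier (\<lambda>x. \<integral>t. k m (x \<bullet> \<theta> t) \<partial>M)" for m
  proof (rule multiplier_integral[OF M, where B="measure (\<nu> m) (space (\<nu> m))"])
    show "(\<lambda>(t, x). k m (x \<bullet> \<theta> t)) \<in> borel_measurable (M \<Otimes>\<^sub>M borel)" by measurable
    show "multiplier (\<lambda>x. k m (x \<bullet> \<theta> t))" for t
      unfolding k_def
    proof (rule multiplier_integral[OF \<nu>(1), where B=1])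
      note [measurable_cong] = \<nu>(2)[of m]
      show "(\<lambda>(u, x). cos (u * (x \<bullet> \<theta> t))) \<in> borel_measurable (\<nu> m \<Otimes>\<^sub>M borel)" by measurable
      show "multiplier (\<lambda>x. cos (u * (x \<bullet> \<theta> t)))" for u
        using multiplier_cos[of "u *\<^sub>R \<theta> t"] by simp
    qed simp
  qed (rule k_le)
  define m0 where "m0 m = measure (\<nu> m) (space (\<nu> m)) * measure M (space M)" for m
  have exp_a: "exp (- c * (\<integral>t. a m (x \<bullet> \<theta> t) \<partial>M)) = exp (- c * m0 m) * exp (c * (\<integral>t. k m (x \<bullet> \<theta> t) \<partial>M))" for m x
  proof -
    have "integrable M (\<lambda>t. k m (x \<bullet> \<theta> t))"
      by (rule M.integrable_const_bound[where B="measure (\<nu> m) (space (\<nu> m))"]) (use k_le in auto)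
    then have "(\<integral>t. a m (x \<bullet> \<theta> t) \<partial>M) = m0 m - (\<integral>t. k m (x \<bullet> \<theta> t) \<partial>M)"
      unfolding ak m0_def by simp
    then show ?thesis by (simp add: exp_add[symmetric] right_diff_distrib)
  qed
  show ?thesis
  proof (rule multiplier_lim[where B=1])
    show "multiplier (\<lambda>x. exp (- c * (\<integral>t. a m (x \<bullet> \<theta> t) \<partial>M)))" for m
      unfolding exp_a using c by (intro multiplier_mult multiplier_const multiplier_exp mk) auto
    show "\<bar>exp (- c * (\<integral>t. a m (x \<bullet> \<theta> t) \<partial>M))\<bar> \<le> 1" for m x
      using c by (auto intro!: mult_nonneg_nonneg integral_nonneg_AE ann)
    fix x
    have "(\<lambda>m. \<integral>t. a m (x \<bullet> \<theta> t) \<partial>M) \<longlonglongrightarrow> (\<integral>t. \<bar>x \<bullet> \<theta> t\<bar> powr r \<partial>M)"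
    proof (rule integral_dominated_convergence[where w="\<lambda>_. norm x powr r"])
      show "AE t in M. (\<lambda>m. a m (x \<bullet> \<theta> t)) \<longlonglongrightarrow> \<bar>x \<bullet> \<theta> t\<bar> powr r"
        unfolding a_def by (intro AE_I2 \<nu>(3))
      show "AE t in M. norm (a m (x \<bullet> \<theta> t)) \<le> norm x powr r" for m
        using ann order_trans[OF a_le powr_mono2[OF _ _ inner_le]] r by (intro AE_I2) simp
    qed auto
    then show "(\<lambda>m. exp (- c * (\<integral>t. a m (x \<bullet> \<theta> t) \<partial>M))) \<longlonglongrightarrow> exp (- c * N x powr r)"
      unfolding N_eq by (intro tendsto_intros)
  qed
qed

text \<open>The comparison holds for every scale \<open>s\<close> separately, between bounded
  functions. Tonelli's theorem then allows integration over \<open>s\<close> with values in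
  [0, \<infinity>], without smoothing or local integrability.\<close>

theorem neg_power_le_Lp_norm:
  fixes N :: "'v \<Rightarrow> real" and \<mu> :: "'t measure"
  assumes r: "0 < r" "r \<le> 2" and N: "subspace_of_Lp r \<mu> N" and Nm: "N \<in> borel_measurable borel" and p: "0 < p"
  shows "(\<integral>\<^sup>+x. neg_power p (N x) \<partial>Q) \<le> (\<integral>\<^sup>+x. neg_power p (N x) \<partial>P)"
proof -
  note [measurable] = Nm
  have Nnn: "0 \<le> N x" for x using N by (auto simp: subspace_of_Lp_def Lp_norm_def)
  obtain C where C: "0 < C" and mix: "\<And>t. 0 \<le> t \<Longrightarrow> neg_power p t =
    exp_mixture C p r t"
    using neg_power_mixture[of r p] r p by auto
  define f where "f s x = ennreal (C * s powr (- p - 1) * exp (- ((N x / s) powr r))) * indicator {0<..} s" for s x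
  have [measurable]: "case_prod f \<in> borel_measurable (lborel \<Otimes>\<^sub>M borel)" unfolding f_def by measurable
  have swap: "(\<integral>\<^sup>+x. neg_power p (N x) \<partial>M) = (\<integral>\<^sup>+s. \<integral>\<^sup>+x. f s x \<partial>M \<partial>lborel)"
    if M: "finite_measure M" and sM: "sets M = sets borel" for M
  proof -
    interpret M: finite_measure M by fact
    interpret pair_sigma_finite lborel M ..
    note [measurable_cong] = sM
    have "(\<integral>\<^sup>+x. neg_power p (N x) \<partial>M) = (\<integral>\<^sup>+x. \<integral>\<^sup>+s. f s x \<partial>lborel \<partial>M)"
      unfolding f_def by (intro nn_integral_cong mix Nnn)
    also have "\<dots> = (\<integral>\<^sup>+s. \<integral>\<^sup>+x. f s x \<partial>M \<partial>lborel)"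
      by (rule Fubini') (unfold f_def, measurable)
    finally show ?thesis .
  qed
  show ?thesis
    unfolding swap[OF fin_P sets_P] swap[OF fin_Q sets_Q]
  proof (intro nn_integral_mono)
    fix s :: real
    show "(\<integral>\<^sup>+x. f s x \<partial>Q) \<le> (\<integral>\<^sup>+x. f s x \<partial>P)"
    proof (cases "0 < s")
      case True
      have f: "f s = (\<lambda>x. ennreal (C * s powr (- p - 1) * exp (- (1 / s powr r) * N x powr r)))"
        using True by (auto simp: f_def fun_eq_iff powr_divide Nnn)
      show ?thesis unfolding f
        using C True by (intro multiplier_nn_integral_le multiplier_mult multiplier_const multiplier_exp_neg_Lp_norm[OF r N]) auto
    qed (simp add: f_def)
  qed
qed

end

section \<open>Stable vectors\<close>

text \<open>Concavity through the tangent at 1: after division by the mean, Bernoulli's inequality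
  bounds both powers, and the linear terms cancel because the quotients add up to 2.\<close>

lemma powr_mean_le:
  fixes A B e :: real
  assumes "0 \<le> A" "0 \<le> B" "0 < e" "e \<le> 1"
  shows "A powr e + B powr e \<le> 2 * ((A + B) / 2) powr e"
proof (cases "A + B = 0")
  case True
  then show ?thesis using assms by (auto simp: add_nonneg_eq_0_iff)
next
  case False
  define m where "m = (A + B) / 2"
  have m: "0 < m" using False assms by (simp add: m_def)
  have bern: "x powr e \<le> 1 + e * (x - 1)" if x: "0 \<le> x" for x :: real
  proof (cases "x = 0")
    case False
    then have "x > 0" using x by simp
    have "e * ln x + (1 - e) * ln 1 \<le> ln (e * x + (1 - e) * 1)"
      using concave_onD[OF ln_concave, of "1 - e" x 1] \<open>x > 0\<close> assms by simp
    then have "exp (e * ln x) \<le> exp (ln (1 + e * (x - 1)))" by (simp add: algebra_simps)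
    moreover have "0 < e * x + (1 - e)" using \<open>x > 0\<close> assms by (simp add: add_pos_nonneg)
    then have "0 < 1 + e * (x - 1)" by (simp add: algebra_simps)
    ultimately show ?thesis using \<open>x > 0\<close> by (simp add: powr_def)
  qed (use assms in simp)
  have "(A / m) powr e + (B / m) powr e \<le> (1 + e * (A / m - 1)) + (1 + e * (B / m - 1))"
    using bern[of "A / m"] bern[of "B / m"] assms m by (intro add_mono) auto
  also have "\<dots> = 2 + e * ((A + B) / m - 2)" by (simp add: add_divide_distrib algebra_simps)
  also have "(A + B) / m = 2" using m by (simp add: m_def field_simps)
  finally have "(A powr e + B powr e) / m powr e \<le> 2"
    using assms m by (simp add: powr_divide add_divide_distrib)
  then show ?thesis using m by (simp add: m_def field_simps)
qed

text \<open>After normalizing the sum to 1, each part z in (0, 1) is strictly below its e-th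
  power.\<close>

lemma powr_subadditive_strict:
  fixes x y e :: real
  assumes "0 < x" "0 < y" "0 < e" "e < 1" shows "(x + y) powr e < x powr e + y powr e"
proof -
  define s where "s = x + y"
  have s: "0 < s" using assms by (simp add: s_def)
  have *: "z < z powr e" if "0 < z" "z < 1" for z :: real
    using powr_less_mono'[of z e 1] that assms by simp
  have "1 = x / s + y / s" using s by (simp add: s_def add_divide_distrib[symmetric])
  also have "\<dots> < (x / s) powr e + (y / s) powr e"
    using * assms s by (intro add_strict_mono) (auto simp: s_def)
  also have "\<dots> = (x powr e + y powr e) / s powr e" using assms s by (simp add: powr_divide add_divide_distrib)
  finally show ?thesis using s by (simp add: s_def field_simps)
qed

lemma abs_powr_eq_power2: "\<bar>a\<bar> powr q = (a\<^sup>2) powr (q / 2)" for a q :: real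
proof -
  have "(a\<^sup>2) powr (q / 2) = (\<bar>a\<bar> powr 2) powr (q / 2)" by (cases "a = 0") (simp_all add: powr_numeral)
  also have "\<dots> = \<bar>a\<bar> powr (2 * (q / 2))" by (rule powr_powr)
  finally show ?thesis by simp
qed

text \<open>Concavity of the power q/2 applied to the squares, whose mean is a^2 + b^2 by the
  parallelogram law, followed by subadditivity. The weak form compares the characteristic functions;
  the strict form detects disjoint supports.\<close>

lemma abs_powr_parallelogram:
  fixes a b q :: real
  assumes q: "0 < q" "q \<le> 2"
  shows "\<bar>a + b\<bar> powr q + \<bar>a - b\<bar> powr q \<le> 2 * (\<bar>a\<bar> powr q + \<bar>b\<bar> powr q)"
    and "q < 2 \<Longrightarrow> a \<noteq> 0 \<Longrightarrow> b \<noteq> 0 \<Longrightarrow>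
      \<bar>a + b\<bar> powr q + \<bar>a - b\<bar> powr q < 2 * (\<bar>a\<bar> powr q + \<bar>b\<bar> powr q)"
proof -
  have eq: "((a + b)\<^sup>2 + (a - b)\<^sup>2) / 2 = a\<^sup>2 + b\<^sup>2" by (simp add: power2_eq_square algebra_simps)
  have "((a + b)\<^sup>2) powr (q / 2) + ((a - b)\<^sup>2) powr (q / 2) \<le> 2 * (((a + b)\<^sup>2 + (a - b)\<^sup>2) / 2) powr (q / 2)"
    using q by (intro powr_mean_le) auto
  then have mean: "\<bar>a + b\<bar> powr q + \<bar>a - b\<bar> powr q \<le> 2 * (a\<^sup>2 + b\<^sup>2) powr (q / 2)"
    by (simp only: abs_powr_eq_power2 eq)
  show strict: "\<bar>a + b\<bar> powr q + \<bar>a - b\<bar> powr q < 2 * (\<bar>a\<bar> powr q + \<bar>b\<bar> powr q)" if "q < 2" "a \<noteq> 0" "b \<noteq> 0"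
    using mean powr_subadditive_strict[of "a\<^sup>2" "b\<^sup>2" "q / 2"] that q unfolding abs_powr_eq_power2[of a] abs_powr_eq_power2[of b] by simp
  show "\<bar>a + b\<bar> powr q + \<bar>a - b\<bar> powr q \<le> 2 * (\<bar>a\<bar> powr q + \<bar>b\<bar> powr q)"
  proof (cases "q = 2 \<or> a = 0 \<or> b = 0")
    case True
    then show ?thesis
    proof (elim disjE)
      assume "q = 2"
      then show ?thesis using mean by (simp add: abs_powr_eq_power2)
    qed (use q in \<open>simp_all\<close>)
  next
    case False
    then show ?thesis using strict q by fastforce
  qed
qed

section \<open>Factorization and symmetrization of stable characteristic functions\<close>

lemma in_Lp_cmult: "in_Lp q \<mu> f \<Longrightarrow> in_Lp q \<mu> (\<lambda>t. c * f t)"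
  by (auto simp: in_Lp_def abs_mult powr_mult)

lemma in_Lp_sum:
  assumes q: "0 < q" and B: "finite B" and f: "\<And>b. b \<in> B \<Longrightarrow> in_Lp q \<mu> (f b)"
  shows "in_Lp q \<mu> (\<lambda>t. \<Sum>b\<in>B. f b t)"
  unfolding in_Lp_def
proof
  show m: "(\<lambda>t. \<Sum>b\<in>B. f b t) \<in> borel_measurable \<mu>"
    using f by (intro borel_measurable_sum) (auto simp: in_Lp_def)
  show "integrable \<mu> (\<lambda>t. \<bar>\<Sum>b\<in>B. f b t\<bar> powr q)"
  proof (rule Bochner_Integration.integrable_bound)
    show "integrable \<mu> (\<lambda>t. real (card B) powr q * (\<Sum>b\<in>B. \<bar>f b t\<bar> powr q))"
      using f by (intro integrable_mult_right Bochner_Integration.integrable_sum) (auto simp: in_Lp_def)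
    show "AE t in \<mu>. norm (\<bar>\<Sum>b\<in>B. f b t\<bar> powr q) \<le> norm (real (card B) powr q * (\<Sum>b\<in>B. \<bar>f b t\<bar> powr q))"
    proof (rule AE_I2)
      fix t
      have "\<bar>\<Sum>b\<in>B. f b t\<bar> powr q \<le> (\<Sum>b\<in>B. \<bar>f b t\<bar>) powr q" using q by (intro powr_mono2 sum_abs) auto
      also have "\<dots> \<le> real (card B) powr q * (\<Sum>b\<in>B. \<bar>f b t\<bar> powr q)" by (rule sum_powr_le[OF B q]) simp
      finally show "norm (\<bar>\<Sum>b\<in>B. f b t\<bar> powr q) \<le> norm (real (card B) powr q * (\<Sum>b\<in>B. \<bar>f b t\<bar> powr q))" by simp
    qed
  qed (use m in measurable)
qed

abbreviation power_integral :: "real \<Rightarrow> 't measure \<Rightarrow> ('t \<Rightarrow> real) \<Rightarrow> real" where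
  "power_integral q \<mu> f \<equiv> LINT t|\<mu>. \<bar>f t\<bar> powr q"

text \<open>Packaging the representing functions as a family \<open>S \<xi>\<close> linear in \<xi>
  lets block splitting and sign changes be handled by linearity.\<close>

lemma symmetric_stableE:
  fixes X :: "'w \<Rightarrow> 'v::euclidean_space"
  assumes "symmetric_stable q M X" and q: "0 < q"
  obtains S :: "'v \<Rightarrow> real \<Rightarrow> real"
  where "\<And>\<xi>. in_Lp q (lebesgue_on {0..1}) (S \<xi>)" and "\<And>t. linear (\<lambda>\<xi>. S \<xi> t)"
    and "\<And>\<xi>. (LINT \<omega>|M. cis (\<xi> \<bullet> X \<omega>)) = complex_of_real (exp (- power_integral q (lebesgue_on {0..1}) (S \<xi>)))"
proof -
  obtain s :: "'v \<Rightarrow> real \<Rightarrow> real" where s: "\<And>b. b \<in> Basis \<Longrightarrow> in_Lp q (lebesgue_on {0..1}) (s b)"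
    "\<And>\<xi>. (LINT \<omega>|M. cis (\<xi> \<bullet> X \<omega>)) = complex_of_real (exp (- (LINT t|lebesgue_on {0..1}. \<bar>\<Sum>b\<in>Basis. (\<xi> \<bullet> b) * s b t\<bar> powr q)))"
    using assms by (auto simp: symmetric_stable_def)
  show ?thesis
  proof (rule that[of "\<lambda>\<xi> t. \<Sum>b\<in>Basis. (\<xi> \<bullet> b) * s b t"])
    show "in_Lp q (lebesgue_on {0..1}) (\<lambda>t. \<Sum>b\<in>Basis. (\<xi> \<bullet> b) * s b t)" for \<xi>
      by (intro in_Lp_sum[OF q] in_Lp_cmult s) auto
    show "linear (\<lambda>\<xi>. \<Sum>b\<in>Basis. (\<xi> \<bullet> b) * s b t)" for t
      by (intro linearI) (simp_all add: inner_add_left distrib_right sum.distrib sum_distrib_left mult.assoc)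
  qed (rule s(2))
qed

text \<open>Additivity on pairs of basis vectors extends to whole blocks. For q < 2 equality in the
  power inequality forces the functions of the two blocks to have disjoint supports almost
  everywhere; both signs \<open>c\<close> are used, because the inequality involves a sum and a
  difference. For q = 2 additivity means orthogonality, which is bilinear.\<close>

lemma stable_product_factorizes:
  fixes S :: "'a::euclidean_space \<times> 'b::euclidean_space \<Rightarrow> real \<Rightarrow> real"
  assumes q: "0 < q" "q \<le> 2"
    and S: "\<And>\<xi>. in_Lp q \<mu> (S \<xi>)" and lin: "\<And>t. linear (\<lambda>\<xi>. S \<xi> t)"
    and fac: "\<And>i j c. i \<in> Basis \<Longrightarrow> j \<in> Basis \<Longrightarrow> \<bar>c\<bar> = 1 \<Longrightarrow>
      power_integral q \<mu> (S (i, c *\<^sub>R j)) = power_integral q \<mu> (S (i, 0)) + power_integral q \<mu> (S (0, j))"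
  shows "power_integral q \<mu> (S (u, v)) = power_integral q \<mu> (S (u, 0)) + power_integral q \<mu> (S (0, v))"
proof -
  have [measurable]: "S \<xi> \<in> borel_measurable \<mu>" and int: "integrable \<mu> (\<lambda>t. \<bar>S \<xi> t\<bar> powr q)" for \<xi>
    using S[of \<xi>] by (auto simp: in_Lp_def)
  have split: "S (x, y) t = S (x, 0) t + S (0, y) t" for x y t
    using linear_add[OF lin[of t], of "(x, 0)" "(0, y)"] by simp
  have scale2: "S (0, c *\<^sub>R y) t = c * S (0, y) t" and scale1: "S (c *\<^sub>R x, 0) t = c * S (x, 0) t" for x y c t
    using linear_scale[OF lin[of t], of c "(0, y)"] linear_scale[OF lin[of t], of c "(x, 0)"] by simp_all
  have neg: "S (0, - y) t = - S (0, y) t" for y t using scale2[of "-1" y t] by simp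
  have U: "S (u, 0) t = (\<Sum>i\<in>Basis. (u \<bullet> i) * S (i, 0) t)" for u t
  proof -
    have "linear (\<lambda>u. S (u, 0) t)"
      using linear_compose[OF _ lin[of t], of "\<lambda>u. (u, 0)"] by (simp add: o_def linear_iff)
    from linear_sum[OF this, of "\<lambda>i. (u \<bullet> i) *\<^sub>R i" Basis] show ?thesis
      by (simp add: euclidean_representation scale1)
  qed
  have V: "S (0, v) t = (\<Sum>j\<in>Basis. (v \<bullet> j) * S (0, j) t)" for v t
  proof -
    have "linear (\<lambda>v. S (0, v) t)"
      using linear_compose[OF _ lin[of t], of "\<lambda>v. (0, v)"] by (simp add: o_def linear_iff)
    from linear_sum[OF this, of "\<lambda>i. (v \<bullet> i) *\<^sub>R i" Basis] show ?thesis
      by (simp add: euclidean_representation scale2)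
  qed
  show ?thesis
  proof (cases "q = 2")
    case False
    then have q2: "q < 2" using q by simp
    \<comment> \<open>\<open>D\<close> is the pointwise defect in the power inequality. It is
      nonnegative with integral 0, and strictness leaves no point outside a null set where both
      functions are nonzero.\<close>
    have disj: "AE t in \<mu>. S (i, 0) t * S (0, j) t = 0" if ij: "i \<in> Basis" "j \<in> Basis" for i j
    proof -
      define D where "D t = 2 * (\<bar>S (i, 0) t\<bar> powr q + \<bar>S (0, j) t\<bar> powr q) - (\<bar>S (i, j) t\<bar> powr q + \<bar>S (i, - j) t\<bar> powr q)" for t
      have D_eq: "D t = 2 * (\<bar>S (i, 0) t\<bar> powr q + \<bar>S (0, j) t\<bar> powr q)
        - (\<bar>S (i, 0) t + S (0, j) t\<bar> powr q + \<bar>S (i, 0) t - S (0, j) t\<bar> powr q)" for t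
        unfolding D_def split[of i j] split[of i "- j"] neg by simp
      have Dnn: "0 \<le> D t" for t unfolding D_eq using abs_powr_parallelogram(1)[OF q] by simp
      have "(LINT t|\<mu>. D t) = 0"
        unfolding D_def using int fac[OF ij, of 1] fac[OF ij, of "-1"] by simp
      moreover have "integrable \<mu> D" unfolding D_def using int by simp
      ultimately have "AE t in \<mu>. D t = 0" using integral_nonneg_eq_0_iff_AE[of \<mu> D] Dnn by simp
      then show ?thesis
      proof eventually_elim
        case (elim t)
        show ?case
        proof (rule ccontr)
          assume "S (i, 0) t * S (0, j) t \<noteq> 0"
          then have "0 < D t" using abs_powr_parallelogram(2)[OF q q2, of "S (i, 0) t" "S (0, j) t"] unfolding D_eq by simp
          then show False using elim by simp
        qed
      qed
    qed
    then have "AE t in \<mu>. \<forall>i\<in>Basis. \<forall>j\<in>Basis. S (i, 0) t * S (0, j) t = 0"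
      by (intro AE_finite_allI) auto
    then have "AE t in \<mu>. \<bar>S (u, v) t\<bar> powr q = \<bar>S (u, 0) t\<bar> powr q + \<bar>S (0, v) t\<bar> powr q"
    proof eventually_elim
      case (elim t)
      have "S (u, 0) t * S (0, v) t = 0"
      proof (cases "\<forall>i\<in>Basis. S (i, 0) t = 0")
        case True then show ?thesis by (subst U) simp
      next
        case False
        then obtain i where "i \<in> Basis" "S (i, 0) t \<noteq> 0" by blast
        then have "\<forall>j\<in>Basis. S (0, j) t = 0" using elim by auto
        then show ?thesis by (subst V) simp
      qed
      then show ?case unfolding split[of u v] using q by auto
    qed
    then have "power_integral q \<mu> (S (u, v)) = (LINT t|\<mu>. \<bar>S (u, 0) t\<bar> powr q + \<bar>S (0, v) t\<bar> powr q)"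
      by (intro integral_cong_AE) auto
    then show ?thesis using int by simp
  next
    \<comment> \<open>Polarization writes the mixed product through squares, so additivity on a
      basis pair says that its integral vanishes; expanding in both blocks gives the general
      case.\<close>
    case True
    have pw: "\<bar>x\<bar> powr q = x\<^sup>2" for x :: real using True by (simp add: abs_powr_eq_power2)
    have int2: "integrable \<mu> (\<lambda>t. (S \<xi> t)\<^sup>2)" for \<xi> using int[of \<xi>] by (simp add: pw)
    have prod_eq: "S (x, 0) t * S (0, y) t = ((S (x, y) t)\<^sup>2 - (S (x, 0) t)\<^sup>2 - (S (0, y) t)\<^sup>2) / 2" for x y t
      unfolding split[of x y] by (simp add: power2_eq_square algebra_simps)
    have prod_int: "integrable \<mu> (\<lambda>t. S (x, 0) t * S (0, y) t)" for x y
      unfolding prod_eq using int2 by simp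
    have "(LINT t|\<mu>. S (i, 0) t * S (0, j) t) = 0" if ij: "i \<in> Basis" "j \<in> Basis" for i j
      unfolding prod_eq using int2 fac[OF ij, of 1] by (simp add: pw)
    moreover have "S (u, 0) t * S (0, v) t = (\<Sum>i\<in>Basis. \<Sum>j\<in>Basis. (u \<bullet> i) * (v \<bullet> j) * (S (i, 0) t * S (0, j) t))" for t
      unfolding U[of u] V[of v] sum_product by (simp add: mult_ac)
    ultimately have "(LINT t|\<mu>. S (u, 0) t * S (0, v) t) = 0"
      using prod_int by (simp add: Bochner_Integration.integral_sum)
    then show ?thesis unfolding prod_eq using int2 by (simp add: pw)
  qed
qed

text \<open>The arithmetic-geometric mean inequality for exp(-a) and exp(-b), from the square of a
  difference.\<close>

lemma exp_average_le: "exp (- ((a + b) / 2)) \<le> (exp (- a) + exp (- b)) / 2" for a b :: real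
proof -
  have "0 \<le> (exp (- a / 2) - exp (- b / 2))\<^sup>2" by simp
  also have "\<dots> = exp (- a) + exp (- b) - 2 * exp (- ((a + b) / 2))"
    by (simp add: power2_diff exp_double[symmetric] exp_add[symmetric] add_divide_distrib)
  finally show ?thesis by simp
qed

text \<open>The left side will be the characteristic function of \<open>Y\<close>, the right side
  that of \<open>X\<close> with a random sign on the second block. The power inequality is
  integrated, and then the exponential of the mean is bounded by the mean of the
  exponentials.\<close>

lemma stable_product_le_symmetrized:
  fixes S :: "'a::euclidean_space \<times> 'b::euclidean_space \<Rightarrow> real \<Rightarrow> real"
  assumes q: "0 < q" "q \<le> 2"
    and S: "\<And>\<xi>. in_Lp q \<mu> (S \<xi>)" and lin: "\<And>t. linear (\<lambda>\<xi>. S \<xi> t)"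
  shows "exp (- power_integral q \<mu> (S (u, 0))) * exp (- power_integral q \<mu> (S (0, v)))
    \<le> (exp (- power_integral q \<mu> (S (u, v))) + exp (- power_integral q \<mu> (S (u, - v)))) / 2"
proof -
  have int: "integrable \<mu> (\<lambda>t. \<bar>S \<xi> t\<bar> powr q)" for \<xi>
    using S[of \<xi>] by (auto simp: in_Lp_def)
  have split: "S (x, y) t = S (x, 0) t + S (0, y) t" for x y t
    using linear_add[OF lin[of t], of "(x, 0)" "(0, y)"] by simp
  have neg: "S (0, - y) t = - S (0, y) t" for y t
    using linear_scale[OF lin[of t], of "-1" "(0, y)"] by simp
  have half: "exp (- d) \<le> exp (- (c / 2))" if "c \<le> 2 * d" for c d :: real using that by simp
  have "power_integral q \<mu> (S (u, v)) + power_integral q \<mu> (S (u, - v))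
    = (LINT t|\<mu>. \<bar>S (u, v) t\<bar> powr q + \<bar>S (u, - v) t\<bar> powr q)" using int by simp
  also have "\<dots> \<le> (LINT t|\<mu>. 2 * (\<bar>S (u, 0) t\<bar> powr q + \<bar>S (0, v) t\<bar> powr q))"
  proof (rule integral_mono)
    show "\<bar>S (u, v) t\<bar> powr q + \<bar>S (u, - v) t\<bar> powr q \<le> 2 * (\<bar>S (u, 0) t\<bar> powr q + \<bar>S (0, v) t\<bar> powr q)" for t
      unfolding split[of u v] split[of u "- v"] neg using abs_powr_parallelogram(1)[OF q] by simp
  qed (use int in simp_all)
  also have "\<dots> = 2 * (power_integral q \<mu> (S (u, 0)) + power_integral q \<mu> (S (0, v)))" using int by simp
  finally have "exp (- (power_integral q \<mu> (S (u, 0)) + power_integral q \<mu> (S (0, v))))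
    \<le> exp (- ((power_integral q \<mu> (S (u, v)) + power_integral q \<mu> (S (u, - v))) / 2))"
    by (rule half)
  also have "\<dots> \<le> (exp (- power_integral q \<mu> (S (u, v))) + exp (- power_integral q \<mu> (S (u, - v)))) / 2"
    by (rule exp_average_le)
  finally show ?thesis by (simp add: exp_add[symmetric])
qed

lemma (in prob_space) integrable_cis:
  fixes X :: "'a \<Rightarrow> 'v::euclidean_space"
  assumes [measurable]: "X \<in> borel_measurable M"
  shows "integrable M (\<lambda>\<omega>. cis (\<xi> \<bullet> X \<omega>))"
proof (rule integrable_const_bound[where B=1])
  have [measurable]: "cis \<in> borel_measurable borel"
    by (intro borel_measurable_continuous_onI continuous_intros)
  show "(\<lambda>\<omega>. cis (\<xi> \<bullet> X \<omega>)) \<in> borel_measurable M" by measurable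
qed simp

text \<open>Independence of two single coordinates makes the exponent \<open>V\<close> additive on
  the corresponding basis vectors; stability then extends this to all frequencies through
  \<open>stable_product_factorizes\<close>.\<close>

lemma stable_characteristic_factorizes:
  fixes Y :: "'w \<Rightarrow> (real ^ 'k) \<times> (real ^ 'm)"
  assumes q: "0 < q" "q \<le> 2" and M: "prob_space M" and Y: "symmetric_stable q M Y"
    and indep: "\<And>(i::'k) (j::'m). prob_space.indep_var M borel (\<lambda>\<omega>. fst (Y \<omega>) $ i) borel (\<lambda>\<omega>. snd (Y \<omega>) $ j)"
  shows "(LINT \<omega>|M. cis ((u, v) \<bullet> Y \<omega>)) = (LINT \<omega>|M. cis (u \<bullet> fst (Y \<omega>))) * (LINT \<omega>|M. cis (v \<bullet> snd (Y \<omega>)))"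
proof -
  interpret prob_space M by fact
  have [measurable]: "Y \<in> borel_measurable M" using Y by (simp add: symmetric_stable_def)
  have [measurable]: "cis \<in> borel_measurable borel"
    by (intro borel_measurable_continuous_onI continuous_intros)
  obtain S :: "(real ^ 'k) \<times> (real ^ 'm) \<Rightarrow> real \<Rightarrow> real" where S: "\<And>\<xi>. in_Lp q (lebesgue_on {0..1}) (S \<xi>)"
    "\<And>t. linear (\<lambda>\<xi>. S \<xi> t)"
    "\<And>\<xi>. (LINT \<omega>|M. cis (\<xi> \<bullet> Y \<omega>)) = complex_of_real (exp (- power_integral q (lebesgue_on {0..1}) (S \<xi>)))"
    using symmetric_stableE[OF Y q(1)] by blast
  define V where "V \<xi> = power_integral q (lebesgue_on {0..1}) (S \<xi>)" for \<xi>
  have \<phi>: "(LINT \<omega>|M. cis (\<xi> \<bullet> Y \<omega>)) = complex_of_real (exp (- V \<xi>))" for \<xi>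
    unfolding V_def by (rule S(3))
  have V_neg: "V (- \<xi>) = V \<xi>" for \<xi>
  proof -
    have "S (- \<xi>) t = - S \<xi> t" for t using linear_neg[OF S(2)[of t]] .
    then show ?thesis by (simp add: V_def)
  qed
  have "V (u, v) = V (u, 0) + V (0, v)"
    unfolding V_def
  proof (rule stable_product_factorizes[OF q S(1,2)])
    fix i :: "real ^ 'k" and j :: "real ^ 'm" and c :: real
    assume "i \<in> Basis" "j \<in> Basis" and c: "\<bar>c\<bar> = 1"
    then obtain i' j' where ij: "i = axis i' 1" "j = axis j' 1" by (auto simp: Basis_vec_def)
    define a where "a \<omega> = fst (Y \<omega>) $ i'" for \<omega>
    define b where "b \<omega> = snd (Y \<omega>) $ j'" for \<omega>
    have iY: "i \<bullet> fst (Y \<omega>) = a \<omega>" and jY: "j \<bullet> snd (Y \<omega>) = b \<omega>" for \<omega>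
      by (simp_all add: ij a_def b_def inner_axis' inner_axis)
    have inner: "(i, c *\<^sub>R j) \<bullet> Y \<omega> = a \<omega> + c * b \<omega>" "(i, 0) \<bullet> Y \<omega> = a \<omega>" "(0, c *\<^sub>R j) \<bullet> Y \<omega> = c * b \<omega>" for \<omega>
      by (simp_all add: inner_prod_def iY jY)
    have "indep_var borel (cis \<circ> a) borel ((\<lambda>x. cis (c * x)) \<circ> b)"
      using indep[of i' j'] unfolding a_def[abs_def] b_def[abs_def] by (rule indep_var_compose) measurable
    then have ind: "indep_var borel (\<lambda>\<omega>. cis (a \<omega>)) borel (\<lambda>\<omega>. cis (c * b \<omega>))" by (simp add: o_def)
    have "(LINT \<omega>|M. cis (a \<omega>) * cis (c * b \<omega>)) = (LINT \<omega>|M. cis (a \<omega>)) * (LINT \<omega>|M. cis (c * b \<omega>))"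
    proof (rule indep_var_lebesgue_integral[OF ind])
      show "integrable M (\<lambda>\<omega>. cis (a \<omega>))" "integrable M (\<lambda>\<omega>. cis (c * b \<omega>))"
        using integrable_cis[of Y "(i, 0)"] integrable_cis[of Y "(0, c *\<^sub>R j)"] by (simp_all add: inner)
    qed
    then have "complex_of_real (exp (- V (i, c *\<^sub>R j))) = complex_of_real (exp (- V (i, 0))) * complex_of_real (exp (- V (0, c *\<^sub>R j)))"
      unfolding \<phi>[symmetric] inner by (simp add: cis_mult)
    then have "exp (- V (i, c *\<^sub>R j)) = exp (- V (i, 0) + - V (0, c *\<^sub>R j))"
      unfolding exp_add by (metis of_real_eq_iff of_real_mult)
    then have "V (i, c *\<^sub>R j) = V (i, 0) + V (0, c *\<^sub>R j)" by simp
    \<comment> \<open>\<open>V\<close> is even, so a sign in front of \<open>j\<close> does not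
      change its value.\<close>
    moreover have "V (0, c *\<^sub>R j) = V (0, j)"
      using c V_neg[of "(0, j)"] by (cases "0 \<le> c") auto
    ultimately show "power_integral q (lebesgue_on {0..1}) (S (i, c *\<^sub>R j))
      = power_integral q (lebesgue_on {0..1}) (S (i, 0)) + power_integral q (lebesgue_on {0..1}) (S (0, j))"
      by (simp add: V_def)
  qed
  then have "exp (- V (u, v)) = exp (- V (u, 0)) * exp (- V (0, v))" by (simp add: exp_add[symmetric])
  then have "(LINT \<omega>|M. cis ((u, v) \<bullet> Y \<omega>)) = (LINT \<omega>|M. cis ((u, 0) \<bullet> Y \<omega>)) * (LINT \<omega>|M. cis ((0, v) \<bullet> Y \<omega>))"
    unfolding \<phi> by (simp only: of_real_mult)
  then show ?thesis by (simp add: inner_prod_def)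
qed

section \<open>The random sign and the comparison of moments\<close>

abbreviation coin :: "'w measure \<Rightarrow> (bool \<times> 'w) measure" where
  "coin M \<equiv> measure_pmf (bernoulli_pmf (1 / 2)) \<Otimes>\<^sub>M M"

lemma integral_bernoulli_pair:
  fixes f :: "bool \<times> 'w \<Rightarrow> real"
  assumes M: "prob_space M" and f[measurable]: "f \<in> borel_measurable (coin M)"
    and bd: "\<And>z. \<bar>f z\<bar> \<le> B"
  shows "(\<integral>z. f z \<partial>(coin M)) = ((\<integral>\<omega>. f (True, \<omega>) \<partial>M) + (\<integral>\<omega>. f (False, \<omega>) \<partial>M)) / 2"
proof -
  interpret M: prob_space M by fact
  interpret pair_prob_space "measure_pmf (bernoulli_pmf (1 / 2))" M ..
  have "integrable (coin M) f"
    by (rule finite_measure_integrable_bounded[where B=B]) (auto simp: bd P.finite_measure_axioms)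
  from integral_fst'[OF this] show ?thesis by (simp add: field_simps)
qed

lemma nn_integral_bernoulli_pair:
  fixes f :: "bool \<times> 'w \<Rightarrow> ennreal"
  assumes M: "prob_space M" and f[measurable]: "f \<in> borel_measurable (coin M)"
    and g: "\<And>b \<omega>. f (b, \<omega>) = g \<omega>"
  shows "(\<integral>\<^sup>+z. f z \<partial>(coin M)) = (\<integral>\<^sup>+\<omega>. g \<omega> \<partial>M)"
proof -
  interpret M: prob_space M by fact
  interpret pair_prob_space "measure_pmf (bernoulli_pmf (1 / 2))" M ..
  have "(\<integral>\<^sup>+z. f z \<partial>(coin M)) = (\<integral>\<^sup>+b. \<integral>\<^sup>+\<omega>. f (b, \<omega>) \<partial>M \<partial>bernoulli_pmf (1 / 2))"
    by (rule M.nn_integral_fst[symmetric]) measurable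
  then show ?thesis by (simp add: g measure_pmf.emeasure_space_1)
qed

text \<open>The product type carries the block structure: the first k coordinates form the first
  component and the remaining n - k the second, so the symmetry condition is negation of the second
  component.\<close>

theorem corollary2:
  fixes k n :: nat
    and q p :: real
    and M :: "'w measure" and M' :: "'w2 measure" and \<mu> :: "'t measure"
    and X :: "'w \<Rightarrow> (real ^ 'k) \<times> (real ^ 'm)"
    and Y :: "'w2 \<Rightarrow> (real ^ 'k) \<times> (real ^ 'm)"
    and N :: "(real ^ 'k) \<times> (real ^ 'm) \<Rightarrow> real"
  assumes "0 < q" and "q \<le> 2"
    and "1 \<le> k" and "k < n"
    and "CARD('k) = k" and "CARD('m) = n - k"
    and "prob_space M" and "symmetric_stable q M X"
    and "prob_space M'" and "symmetric_stable q M' Y"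
    and "distr M' borel (\<lambda>\<omega>. fst (Y \<omega>)) = distr M borel (\<lambda>\<omega>. fst (X \<omega>))"
    and "distr M' borel (\<lambda>\<omega>. snd (Y \<omega>)) = distr M borel (\<lambda>\<omega>. snd (X \<omega>))"
    and "\<And>(i::'k) (j::'m).
           prob_space.indep_var M' borel (\<lambda>\<omega>. fst (Y \<omega>) $ i) borel (\<lambda>\<omega>. snd (Y \<omega>) $ j)"
    and "homogeneous_space N"
    and "0 < p" and "p < real n"
  assumes cases:
    "((\<forall>u v. N (u, v) = N (u, - v)) \<and> p \<in> {real n - 1..<real n}) \<or>
     ((\<exists>r. 0 < r \<and> r \<le> 2 \<and> subspace_of_Lp r \<mu> N) \<and>
        (\<forall>u v. N (u, v) = N (u, - v)) \<and> p \<in> {0<..<real n}) \<or>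
     ((\<exists>\<rho>. 2 < \<rho> \<and> \<rho> \<le> \<infinity> \<and> N = ell_norm \<rho>) \<and>
        3 \<le> n \<and> p \<in> {real n - 3..<real n})"
  shows "(\<integral>\<^sup>+ \<omega>. neg_power p (N (X \<omega>)) \<partial>M) \<ge> (\<integral>\<^sup>+ \<omega>. neg_power p (N (Y \<omega>)) \<partial>M')"
proof -
  note q = assms(1,2) and M = assms(7) and X = assms(8) and M' = assms(9) and Y = assms(10) and N = assms(14)
  interpret M: prob_space M by (rule M)
  interpret M': prob_space M' by (rule M')
  have Xm[measurable]: "X \<in> borel_measurable M" using X by (simp add: symmetric_stable_def)
  have Ym[measurable]: "Y \<in> borel_measurable M'" using Y by (simp add: symmetric_stable_def)
  have [measurable]: "cis \<in> borel_measurable borel"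
    by (intro borel_measurable_continuous_onI continuous_intros)
  note Nm[measurable] = homogeneous_space_measurable[OF N]
  have dim: "DIM((real ^ 'k) \<times> (real ^ 'm)) = n" using assms(3-6) by simp
  \<comment> \<open>In the third case the symmetry condition is automatic: each basis vector lies in
    one block, so negating a block leaves absolute values of coordinates unchanged.\<close>
  have even: "N (u, - v) = N (u, v)" for u v
    using cases
  proof (elim disjE conjE exE)
    fix \<rho> assume N: "N = ell_norm \<rho>"
    have "\<bar>(u, - v) \<bullet> b\<bar> = \<bar>(u, v) \<bullet> b\<bar>" if "b \<in> Basis" for b
      using that by (auto simp: Basis_prod_def)
    then show ?thesis unfolding N ell_norm_def by (auto intro!: arg_cong[where f=Max] image_cong)
  qed auto
  \<comment> \<open>The coin decides whether the second block of \<open>X\<close> is negated. The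
    cosine transform of the resulting law is the average of those for \<open>(u, v)\<close> and
    \<open>(u, - v)\<close>.\<close>
  define X' where "X' z = (if fst z then X (snd z) else (fst (X (snd z)), - snd (X (snd z))))" for z
  define P where "P = distr (coin M) borel X'"
  define Q where "Q = distr M' borel Y"
  have [measurable]: "fst \<in> borel_measurable (borel :: ((real ^ 'k) \<times> (real ^ 'm)) measure)"
    "snd \<in> borel_measurable (borel :: ((real ^ 'k) \<times> (real ^ 'm)) measure)"
    by (intro borel_measurable_continuous_onI continuous_intros)+
  have flip_m: "(\<lambda>x :: (real ^ 'k) \<times> (real ^ 'm). (fst x, - snd x)) \<in> borel_measurable borel"
    by (intro borel_measurable_continuous_onI continuous_intros)
  have fst_m: "Measurable.pred (coin M) fst"
    using measurable_compose[OF measurable_fst, of "\<lambda>b. b" "measure_pmf (bernoulli_pmf (1 / 2))" "count_space UNIV" M] by simp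
  have flip[measurable]: "X' \<in> borel_measurable (coin M)"
    unfolding X'_def[abs_def]
    by (intro measurable_If measurable_compose[OF measurable_snd Xm] measurable_compose[OF measurable_snd Xm, THEN measurable_compose, OF flip_m]) (use fst_m in simp)
  obtain S :: "(real ^ 'k) \<times> (real ^ 'm) \<Rightarrow> real \<Rightarrow> real" where S: "\<And>\<xi>. in_Lp q (lebesgue_on {0..1}) (S \<xi>)"
    "\<And>t. linear (\<lambda>\<xi>. S \<xi> t)"
    "\<And>\<xi>. (LINT \<omega>|M. cis (\<xi> \<bullet> X \<omega>)) = complex_of_real (exp (- power_integral q (lebesgue_on {0..1}) (S \<xi>)))"
    using symmetric_stableE[OF X q(1)] by blast
  define E where "E \<xi> = exp (- power_integral q (lebesgue_on {0..1}) (S \<xi>))" for \<xi>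
  have cosX: "(LINT \<omega>|M. cos (\<xi> \<bullet> X \<omega>)) = E \<xi>" for \<xi>
    using integral_Re[OF M.integrable_cis[OF Xm, of \<xi>]] by (simp add: S(3) E_def)
  \<comment> \<open>The block characteristic functions of \<open>Y\<close> agree with those of
    \<open>X\<close> by the equality of the marginal laws, so everything is expressed through the
    single family \<open>S\<close> belonging to \<open>X\<close>.\<close>
  have cosY: "(LINT \<omega>|M'. cos ((u, v) \<bullet> Y \<omega>)) = E (u, 0) * E (0, v)" for u v
  proof -
    have "(LINT \<omega>|M'. cis (u \<bullet> fst (Y \<omega>))) = (LINT x|distr M' borel (\<lambda>\<omega>. fst (Y \<omega>)). cis (u \<bullet> x))"
      by (subst integral_distr) auto
    also have "\<dots> = (LINT \<omega>|M. cis ((u, 0) \<bullet> X \<omega>))"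
      unfolding assms(11) by (subst integral_distr) (auto simp: inner_prod_def)
    finally have 1: "(LINT \<omega>|M'. cis (u \<bullet> fst (Y \<omega>))) = complex_of_real (E (u, 0))" by (simp add: S(3) E_def)
    have "(LINT \<omega>|M'. cis (v \<bullet> snd (Y \<omega>))) = (LINT x|distr M' borel (\<lambda>\<omega>. snd (Y \<omega>)). cis (v \<bullet> x))"
      by (subst integral_distr) auto
    also have "\<dots> = (LINT \<omega>|M. cis ((0, v) \<bullet> X \<omega>))"
      unfolding assms(12) by (subst integral_distr) (auto simp: inner_prod_def)
    finally have 2: "(LINT \<omega>|M'. cis (v \<bullet> snd (Y \<omega>))) = complex_of_real (E (0, v))" by (simp add: S(3) E_def)
    have "(LINT \<omega>|M'. cis ((u, v) \<bullet> Y \<omega>)) = complex_of_real (E (u, 0) * E (0, v))"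
      using stable_characteristic_factorizes[OF q M' Y assms(13), of u v] 1 2 by simp
    then show ?thesis using integral_Re[OF M'.integrable_cis[OF Ym, of "(u, v)"]] by simp
  qed
  interpret B: pair_prob_space "measure_pmf (bernoulli_pmf (1 / 2))" M ..
  interpret cos_dominated P Q
  proof (rule cos_dominated.intro)
    show "finite_measure P" unfolding P_def by (rule B.P.finite_measure_distr[OF flip])
    show "finite_measure Q" unfolding Q_def by (rule M'.finite_measure_distr[OF Ym])
    show "sets P = sets borel" "sets Q = sets borel" by (simp_all add: P_def Q_def)
    fix \<xi> :: "(real ^ 'k) \<times> (real ^ 'm)"
    define u v where "u = fst \<xi>" and "v = snd \<xi>"
    then have \<xi>: "\<xi> = (u, v)" by simp
    have "(\<integral>x. cos (x \<bullet> \<xi>) \<partial>Q) = E (u, 0) * E (0, v)"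
      unfolding Q_def by (subst integral_distr) (auto simp: cosY[symmetric] \<xi> inner_commute)
    also have "\<dots> \<le> (E (u, v) + E (u, - v)) / 2"
      unfolding E_def by (rule stable_product_le_symmetrized[OF q S(1,2)])
    also have "\<dots> = (\<integral>x. cos (x \<bullet> \<xi>) \<partial>P)"
    proof -
      have "(\<integral>x. cos (x \<bullet> \<xi>) \<partial>P) = (\<integral>z. cos (X' z \<bullet> \<xi>)
        \<partial>(coin M))"
        unfolding P_def by (subst integral_distr) auto
      also have "\<dots> = ((\<integral>\<omega>. cos (X \<omega> \<bullet> \<xi>) \<partial>M) + (\<integral>\<omega>. cos ((fst (X \<omega>), - snd (X \<omega>)) \<bullet> \<xi>) \<partial>M)) / 2"
        by (subst integral_bernoulli_pair[OF M, where B=1]) (auto simp: X'_def)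
      also have "(\<integral>\<omega>. cos (X \<omega> \<bullet> \<xi>) \<partial>M) = E (u, v)" by (simp add: cosX[symmetric] \<xi> inner_commute)
      also have "(\<integral>\<omega>. cos ((fst (X \<omega>), - snd (X \<omega>)) \<bullet> \<xi>) \<partial>M) = E (u, - v)"
        by (simp add: cosX[symmetric] \<xi> inner_commute inner_prod_def)
      finally show ?thesis by simp
    qed
    finally show "(\<integral>x. cos (x \<bullet> \<xi>) \<partial>Q) \<le> (\<integral>x. cos (x \<bullet> \<xi>) \<partial>P)" .
  qed
  have "(\<integral>\<^sup>+x. neg_power p (N x) \<partial>Q) \<le> (\<integral>\<^sup>+x. neg_power p (N x) \<partial>P)"
    using cases
  proof (elim disjE conjE exE)
    assume "p \<in> {real n - 1..<real n}"
    then show ?thesis using assms(15) dim by (intro neg_power_le_high_exponent[OF N]) auto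
  next
    fix r assume "0 < r" "r \<le> 2" "subspace_of_Lp r \<mu> N"
    then show ?thesis using assms(15) by (intro neg_power_le_Lp_norm[OF _ _ _ Nm]) auto
  next
    fix \<rho> :: ereal assume "2 < \<rho>" and N: "N = ell_norm \<rho>" and "p \<in> {real n - 3..<real n}"
    then show ?thesis unfolding N using assms(15) dim by (intro neg_power_le_ell_norm) auto
  qed
  moreover have "(\<integral>\<^sup>+x. neg_power p (N x) \<partial>Q) = (\<integral>\<^sup>+ \<omega>. neg_power p (N (Y \<omega>)) \<partial>M')"
    unfolding Q_def by (subst nn_integral_distr) auto
  \<comment> \<open>By \<open>even\<close>, \<open>N\<close> does not see the coin, so the integral
    over the enlarged space collapses to the one for \<open>X\<close>.\<close>
  moreover have "(\<integral>\<^sup>+x. neg_power p (N x) \<partial>P) = (\<integral>\<^sup>+ \<omega>. neg_power p (N (X \<omega>)) \<partial>M)"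
    unfolding P_def
    by (subst nn_integral_distr, simp, simp, rule nn_integral_bernoulli_pair[OF M]) (auto simp: X'_def even)
  ultimately show ?thesis by simp
qed

end
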